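(* Let $\alpha,\beta,\gamma\in\mathbb{R}$ be such that $1,\alpha,\beta$ are linearly independent over $\mathbb{Q}$, and let $(Z,T)$ be the 3-dimensional (Heisenberg) nil-flow with parameters $\alpha,\beta,\gamma$. Then the minimal flow $(Z,T)$ is relatively disjoint from $(|\mathcal{W}|,T)$ over its largest equicontinuous factor $(Y,T)$; i.e., the flow $\left(|\mathcal{W}|\times_Y Z,\;T\times T\right)$ is minimal.
   Context: A flow is a compact Hausdorff space with a self-homeomorphism $T$; it is minimal if every orbit is dense. A homomorphism of flows is a continuous surjective map commuting with $T$. Nil-flow: let $N$ be the group of real matrices $\begin{pmatrix}1&x&z\\0&1&y\\0&0&1\end{pmatrix}$, $\Gamma\subset N$ the subgroup of matrices with integer entries, $Z=N/\Gamma$, and let $T$ act on $Z$ by left translation $g\Gamma\mapsto (\tau g)\Gamma$ by the element $\tau=\begin{pmatrix}1&\alpha&\gamma+\frac12\alpha\beta\\0&1&\beta\\0&0&1\end{pmatrix}$. Its largest equicontinuous factor is $(Y,T)=(\mathbb{T}^2,R_\alpha\times R_\beta)\cong(N/B\Gamma,T)$, where $\mathbb{T}=\mathbb{R}/\mathbb{Z}$, $R_\theta$ is rotation by $\theta$, and $B\subset N$ is the subgroup of matrices with $x=y=0$; $\pi:Z\to Y$ is the canonical homomorphism $g\Gamma\mapsto gB\Gamma$. The Weyl algebra $\mathcal{W}$ is the smallest uniformly closed, translation invariant, conjugation-closed subalgebra (containing the constants) of $\ell^\infty(\mathbb{Z})$ containing all functions $n\mapsto e^{2\pi i n^k\theta}$,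 $\theta\in\mathbb{R}$, $k\in\mathbb{N}$. $|\mathcal{W}|$ is its Gelfand space, and $T$ on $|\mathcal{W}|$ is induced by translation on $\mathcal{W}$. Since $n\mapsto e^{2\pi i n\alpha}$ and $n\mapsto e^{2\pi i n\beta}$ are in $\mathcal{W}$, there is a corresponding canonical homomorphism $\phi:(|\mathcal{W}|,T)\to(Y,T)$. $|\mathcal{W}|\times_Y Z=\{(x,z)\in|\mathcal{W}|\times Z:\phi(x)=\pi(z)\}$. Relative disjointness over $Y$ means that this flow under $T\times T$ is minimal. *)

theory Defs
  imports "HOL-Analysis.Analysis" "HOL-Algebra.Left_Coset"
begin

section \<open>Flows\<close>

text \<open>
  Spaces are elements of \<^typ>\<open>'a topology\<close>; the values of a map outside
  \<^term>\<open>topspace X\<close> are irrelevant.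
\<close>

definition flow :: "'a topology \<Rightarrow> ('a \<Rightarrow> 'a) \<Rightarrow> bool" where
  "flow X T \<longleftrightarrow>
     topspace X \<noteq> {} \<and> compact_space X \<and> Hausdorff_space X \<and> homeomorphic_map X X T"

definition flow_power :: "'a topology \<Rightarrow> ('a \<Rightarrow> 'a) \<Rightarrow> int \<Rightarrow> 'a \<Rightarrow> 'a" where
  "flow_power X T n =
     (if 0 \<le> n then T ^^ nat n else inv_into (topspace X) T ^^ nat (- n))"

definition minimal_flow :: "'a topology \<Rightarrow> ('a \<Rightarrow> 'a) \<Rightarrow> bool" where
  "minimal_flow X T \<longleftrightarrow>
     flow X T \<and>
     (\<forall>x\<in>topspace X. X closure_of (range (\<lambda>n. flow_power X T n x)) = topspace X)"

definition flow_hom ::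
    "'a topology \<Rightarrow> ('a \<Rightarrow> 'a) \<Rightarrow> 'b topology \<Rightarrow> ('b \<Rightarrow> 'b) \<Rightarrow> ('a \<Rightarrow> 'b) \<Rightarrow> bool" where
  "flow_hom X T Y S p \<longleftrightarrow>
     flow X T \<and> flow Y S \<and>
     continuous_map X Y p \<and> p ` topspace X = topspace Y \<and>
     (\<forall>x\<in>topspace X. p (T x) = S (p x))"

text \<open>
  The unique uniformity of a compact Hausdorff space consists of the neighbourhoods of the
  diagonal.
\<close>

definition equicontinuous_flow :: "'a topology \<Rightarrow> ('a \<Rightarrow> 'a) \<Rightarrow> bool" where
  "equicontinuous_flow X T \<longleftrightarrow>
     flow X T \<and>
     (\<forall>U. openin (prod_topology X X) U \<and> (\<forall>x\<in>topspace X. (x, x) \<in> U) \<longrightarrow>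
        (\<exists>V. openin (prod_topology X X) V \<and> (\<forall>x\<in>topspace X. (x, x) \<in> V) \<and>
             (\<forall>(x, y)\<in>V. \<forall>n. (flow_power X T n x, flow_power X T n y) \<in> U)))"

text \<open>
  Every equicontinuous factor of \<open>(X, T)\<close> factors through \<open>p\<close>.  A factor of \<open>X\<close> is isomorphic
  to one whose points are the fibres of the factor map, so it suffices to let the competing
  factors range over the topologies on \<^typ>\<open>'a set\<close>.
\<close>

definition largest_equicontinuous_factor ::
    "'a topology \<Rightarrow> ('a \<Rightarrow> 'a) \<Rightarrow> 'b topology \<Rightarrow> ('b \<Rightarrow> 'b) \<Rightarrow> ('a \<Rightarrow> 'b) \<Rightarrow> bool" where
  "largest_equicontinuous_factor X T Y S p \<longleftrightarrow>
     flow_hom X T Y S p \<and> equicontinuous_flow Y S \<and>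
     (\<forall>(E :: 'a set topology) R q.
        equicontinuous_flow E R \<and> flow_hom X T E R q \<longrightarrow>
        (\<exists>r. flow_hom Y S E R r \<and> (\<forall>x\<in>topspace X. q x = r (p x))))"

definition fiber_product ::
    "'a topology \<Rightarrow> ('a \<Rightarrow> 'c) \<Rightarrow> 'b topology \<Rightarrow> ('b \<Rightarrow> 'c) \<Rightarrow> ('a \<times> 'b) topology" where
  "fiber_product X p Z q =
     subtopology (prod_topology X Z) {(x, z). x \<in> topspace X \<and> z \<in> topspace Z \<and> p x = q z}"

definition relatively_disjoint_over ::
    "'a topology \<Rightarrow> ('a \<Rightarrow> 'a) \<Rightarrow> ('a \<Rightarrow> 'c) \<Rightarrow>
     'b topology \<Rightarrow> ('b \<Rightarrow> 'b) \<Rightarrow> ('b \<Rightarrow> 'c) \<Rightarrow>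
     'c topology \<Rightarrow> ('c \<Rightarrow> 'c) \<Rightarrow> bool" where
  "relatively_disjoint_over X T p Z S q Y R \<longleftrightarrow>
     flow_hom X T Y R p \<and> flow_hom Z S Y R q \<and>
     minimal_flow (fiber_product X p Z q) (map_prod T S)"


section \<open>The Heisenberg nil-flow\<close>

definition quotient_topology :: "'a topology \<Rightarrow> ('a \<Rightarrow> 'b) \<Rightarrow> 'b topology" where
  "quotient_topology X q =
     topology (\<lambda>U. U \<subseteq> q ` topspace X \<and> openin X {x \<in> topspace X. q x \<in> U})"

lemma openin_quotient_topology:
  "openin (quotient_topology X q) U \<longleftrightarrow>
     U \<subseteq> q ` topspace X \<and> openin X {x \<in> topspace X. q x \<in> U}"
proof -
  have "istopology (\<lambda>U. U \<subseteq> q ` topspace X \<and> openin X {x \<in> topspace X. q x \<in> U})"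
    unfolding istopology_def
  proof (intro conjI allI impI)
    fix S T
    assume "S \<subseteq> q ` topspace X \<and> openin X {x \<in> topspace X. q x \<in> S}"
      and "T \<subseteq> q ` topspace X \<and> openin X {x \<in> topspace X. q x \<in> T}"
    moreover have "{x \<in> topspace X. q x \<in> S \<inter> T} =
        {x \<in> topspace X. q x \<in> S} \<inter> {x \<in> topspace X. q x \<in> T}"
      by auto
    ultimately show "S \<inter> T \<subseteq> q ` topspace X" "openin X {x \<in> topspace X. q x \<in> S \<inter> T}"
      by auto
  next
    fix K
    assume K: "\<forall>S\<in>K. S \<subseteq> q ` topspace X \<and> openin X {x \<in> topspace X. q x \<in> S}"
    then show "\<Union>K \<subseteq> q ` topspace X"
      by auto
    have "{x \<in> topspace X. q x \<in> \<Union>K} = \<Union>((\<lambda>S. {x \<in> topspace X. q x \<in> S}) ` K)"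
      by auto
    with K show "openin X {x \<in> topspace X. q x \<in> \<Union>K}"
      by auto
  qed
  then show ?thesis
    by (simp add: quotient_topology_def)
qed

lemma topspace_quotient_topology: "topspace (quotient_topology X q) = q ` topspace X"
proof (rule antisym)
  show "topspace (quotient_topology X q) \<subseteq> q ` topspace X"
    using openin_quotient_topology openin_topspace by metis
  have "{x \<in> topspace X. q x \<in> q ` topspace X} = topspace X"
    by auto
  then have "openin (quotient_topology X q) (q ` topspace X)"
    by (simp add: openin_quotient_topology)
  then show "q ` topspace X \<subseteq> topspace (quotient_topology X q)"
    by (rule openin_subset)
qed

definition heis :: "real \<Rightarrow> real \<Rightarrow> real \<Rightarrow> real^3^3" where
  "heis x y z = vector [vector [1, x, z], vector [0, 1, y], vector [0, 0, 1]]"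

definition heis_group :: "(real^3^3) monoid" where
  "heis_group = \<lparr>carrier = {heis x y z | x y z. True}, mult = (**), one = mat 1\<rparr>"

definition heis_lattice :: "(real^3^3) set" where
  "heis_lattice = {heis x y z | x y z. x \<in> \<int> \<and> y \<in> \<int> \<and> z \<in> \<int>}"

definition heis_center :: "(real^3^3) set" where
  "heis_center = {heis 0 0 z | z. True}"

text \<open>The space \<open>N/H\<close> of left cosets of \<open>H\<close> in the Heisenberg group \<open>N\<close>.\<close>

definition heis_quotient :: "(real^3^3) set \<Rightarrow> (real^3^3) set topology" where
  "heis_quotient H =
     quotient_topology (top_of_set (carrier heis_group)) (\<lambda>g. g <#\<^bsub>heis_group\<^esub> H)"

lemma topspace_heis_quotient: "topspace (heis_quotient H) = lcosets\<^bsub>heis_group\<^esub> H"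
  by (auto simp: heis_quotient_def topspace_quotient_topology LCOSETS_def)

definition heis_tau :: "real \<Rightarrow> real \<Rightarrow> real \<Rightarrow> real^3^3" where
  "heis_tau \<alpha> \<beta> \<gamma> = heis \<alpha> \<beta> (\<gamma> + \<alpha> * \<beta> / 2)"

text \<open>Left translation by \<open>\<tau>\<close>, acting on the left cosets of any subgroup.\<close>

definition nil_translation ::
    "real \<Rightarrow> real \<Rightarrow> real \<Rightarrow> (real^3^3) set \<Rightarrow> (real^3^3) set" where
  "nil_translation \<alpha> \<beta> \<gamma> C = heis_tau \<alpha> \<beta> \<gamma> <#\<^bsub>heis_group\<^esub> C"

definition nil_space :: "(real^3^3) set topology" where
  "nil_space = heis_quotient heis_lattice"

text \<open>
  The torus \<open>Y\<close> is taken in the form \<open>N/B\<Gamma>\<close>.  The coset of \<^term>\<open>heis x y z\<close> corresponds to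
  \<open>(x + \<int>, y + \<int>)\<close>, and left translation by \<open>\<tau>\<close> to the rotation by \<open>(\<alpha>, \<beta>)\<close>.
\<close>

definition center_lattice :: "(real^3^3) set" where
  "center_lattice = heis_center <#>\<^bsub>heis_group\<^esub> heis_lattice"

definition torus_space :: "(real^3^3) set topology" where
  "torus_space = heis_quotient center_lattice"

text \<open>\<open>g\<Gamma> \<mapsto> gB\<Gamma>\<close>; this is \<open>C \<mapsto> C B\<Gamma>\<close>, because \<open>B\<close> is central.\<close>

definition nil_proj :: "(real^3^3) set \<Rightarrow> (real^3^3) set" where
  "nil_proj C = C <#>\<^bsub>heis_group\<^esub> center_lattice"


section \<open>The Weyl algebra and its Gelfand space\<close>

definition ell_infty :: "(int \<Rightarrow> complex) set" where
  "ell_infty = {f. bounded (range f)}"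

definition unital_subalgebra :: "(int \<Rightarrow> complex) set \<Rightarrow> bool" where
  "unital_subalgebra A \<longleftrightarrow>
     A \<subseteq> ell_infty \<and> (\<forall>c. (\<lambda>n. c) \<in> A) \<and>
     (\<forall>f\<in>A. \<forall>g\<in>A. (\<lambda>n. f n + g n) \<in> A \<and> (\<lambda>n. f n * g n) \<in> A)"

definition conj_closed :: "(int \<Rightarrow> complex) set \<Rightarrow> bool" where
  "conj_closed A \<longleftrightarrow> (\<forall>f\<in>A. (\<lambda>n. cnj (f n)) \<in> A)"

definition translation_invariant :: "(int \<Rightarrow> complex) set \<Rightarrow> bool" where
  "translation_invariant A \<longleftrightarrow> (\<forall>f\<in>A. \<forall>m. (\<lambda>n. f (n + m)) \<in> A)"

definition uniformly_closed :: "(int \<Rightarrow> complex) set \<Rightarrow> bool" where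
  "uniformly_closed A \<longleftrightarrow>
     (\<forall>F f. (\<forall>k. F k \<in> A) \<and> uniform_limit UNIV F f sequentially \<longrightarrow> f \<in> A)"

definition weyl_function :: "nat \<Rightarrow> real \<Rightarrow> int \<Rightarrow> complex" where
  "weyl_function k \<theta> n = cis (2 * pi * (of_int n ^ k * \<theta>))"

definition weyl_algebra :: "(int \<Rightarrow> complex) set" where
  "weyl_algebra =
     \<Inter>{A. unital_subalgebra A \<and> conj_closed A \<and> translation_invariant A \<and>
          uniformly_closed A \<and> (\<forall>k \<theta>. weyl_function k \<theta> \<in> A)}"

text \<open>
  Unital complex algebra homomorphisms \<open>A \<rightarrow> \<complex>\<close>, made \<^const>\<open>extensional\<close> so that they are
  determined by their values on \<open>A\<close>, with the topology of pointwise convergence on \<open>A\<close>.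
\<close>

definition characters :: "(int \<Rightarrow> complex) set \<Rightarrow> ((int \<Rightarrow> complex) \<Rightarrow> complex) set" where
  "characters A =
     {\<xi> \<in> extensional A.
        \<xi> (\<lambda>n. 1) = 1 \<and>
        (\<forall>c. \<forall>f\<in>A. \<xi> (\<lambda>n. c * f n) = c * \<xi> f) \<and>
        (\<forall>f\<in>A. \<forall>g\<in>A. \<xi> (\<lambda>n. f n + g n) = \<xi> f + \<xi> g \<and> \<xi> (\<lambda>n. f n * g n) = \<xi> f * \<xi> g)}"

definition gelfand_space ::
    "(int \<Rightarrow> complex) set \<Rightarrow> ((int \<Rightarrow> complex) \<Rightarrow> complex) topology" where
  "gelfand_space A = subtopology (product_topology (\<lambda>f. euclidean) A) (characters A)"

definition gelfand_shift ::
    "(int \<Rightarrow> complex) set \<Rightarrow> ((int \<Rightarrow> complex) \<Rightarrow> complex) \<Rightarrow> (int \<Rightarrow> complex) \<Rightarrow> complex" where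
  "gelfand_shift A \<xi> = (\<lambda>f\<in>A. \<xi> (\<lambda>n. f (n + 1)))"

text \<open>
  The values of \<open>\<xi>\<close> at \<open>n \<mapsto> e(n\<alpha>)\<close> and \<open>n \<mapsto> e(n\<beta>)\<close> are \<open>e(x)\<close> and \<open>e(y)\<close> for a unique
  \<open>(x + \<int>, y + \<int>)\<close>, where \<open>e(t) = exp (2\<pi>it)\<close>; the right-hand side is the corresponding
  coset of \<open>B\<Gamma>\<close>, see \<open>weyl_proj_eq_coset\<close>.
\<close>

definition weyl_proj ::
    "real \<Rightarrow> real \<Rightarrow> ((int \<Rightarrow> complex) \<Rightarrow> complex) \<Rightarrow> (real^3^3) set" where
  "weyl_proj \<alpha> \<beta> \<xi> =
     {heis x y z | x y z.
        cis (2 * pi * x) = \<xi> (weyl_function 1 \<alpha>) \<and> cis (2 * pi * y) = \<xi> (weyl_function 1 \<beta>)}"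

lemma heis_mult: "heis a b c ** heis x y z = heis (a + x) (b + y) (c + z + a * y)"
  by (simp add: heis_def vec_eq_iff matrix_matrix_mult_def sum_3 forall_3 algebra_simps)

lemma heis_eq_iff: "heis a b c = heis x y z \<longleftrightarrow> a = x \<and> b = y \<and> c = z"
  by (auto simp: heis_def vec_eq_iff forall_3)

lemma cis_2pi_eq_iff: "cis (2 * pi * x) = cis (2 * pi * a) \<longleftrightarrow> x - a \<in> \<int>"
proof -
  have "cis (2 * pi * x) = cis (2 * pi * a) \<longleftrightarrow> cis (2 * pi * (x - a)) = 1"
    by (simp add: right_diff_distrib flip: cis_divide)
  also have "\<dots> \<longleftrightarrow> cos (2 * pi * (x - a)) = 1"
    by (auto simp: complex_eq_iff cos_one_sin_zero)
  also have "\<dots> \<longleftrightarrow> x - a \<in> \<int>"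
    by (auto simp: cos_one_2pi_int Ints_def)
  finally show ?thesis .
qed

lemma weyl_proj_eq_coset:
  assumes "\<xi> (weyl_function 1 \<alpha>) = cis (2 * pi * a)" and "\<xi> (weyl_function 1 \<beta>) = cis (2 * pi * b)"
  shows "weyl_proj \<alpha> \<beta> \<xi> = heis a b c <#\<^bsub>heis_group\<^esub> center_lattice"
proof -
  have mult: "mult heis_group = (**)"
    by (simp add: heis_group_def)
  have B: "center_lattice = {heis x y z | x y z. x \<in> \<int> \<and> y \<in> \<int>}"
  proof (rule Set.set_eqI)
    fix g
    have "g \<in> center_lattice" if "g = heis x y z" "x \<in> \<int>" "y \<in> \<int>" for x y z
    proof -
      have "g = heis 0 0 z ** heis x y 0"
        using that by (simp add: heis_mult)
      moreover have "heis 0 0 z \<in> heis_center" "heis x y 0 \<in> heis_lattice"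
        using that Ints_0 unfolding heis_center_def heis_lattice_def by blast+
      ultimately show ?thesis
        unfolding center_lattice_def set_mult_def mult by blast
    qed
    then show "g \<in> center_lattice \<longleftrightarrow> g \<in> {heis x y z | x y z. x \<in> \<int> \<and> y \<in> \<int>}"
      by (auto simp: center_lattice_def set_mult_def mult heis_center_def heis_lattice_def heis_mult heis_eq_iff)
  qed
  have "heis a b c <#\<^bsub>heis_group\<^esub> center_lattice = {heis x y z | x y z. x - a \<in> \<int> \<and> y - b \<in> \<int>}"
  proof (rule Set.set_eqI)
    fix g
    have "g \<in> heis a b c <#\<^bsub>heis_group\<^esub> center_lattice"
      if "g = heis x y z" "x - a \<in> \<int>" "y - b \<in> \<int>" for x y z
    proof -
      have "g = heis a b c ** heis (x - a) (y - b) (z - c - a * (y - b))"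
        using that by (simp add: heis_mult)
      with that show ?thesis
        unfolding l_coset_def mult B by blast
    qed
    then show "g \<in> heis a b c <#\<^bsub>heis_group\<^esub> center_lattice \<longleftrightarrow>
        g \<in> {heis x y z | x y z. x - a \<in> \<int> \<and> y - b \<in> \<int>}"
      by (force simp: l_coset_def mult B heis_mult heis_eq_iff)
  qed
  also have "\<dots> = weyl_proj \<alpha> \<beta> \<xi>"
    unfolding weyl_proj_def assms cis_2pi_eq_iff ..
  finally show ?thesis ..
qed

end

theory Submission
  imports Defs "HOL-Computational_Algebra.Fundamental_Theorem_Algebra"
begin

text \<open>
  Write \<open>e(t) = exp (2\<pi>it)\<close>.  The orbit of the coset of \<open>(x, y, z)\<close> under the nil-translation is
  \<open>(x\<^sub>n, y\<^sub>n, z\<^sub>n) = (x + n\<alpha>, y + n\<beta>, z + n\<gamma> + n\<^sup>2\<alpha>\<beta>/2 + n\<alpha>y)\<close>.  Modulo \<open>1\<close> the first two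
  coordinates describe the image in the torus \<open>Y\<close>.  Where \<open>y - y0\<close> is not an integer, the number
  \<open>z - x\<lfloor>y - y0\<rfloor>\<close> modulo \<open>1\<close> is a continuous coordinate on the fibres of \<open>Z \<rightarrow> Y\<close>; let \<open>\<zeta>\<^sub>n\<close> be its
  value along the orbit.

  To steer the orbit of \<open>(\<xi>, C)\<close> in the fibre product into a neighbourhood of \<open>(\<xi>', C')\<close>, take a
  nonnegative \<open>w\<close> in the Weyl algebra that is positive at \<open>\<xi>'\<close> and vanishes off a small neighbourhood
  of \<open>\<xi>'\<close>.  At a time \<open>n\<close> of positive weight \<open>\<xi>(w(\<cdot> + n))\<close> the first component is near \<open>\<xi>'\<close>, and
  then the second one is near the fibre that contains \<open>C'\<close>, because both components have the same
  image in \<open>Y\<close>.  So it suffices that \<open>\<zeta>\<^sub>n\<close> is equidistributed modulo \<open>1\<close> with respect to these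
  weights, which by Weyl's criterion means that
  \<open>\<Sum>n<N. \<xi>(f(\<cdot> + n)) sin\<^sup>2(\<pi>(y\<^sub>n - y0)) e(m\<zeta>\<^sub>n) = o(N)\<close> for \<open>f\<close> in the Weyl algebra and \<open>m \<noteq> 0\<close>.
  The factor \<open>sin\<^sup>2\<close> removes the discontinuity of the coordinate.  Characters of the algebra are limits
  of point evaluations (\<open>char_approx\<close>), so \<open>\<xi>(f(\<cdot> + n))\<close> may be replaced by \<open>f(s + n)\<close>, provided that
  the estimate is uniform in the integer \<open>s\<close>; and \<open>f\<close> may be taken to be \<open>n \<mapsto> e(p(n))\<close> with a real
  polynomial \<open>p\<close>, since these functions span a dense subspace.

  The estimate is \<open>null_means_fiber_poly_phase\<close>, and it holds by the van der Corput trick.  Apart from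
  a constant and a function of \<open>y\<^sub>n\<close>, the difference \<open>\<zeta>\<^bsub>n+h\<^esub> - \<zeta>\<^sub>n\<close> equals \<open>- nk\<alpha>\<close>, where \<open>k\<close> is the number of
  points of \<open>y0 + \<int>\<close> that the second coordinate crosses in \<open>h\<close> steps, so that \<open>\<bar>k - h\<beta>\<bar> \<le> 1\<close>.  The correlations
  are therefore Weyl sums of the polynomials \<open>p(n + h) - p(n) - mk\<alpha>n + l\<beta>n\<close>.  If the linear coefficient
  is rational, apply a \<open>\<rat>\<close>-linear map \<open>\<phi> : \<real> \<rightarrow> \<real>\<close> with \<open>\<phi>(\<alpha>) = 1\<close> and \<open>\<phi>(\<beta>) = \<phi>(1) = 0\<close>: a fixed
  polynomial in \<open>h\<close> without constant term takes the value \<open>mk\<close>, hence stays within \<open>\<bar>m\<bar>\<close> of \<open>mh\<beta>\<close>.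
  For infinitely many \<open>h\<close> this forces that polynomial to be \<open>mh\<beta>\<close>, and then \<open>\<beta> = k/h\<close> is rational.
  So only finitely many \<open>h\<close> are exceptional (\<open>large_times_nonresonant\<close>).

  The criterion is of use only if the weights do not have mean zero.  This is
  \<open>weyl_algebra_positive_means\<close>, a quantitative form of the minimality of the Gelfand space: finitely
  many polynomial phases return simultaneously to their values at a given point with positive density,
  because products of Fejer-like kernels have nonnegative Fourier coefficients.

  Minimality of \<open>Z\<close> follows by projection.  Every equicontinuous factor of \<open>Z\<close> factors through \<open>Y\<close>
  because shearing is fast: moving \<open>y\<close> by \<open>c/(n\<alpha>)\<close> displaces the \<open>n\<close>-th point of the orbit by
  \<open>c\<close> in the central direction, up to an error that tends to \<open>0\<close>.  Hence some pair of points at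
  distance \<open>c\<close> in a fibre is identified (\<open>equicontinuous_factor_merges_vertical_pair\<close>), and by minimality
  all such pairs are.
\<close>


section \<open>Null means and the van der Corput trick\<close>

text \<open>
  In the applications \<open>s\<close> is a translation of the sequence.  Uniformity in \<open>s\<close> makes the means of the
  translates of a function small in the supremum norm, and therefore also their values under
  a character.
\<close>
definition null_means :: "('s \<Rightarrow> nat \<Rightarrow> complex) \<Rightarrow> bool" where
  "null_means u \<longleftrightarrow>
     (\<forall>\<epsilon>>0. \<forall>\<^sub>F N in sequentially. \<forall>s. cmod (\<Sum>n<N. u s n) \<le> \<epsilon> * real N)"

lemma null_meansD:
  "null_means u \<Longrightarrow> \<epsilon> > 0 \<Longrightarrow> \<forall>\<^sub>F N in sequentially. \<forall>s. cmod (\<Sum>n<N. u s n) \<le> \<epsilon> * real N"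
  by (simp add: null_means_def)

lemma null_means_zero: "null_means (\<lambda>s n. 0)"
  by (simp add: null_means_def)

lemma null_means_add:
  assumes "null_means u" "null_means v"
  shows "null_means (\<lambda>s n. u s n + v s n)"
  unfolding null_means_def
proof (intro allI impI)
  fix \<epsilon> :: real assume "\<epsilon> > 0"
  then have "\<epsilon>/2 > 0" by simp
  from null_meansD[OF assms(1) this] null_meansD[OF assms(2) this]
  show "\<forall>\<^sub>F N in sequentially. \<forall>s. cmod (\<Sum>n<N. u s n + v s n) \<le> \<epsilon> * real N"
  proof eventually_elim
    case (elim N)
    show ?case
    proof
      fix s
      have "cmod (\<Sum>n<N. u s n + v s n) \<le> cmod (\<Sum>n<N. u s n) + cmod (\<Sum>n<N. v s n)"
        by (simp add: sum.distrib norm_triangle_ineq)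
      with elim[THEN spec, of s] show "cmod (\<Sum>n<N. u s n + v s n) \<le> \<epsilon> * real N"
        by simp
    qed
  qed
qed

lemma null_means_sum:
  assumes "\<And>i. i \<in> I \<Longrightarrow> null_means (u i)"
  shows "null_means (\<lambda>s n. \<Sum>i\<in>I. u i s n)"
  using assms
  by (induction I rule: infinite_finite_induct) (auto intro: null_means_zero null_means_add)

text \<open>The coefficient may depend on \<open>s\<close>, as long as it is bounded.\<close>

lemma null_means_mult:
  assumes "null_means u" "\<And>s. cmod (c s) \<le> C"
  shows "null_means (\<lambda>s n. c s * u s n)"
  unfolding null_means_def
proof (intro allI impI)
  fix \<epsilon> :: real assume "\<epsilon> > 0"
  have "C \<ge> 0" using assms(2)[of undefined] norm_ge_zero order_trans by blast
  then have "\<epsilon>/(C+1) > 0" using \<open>\<epsilon> > 0\<close> by simp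
  from null_meansD[OF assms(1) this]
  show "\<forall>\<^sub>F N in sequentially. \<forall>s. cmod (\<Sum>n<N. c s * u s n) \<le> \<epsilon> * real N"
  proof eventually_elim
    case (elim N)
    show ?case
    proof
      fix s
      have "cmod (\<Sum>n<N. c s * u s n) = cmod (c s) * cmod (\<Sum>n<N. u s n)"
        by (simp add: norm_mult flip: sum_distrib_left)
      also have "\<dots> \<le> (C+1) * (\<epsilon>/(C+1) * N)"
        using elim[THEN spec, of s] assms(2)[of s] \<open>C \<ge> 0\<close> by (intro mult_mono) auto
      also have "\<dots> = \<epsilon> * N" using \<open>C \<ge> 0\<close> by simp
      finally show "cmod (\<Sum>n<N. c s * u s n) \<le> \<epsilon> * real N" .
    qed
  qed
qed

lemma null_means_approx:
  assumes "\<And>\<epsilon>. \<epsilon> > 0 \<Longrightarrow> \<exists>v. null_means v \<and> (\<forall>s n. cmod (u s n - v s n) \<le> \<epsilon>)"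
  shows "null_means u"
  unfolding null_means_def
proof (intro allI impI)
  fix \<epsilon> :: real assume "\<epsilon> > 0"
  then have e2: "\<epsilon>/2 > 0" by simp
  from assms[OF this] obtain v where v: "null_means v" "\<And>s n. cmod (u s n - v s n) \<le> \<epsilon>/2" by blast
  from null_meansD[OF v(1) e2]
  show "\<forall>\<^sub>F N in sequentially. \<forall>s. cmod (\<Sum>n<N. u s n) \<le> \<epsilon> * real N"
  proof eventually_elim
    case (elim N)
    show ?case
    proof
      fix s
      have "cmod ((\<Sum>n<N. u s n) - (\<Sum>n<N. v s n)) \<le> (\<Sum>n<N. \<epsilon>/2)"
        unfolding sum_subtractf[symmetric] by (rule sum_norm_le) (rule v(2))
      then have "cmod (\<Sum>n<N. u s n) \<le> cmod (\<Sum>n<N. v s n) + N * (\<epsilon>/2)"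
        using norm_triangle_ineq2[of "\<Sum>n<N. u s n" "\<Sum>n<N. v s n"] by simp
      with elim[THEN spec, of s] show "cmod (\<Sum>n<N. u s n) \<le> \<epsilon> * real N"
        by (simp add: algebra_simps)
    qed
  qed
qed

text \<open>Only \<open>h\<close> terms at either end differ.\<close>
lemma cmod_sum_shift_le:
  fixes f :: "nat \<Rightarrow> complex"
  assumes "\<And>n. cmod (f n) \<le> M"
  shows "cmod ((\<Sum>n<N. f (n + h)) - (\<Sum>n<N. f n)) \<le> 2 * M * h"
proof -
  have "(\<Sum>n<N. f (n + h)) - (\<Sum>n<N. f n) = (\<Sum>n<h. f (n + N)) - (\<Sum>n<h. f n)"
  proof -
    have A: "(\<Sum>n<a. f (n + b)) = (\<Sum>n<a+b. f n) - (\<Sum>n<b. f n)" for a b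
      by (induction a) auto
    show ?thesis unfolding A by (simp add: add.commute)
  qed
  also have "cmod \<dots> \<le> cmod (\<Sum>n<h. f (n + N)) + cmod (\<Sum>n<h. f n)"
    by (rule norm_triangle_ineq4)
  also have "\<dots> \<le> (\<Sum>n<h. M) + (\<Sum>n<h. M)"
    by (intro add_mono sum_norm_le assms)
  finally show ?thesis by simp
qed

lemma eventually_const_le_real: "\<epsilon> > 0 \<Longrightarrow> \<forall>\<^sub>F N in sequentially. c \<le> \<epsilon> * real N"
  using eventually_ge_at_top[of "nat \<lceil>c / \<epsilon>\<rceil>"]
  by eventually_elim (simp add: nat_le_iff ceiling_le_iff field_simps)

lemma null_means_shift:
  assumes "null_means u" "\<And>s n. cmod (u s n) \<le> M"
  shows "null_means (\<lambda>s n. u s (n + h))"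
  unfolding null_means_def
proof (intro allI impI)
  fix \<epsilon> :: real assume "\<epsilon> > 0"
  then have e2: "\<epsilon>/2 > 0" by simp
  from null_meansD[OF assms(1) e2] eventually_const_le_real[OF e2, of "2 * M * h"]
  show "\<forall>\<^sub>F N in sequentially. \<forall>s. cmod (\<Sum>n<N. u s (n + h)) \<le> \<epsilon> * real N"
  proof eventually_elim
    case (elim N)
    show ?case
    proof
      fix s
      have "cmod (\<Sum>n<N. u s (n + h)) \<le> cmod (\<Sum>n<N. u s n) + 2 * M * h"
        using norm_triangle_ineq2[of "\<Sum>n<N. u s (n+h)" "\<Sum>n<N. u s n"]
          cmod_sum_shift_le[of "u s" M h N] assms(2) by simp
      with elim(1)[THEN spec, of s] elim(2) show "cmod (\<Sum>n<N. u s (n + h)) \<le> \<epsilon> * real N" 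
        by (simp add: algebra_simps)
    qed
  qed
qed

lemma null_means_cnj: "null_means u \<Longrightarrow> null_means (\<lambda>s n. cnj (u s n))"
  unfolding null_means_def cnj_sum[symmetric] complex_mod_cnj .

lemma cmod_sum_power2_le:
  fixes f :: "nat \<Rightarrow> complex"
  shows "(cmod (\<Sum>n<N. f n))\<^sup>2 \<le> N * (\<Sum>n<N. (cmod (f n))\<^sup>2)"
proof -
  have "(cmod (\<Sum>n<N. f n))\<^sup>2 \<le> (\<Sum>n<N. cmod (f n))\<^sup>2"
    by (intro power_mono norm_sum) auto
  also have "\<dots> = (\<Sum>n<N. 1 * cmod (f n))\<^sup>2" by simp
  also have "\<dots> \<le> (\<Sum>n<N. 1\<^sup>2) * (\<Sum>n<N. (cmod (f n))\<^sup>2)"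
    by (rule Cauchy_Schwarz_ineq_sum)
  finally show ?thesis by simp
qed

text \<open>
  The mean of \<open>u\<close> is almost the mean of \<open>(1/K) \<Sum>k<K. u(n + kg)\<close>, whose mean square is at most
  \<open>M\<^sup>2/K\<close> up to correlations of \<open>u\<close> at the distances \<open>(k - l)g\<close>.  A spacing \<open>g > h0\<close> makes all of
  these null, so that finitely many bad distances do no harm.
\<close>
theorem van_der_Corput:
  fixes u :: "'s \<Rightarrow> nat \<Rightarrow> complex"
  assumes bound: "\<And>s n. cmod (u s n) \<le> M"
    and corr: "\<And>h. h \<ge> h0 \<Longrightarrow> null_means (\<lambda>s n. u s (n + h) * cnj (u s n))"
  shows "null_means u"
  unfolding null_means_def
proof (intro allI impI)
  fix \<epsilon> :: real assume "\<epsilon> > 0"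
  have M0: "M \<ge> 0" using bound[of undefined undefined] norm_ge_zero order_trans by blast
  define g where "g = Suc h0"
  obtain K :: nat where K: "K > 0" "M\<^sup>2 / K \<le> (\<epsilon>/2)\<^sup>2 / 2"
  proof -
    have "\<forall>\<^sub>F K in sequentially. M\<^sup>2 / real K \<le> (\<epsilon>/2)\<^sup>2 / 2"
      using \<open>\<epsilon> > 0\<close> by real_asymp
    from eventually_happens[OF eventually_conj[OF eventually_gt_at_top[of 0] this]]
    show ?thesis using that by auto
  qed
  define v where "v s n = (\<Sum>k<K. u s (n + k * g))" for s n
  have off_gt: "null_means (\<lambda>s n. u s (n + k * g) * cnj (u s (n + l * g)))" if "k > l" for k l
  proof -
    have "h0 \<le> (k - l) * g" using that unfolding g_def by (cases "k - l") auto
    have eq: "n + l * g + (k - l) * g = n + k * g" for n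
      using that by (metis add.assoc add_mult_distrib le_add_diff_inverse less_imp_le)
    have "cmod (u s (n + (k - l) * g) * cnj (u s n)) \<le> M * M" for s n
      unfolding norm_mult complex_mod_cnj by (intro mult_mono bound M0) auto
    from null_means_shift[OF corr[OF \<open>h0 \<le> (k - l) * g\<close>] this, of "l * g"]
    show ?thesis unfolding eq .
  qed
  have off: "null_means (\<lambda>s n. u s (n + k * g) * cnj (u s (n + l * g)))" if "k \<noteq> l" for k l
  proof (cases "k > l")
    case True
    then show ?thesis by (rule off_gt)
  next
    case False
    then have "l > k" using that by simp
    from null_means_cnj[OF off_gt[OF this]] show ?thesis by (simp add: mult.commute)
  qed
  define w where "w s n = (\<Sum>(k,l)\<in>{(k,l). k < K \<and> l < K \<and> k \<noteq> l}.
      u s (n + k * g) * cnj (u s (n + l * g)))" for s n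
  have w: "null_means w"
    unfolding w_def case_prod_unfold by (intro null_means_sum off) auto
  have vw: "of_real ((cmod (v s n))\<^sup>2) = (\<Sum>k<K. of_real ((cmod (u s (n + k * g)))\<^sup>2)) + w s n" for s n
  proof -
    have "of_real ((cmod (v s n))\<^sup>2) = (\<Sum>(k,l)\<in>{..<K}\<times>{..<K}. u s (n + k * g) * cnj (u s (n + l * g)))"
      unfolding complex_norm_square v_def cnj_sum sum_product sum.cartesian_product ..
    also have "{..<K}\<times>{..<K} = (\<lambda>k. (k,k)) ` {..<K} \<union> {(k,l). k < K \<and> l < K \<and> k \<noteq> l}"
      by auto
    also have "(\<Sum>(k,l)\<in>\<dots>. u s (n + k * g) * cnj (u s (n + l * g))) =
       (\<Sum>(k,l)\<in>(\<lambda>k. (k,k)) ` {..<K}. u s (n + k * g) * cnj (u s (n + l * g))) + w s n"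
      unfolding w_def
      by (rule sum.union_disjoint) (auto intro: finite_subset[of _ "{..<K}\<times>{..<K}"])
    also have "(\<Sum>(k,l)\<in>(\<lambda>k. (k,k)) ` {..<K}. u s (n + k * g) * cnj (u s (n + l * g))) =
       (\<Sum>k<K. of_real ((cmod (u s (n + k * g)))\<^sup>2))"
      by (subst sum.reindex) (auto simp: inj_on_def complex_norm_square simp del: of_real_power)
    finally show ?thesis .
  qed
  have pos: "(\<epsilon>/2)\<^sup>2 * K\<^sup>2 / 2 > 0" "\<epsilon>/2 > 0" using \<open>\<epsilon> > 0\<close> K by auto
  from null_meansD[OF w pos(1)] eventually_const_le_real[OF pos(2), of "2 * M * (K * g)"]
  show "\<forall>\<^sub>F N in sequentially. \<forall>s. cmod (\<Sum>n<N. u s n) \<le> \<epsilon> * real N"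
  proof eventually_elim
    case (elim N)
    show ?case
    proof
      fix s
      have "complex_of_real (\<Sum>n<N. (cmod (v s n))\<^sup>2) =
          of_real (\<Sum>n<N. \<Sum>k<K. (cmod (u s (n + k * g)))\<^sup>2) + (\<Sum>n<N. w s n)"
        using vw by (simp add: sum.distrib)
      then have "(\<Sum>n<N. (cmod (v s n))\<^sup>2) = (\<Sum>n<N. \<Sum>k<K. (cmod (u s (n + k * g)))\<^sup>2) + Re (\<Sum>n<N. w s n)"
        by (metis Re_complex_of_real plus_complex.sel(1))
      also have "\<dots> \<le> (\<Sum>n<N. \<Sum>k<K. M\<^sup>2) + (\<epsilon>/2)\<^sup>2 * K\<^sup>2 / 2 * N"
        using elim(1)[THEN spec, of s] complex_Re_le_cmod[of "\<Sum>n<N. w s n"]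
        by (intro add_mono sum_mono power_mono bound) auto
      also have "\<dots> = N * (K\<^sup>2 * (M\<^sup>2 / K)) + (\<epsilon>/2)\<^sup>2 * K\<^sup>2 / 2 * N"
        using K by (simp add: power2_eq_square)
      also have "\<dots> \<le> N * (K\<^sup>2 * ((\<epsilon>/2)\<^sup>2 / 2)) + (\<epsilon>/2)\<^sup>2 * K\<^sup>2 / 2 * N"
        by (intro add_mono mult_left_mono K order_refl) auto
      also have "\<dots> = N * (K * (\<epsilon>/2))\<^sup>2" by (simp add: power_mult_distrib field_simps)
      finally have "N * (\<Sum>n<N. (cmod (v s n))\<^sup>2) \<le> N * (N * (K * (\<epsilon>/2))\<^sup>2)"
        by (intro mult_left_mono) auto
      also have "\<dots> = (N * (K * (\<epsilon>/2)))\<^sup>2" by (simp add: power2_eq_square)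
      finally have "(cmod (\<Sum>n<N. v s n))\<^sup>2 \<le> (N * (K * (\<epsilon>/2)))\<^sup>2"
        using cmod_sum_power2_le[of "v s" N] by linarith
      then have v_le: "cmod (\<Sum>n<N. v s n) \<le> N * (K * (\<epsilon>/2))"
        using \<open>\<epsilon> > 0\<close> by (auto dest: power2_le_imp_le)
      have "(\<Sum>n<N. v s n) - K * (\<Sum>n<N. u s n) = (\<Sum>k<K. (\<Sum>n<N. u s (n + k * g)) - (\<Sum>n<N. u s n))"
        unfolding v_def by (subst sum.swap) (simp add: sum_subtractf)
      also have "cmod \<dots> \<le> (\<Sum>k<K. 2 * M * (K * g))"
      proof (rule sum_norm_le)
        fix k assume "k \<in> {..<K}"
        have "cmod ((\<Sum>n<N. u s (n + k * g)) - (\<Sum>n<N. u s n)) \<le> 2 * M * real (k * g)"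
          by (rule cmod_sum_shift_le[OF bound])
        also have "\<dots> \<le> 2 * M * real (K * g)"
          using \<open>k \<in> _\<close> M0 by (intro mult_left_mono) (auto intro!: mult_right_mono)
        finally show "cmod ((\<Sum>n<N. u s (n + k * g)) - (\<Sum>n<N. u s n)) \<le> 2 * M * (K * g)" by simp
      qed
      finally have "cmod (K * (\<Sum>n<N. u s n)) \<le> N * (K * (\<epsilon>/2)) + K * (2 * M * (K * g))"
        using v_le norm_triangle_ineq2[of "K * (\<Sum>n<N. u s n)" "\<Sum>n<N. v s n"]
        by (simp add: norm_minus_commute)
      also have "\<dots> \<le> N * (K * (\<epsilon>/2)) + K * (\<epsilon>/2 * N)"
        by (intro add_left_mono mult_left_mono) (use elim(2) in auto)
      also have "\<dots> = K * (\<epsilon> * N)" by (simp add: field_simps)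
      finally show "cmod (\<Sum>n<N. u s n) \<le> \<epsilon> * real N" using K
        by (simp add: norm_mult)
    qed
  qed
qed


section \<open>Weyl sums\<close>

text \<open>The additive character \<open>e(t) = exp (2\<pi>it)\<close> of \<open>\<real>/\<int>\<close>.\<close>
definition ee :: "real \<Rightarrow> complex" where "ee t = cis (2 * pi * t)"

lemma ee_0 [simp]: "ee 0 = 1" by (simp add: ee_def)
lemma ee_add: "ee (a + b) = ee a * ee b" by (simp add: ee_def cis_mult distrib_left)
lemma cmod_ee [simp]: "cmod (ee t) = 1" by (simp add: ee_def)
lemma cnj_ee: "cnj (ee t) = ee (- t)" by (simp add: ee_def cis_cnj)
lemma ee_eq_iff: "ee x = ee y \<longleftrightarrow> x - y \<in> \<int>" unfolding ee_def by (rule cis_2pi_eq_iff)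
lemma ee_eq_1_iff: "ee x = 1 \<longleftrightarrow> x \<in> \<int>" using ee_eq_iff[of x 0] by simp
lemma continuous_on_ee [continuous_intros]:
  "continuous_on S f \<Longrightarrow> continuous_on S (\<lambda>t. ee (f t))"
  unfolding ee_def by (intro continuous_intros)

lemma unit_eq_ee:
  assumes "cmod z = 1"
  obtains x where "z = ee x"
proof -
  have "z = ee (Arg2pi z / (2 * pi))" using Arg2pi_eq[of z] assms by (simp add: ee_def cis_conv_exp)
  then show ?thesis by (rule that)
qed

lemma cmod_ee_diff: "cmod (ee t - ee s) = cmod (ee (t - s) - 1)"
proof -
  have "ee t - ee s = ee s * (ee (t - s) - 1)" by (simp add: algebra_simps flip: ee_add)
  then show ?thesis by (simp add: norm_mult)
qed

definition poly_phase :: "real poly \<Rightarrow> int \<Rightarrow> complex" where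
  "poly_phase p n = ee (poly p (of_int n))"

lemma cmod_poly_phase [simp]: "cmod (poly_phase p n) = 1" by (simp add: poly_phase_def)

lemma poly_phase_add: "poly_phase (p + q) n = poly_phase p n * poly_phase q n"
  by (simp add: poly_phase_def ee_add)

definition shift_diff :: "real \<Rightarrow> real poly \<Rightarrow> real poly" where
  "shift_diff h p = p \<circ>\<^sub>p [:h, 1:] - p"

lemma poly_shift_diff: "poly (shift_diff h p) x = poly p (x + h) - poly p x"
  by (simp add: shift_diff_def poly_pcompose add.commute)

lemma shift_diff_add: "shift_diff h (p + q) = shift_diff h p + shift_diff h q"
  by (simp add: shift_diff_def pcompose_add)

lemma shift_diff_pCons:
  "shift_diff h (pCons a q) = pCons 0 (shift_diff h q) + smult h (q \<circ>\<^sub>p [:h, 1:])"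
  by (simp add: shift_diff_def pcompose_pCons)

lemma coeff_pcompose_shift:
  fixes p :: "real poly"
  assumes "degree p \<le> d"
  shows "coeff (p \<circ>\<^sub>p [:h, 1:]) d = coeff p d"
proof (cases "degree p = d")
  case True
  then show ?thesis using lead_coeff_comp[of "[:h, 1:]" p] by (simp add: degree_pcompose)
next
  case False
  then show ?thesis using assms by (simp add: coeff_eq_0 degree_pcompose)
qed

text \<open>Differencing lowers the degree by one and keeps an irrational leading coefficient irrational.\<close>
lemma coeff_shift_diff:
  assumes "degree p \<le> Suc d"
  shows "degree (shift_diff h p) \<le> d \<and> coeff (shift_diff h p) d = real (Suc d) * h * coeff p (Suc d)"
  using assms
proof (induction d arbitrary: p)
  case 0
  obtain a q where p: "p = pCons a q" by (cases p)
  with 0 have "degree q = 0" by (auto split: if_splits)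
  then obtain b where "q = [:b:]" by (rule degree_eq_zeroE)
  then show ?case by (simp add: p shift_diff_def pcompose_pCons)
next
  case (Suc d)
  obtain a q where p: "p = pCons a q" by (cases p)
  with Suc.prems have q: "degree q \<le> Suc d" by (auto split: if_splits)
  note IH = Suc.IH[OF q]
  have "degree (pCons 0 (shift_diff h q)) \<le> Suc d" using IH by (simp add: degree_pCons_le le_trans)
  moreover have "degree (smult h (q \<circ>\<^sub>p [:h, 1:])) \<le> Suc d"
    using q by (simp add: degree_pcompose)
  ultimately have "degree (shift_diff h p) \<le> Suc d"
    unfolding p shift_diff_pCons by (rule degree_add_le)
  then show ?case
    using IH q unfolding p shift_diff_pCons by (simp add: coeff_pcompose_shift algebra_simps)
qed

lemma Rats_coeff_shift_diff:
  assumes "\<And>i. coeff r i \<in> \<rat>" "h \<in> \<rat>"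
  shows "coeff (shift_diff h r) i \<in> \<rat>"
proof -
  have "\<forall>i. coeff (r \<circ>\<^sub>p [:h, 1:]) i \<in> \<rat>" using assms(1)
  proof (induction r)
    case (pCons a p)
    have "coeff p i \<in> \<rat>" for i using pCons.prems[of "Suc i"] by simp
    then have "\<forall>i. coeff (p \<circ>\<^sub>p [:h, 1:]) i \<in> \<rat>" by (rule pCons.IH)
    moreover have "a \<in> \<rat>" using pCons.prems[of 0] by simp
    ultimately show ?case using assms(2) 
      by (auto simp: pcompose_pCons coeff_pCons split: nat.split)
  qed simp
  then show ?thesis using assms(1) by (simp add: shift_diff_def)
qed

lemma common_denominator:
  assumes "\<And>i. coeff (r::real poly) i \<in> \<rat>"
  obtains q :: nat where "q > 0" "\<And>i. real q * coeff r i \<in> \<int>"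
proof -
  have "\<exists>q::nat. q > 0 \<and> (\<forall>i. real q * coeff r i \<in> \<int>)" using assms
  proof (induction r)
    case 0
    then show ?case by (auto intro!: exI[of _ 1])
  next
    case (pCons a p)
    have "coeff p i \<in> \<rat>" for i using pCons.prems[of "Suc i"] by simp
    from pCons.IH[OF this] obtain q :: nat where q: "q > 0" "\<And>i. real q * coeff p i \<in> \<int>" by blast
    have "a \<in> \<rat>" using pCons.prems[of 0] by simp
    then obtain j k :: int where a: "k > 0" "a = of_int j / of_int k" by (metis Rats_cases')
    define q' where "q' = nat k * q"
    have "real q' * coeff (pCons a p) i \<in> \<int>" for i
    proof (cases i)
      case 0
      have "real q' * a = of_int (int q * j)" using a by (simp add: q'_def)
      then show ?thesis using 0 Ints_of_int by (metis coeff_pCons_0)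
    next
      case (Suc i')
      have "real q' * coeff p i' = of_int k * (real q * coeff p i')" using a by (simp add: q'_def)
      moreover have "of_int k * (real q * coeff p i') \<in> \<int>" by (intro Ints_mult q(2)) auto
      ultimately show ?thesis using Suc by (metis coeff_pCons_Suc)
    qed
    moreover have "q' > 0" using a q by (simp add: q'_def)
    ultimately show ?case by blast
  qed
  then show ?thesis using that by blast
qed

text \<open>
  Over \<open>q\<close> steps \<open>n p(n)\<close> changes by \<open>n (p(n + q) - p(n)) + q p(n + q)\<close>, which is an integer by induction.
\<close>
lemma poly_period_Ints:
  assumes "\<And>i. real q * coeff r i \<in> \<int>"
  shows "poly r (of_int n + real q) - poly r (of_int n) \<in> \<int>" "real q * poly r (of_int k) \<in> \<int>"
proof -
  have "(\<forall>k. real q * poly r (of_int k) \<in> \<int>) \<and> (\<forall>n. poly r (of_int n + real q) - poly r (of_int n) \<in> \<int>)"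
    using assms
  proof (induction r)
    case (pCons a p)
    have "real q * coeff p i \<in> \<int>" for i using pCons.prems[of "Suc i"] by simp
    from pCons.IH[OF this] have
      IH: "\<And>k. real q * poly p (of_int k) \<in> \<int>" "\<And>n. poly p (of_int n + real q) - poly p (of_int n) \<in> \<int>"
      by auto
    have a: "real q * a \<in> \<int>" using pCons.prems[of 0] by simp
    have "real q * poly (pCons a p) (of_int k) = real q * a + of_int k * (real q * poly p (of_int k))" for k
      by (simp add: algebra_simps)
    then have "\<forall>k. real q * poly (pCons a p) (of_int k) \<in> \<int>" using a IH by simp
    moreover have "poly (pCons a p) (of_int n + real q) - poly (pCons a p) (of_int n) =
        of_int n * (poly p (of_int n + real q) - poly p (of_int n)) + real q * poly p (of_int (n + int q))" for n
      by (simp add: algebra_simps)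
    then have "\<forall>n. poly (pCons a p) (of_int n + real q) - poly (pCons a p) (of_int n) \<in> \<int>"
      using IH by (metis Ints_add Ints_mult Ints_of_int)
    ultimately show ?case by blast
  qed simp
  then show "poly r (of_int n + real q) - poly r (of_int n) \<in> \<int>" "real q * poly r (of_int k) \<in> \<int>"
    by auto
qed

text \<open>
  Shifting by \<open>q\<close> multiplies the sums by \<open>c\<close> but changes them by a bounded amount only.
\<close>
lemma null_means_quasi_periodic:
  assumes "\<And>s n. u s (n + q) = c * u s n" "c \<noteq> 1" "\<And>s n. cmod (u s n) \<le> M"
  shows "null_means u"
  unfolding null_means_def
proof (intro allI impI)
  fix \<epsilon> :: real assume "\<epsilon> > 0"
  then have "\<epsilon> * cmod (c - 1) > 0" using assms(2) by simp
  from eventually_const_le_real[OF this, of "2 * M * q"]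
  show "\<forall>\<^sub>F N in sequentially. \<forall>s. cmod (\<Sum>n<N. u s n) \<le> \<epsilon> * real N"
  proof eventually_elim
    case (elim N)
    show ?case
    proof
      fix s
      have "(\<Sum>n<N. u s (n + q)) - (\<Sum>n<N. u s n) = (c - 1) * (\<Sum>n<N. u s n)"
        unfolding assms(1) by (simp add: left_diff_distrib sum_distrib_left sum_subtractf)
      then have "cmod (c - 1) * cmod (\<Sum>n<N. u s n) \<le> 2 * M * q"
        using cmod_sum_shift_le[of "u s" M q N] assms(3) by (metis norm_mult)
      also have "\<dots> \<le> cmod (c - 1) * (\<epsilon> * N)" using elim by (simp add: mult_ac)
      finally show "cmod (\<Sum>n<N. u s n) \<le> \<epsilon> * real N" using assms(2) by simp
    qed
  qed
qed

text \<open>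
  Differencing reduces to \<open>p\<close> of degree one.  The rational part \<open>r\<close> is carried along because it may
  have larger degree than \<open>p\<close>; in the end it contributes only a periodic factor.
\<close>
lemma null_means_Weyl_aux:
  assumes "degree p \<le> Suc d" "coeff p (Suc d) \<notin> \<rat>" "\<And>i. coeff r i \<in> \<rat>"
  shows "null_means (\<lambda>s n. poly_phase (p + r) (s + int n))"
  using assms
proof (induction d arbitrary: p r)
  case 0
  obtain q where q: "q > 0" "\<And>i. real q * coeff r i \<in> \<int>" using common_denominator[OF 0(3)] by blast
  define a where "a = coeff p 1"
  have a: "a \<notin> \<rat>" using 0 by (simp add: a_def)
  have p: "poly p x = coeff p 0 + x * a" for x
    using 0(1) by (cases "degree p = 0") (auto simp: poly_altdef a_def coeff_eq_0 le_Suc_eq)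
  have "poly_phase (p + r) (s + int (n + q)) = ee (real q * a) * poly_phase (p + r) (s + int n)" for s n
  proof -
    have "poly r (of_int (s + int n) + real q) - poly r (of_int (s + int n)) \<in> \<int>"
      by (rule poly_period_Ints(1)[OF q(2)])
    then show ?thesis
      unfolding poly_phase_def ee_add[symmetric] ee_eq_iff by (simp add: p algebra_simps)
  qed
  moreover have "ee (real q * a) \<noteq> 1"
  proof
    assume "ee (real q * a) = 1"
    then have "real q * a \<in> \<rat>" using Ints_subset_Rats by (auto simp: ee_eq_1_iff)
    then have "real q * a / real q \<in> \<rat>" by (rule Rats_divide) auto
    then show False using q a by simp
  qed
  ultimately show ?case by (rule null_means_quasi_periodic[where M=1]) simp
next
  case (Suc d)
  show ?case
  proof (rule van_der_Corput[where M=1 and ?h0.0=1])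
    fix h :: nat assume h: "h \<ge> 1"
    have *: "degree (shift_diff (real h) p) \<le> Suc d \<and>
       coeff (shift_diff (real h) p) (Suc d) = real (Suc (Suc d)) * real h * coeff p (Suc (Suc d))"
      by (rule coeff_shift_diff[OF Suc.prems(1)])
    have irr: "coeff (shift_diff (real h) p) (Suc d) \<notin> \<rat>"
    proof
      assume "coeff (shift_diff (real h) p) (Suc d) \<in> \<rat>"
      then have "coeff (shift_diff (real h) p) (Suc d) / (real (Suc (Suc d)) * real h) \<in> \<rat>"
        by (intro Rats_divide Rats_mult) auto
      then have "coeff p (Suc (Suc d)) \<in> \<rat>" using * h by simp
      then show False using Suc.prems by simp
    qed
    have "null_means (\<lambda>s n. poly_phase (shift_diff h p + shift_diff h r) (s + int n))"
      using Suc.IH[OF _ irr] * Rats_coeff_shift_diff[OF Suc.prems(3)] by auto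
    moreover have "poly_phase (p + r) (s + int (n + h)) * cnj (poly_phase (p + r) (s + int n)) =
       poly_phase (shift_diff h p + shift_diff h r) (s + int n)" for s n
      unfolding poly_phase_def cnj_ee ee_add[symmetric] shift_diff_add[symmetric] poly_shift_diff
      by (simp add: algebra_simps)
    ultimately show "null_means (\<lambda>s n. poly_phase (p + r) (s + int (n + h)) * cnj (poly_phase (p + r) (s + int n)))"
      by simp
  qed simp
qed

text \<open>
  The part of \<open>p\<close> above its highest irrational coefficient is the rational part of the previous lemma.
\<close>
theorem null_means_Weyl:
  assumes "i \<ge> 1" "coeff p i \<notin> \<rat>"
  shows "null_means (\<lambda>s n. poly_phase p (s + int n))"
proof -
  define I where "I = {i. coeff p i \<notin> \<rat>}"
  have "I \<subseteq> {..degree p}" by (auto simp: I_def intro: le_degree)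
  then have fin: "finite I" using finite_subset by blast
  have "i \<in> I" using assms by (simp add: I_def)
  define d where "d = Max I - 1"
  have "Max I \<in> I" "Max I \<ge> i" using fin \<open>i \<in> I\<close> by (auto intro!: Max_in)
  then have d: "Suc d = Max I" "coeff p (Suc d) \<notin> \<rat>" using assms by (auto simp: d_def I_def)
  have rat: "coeff p j \<in> \<rat>" if "j > Suc d" for j
  proof (rule ccontr)
    assume "coeff p j \<notin> \<rat>"
    then have "j \<le> Max I" using fin by (simp add: I_def)
    then show False using that d(1) by simp
  qed
  define p1 where "p1 = poly_cutoff (Suc (Suc d)) p"
  have "degree p1 \<le> Suc d" by (rule degree_le) (auto simp: p1_def coeff_poly_cutoff)
  moreover have "coeff p1 (Suc d) \<notin> \<rat>" using d by (simp add: p1_def coeff_poly_cutoff)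
  moreover have "coeff (p - p1) j \<in> \<rat>" for j using rat[of j] by (auto simp: p1_def coeff_poly_cutoff)
  ultimately have "null_means (\<lambda>s n. poly_phase (p1 + (p - p1)) (s + int n))"
    by (rule null_means_Weyl_aux)
  then show ?thesis by simp
qed


section \<open>Trigonometric approximation and resonances\<close>

inductive_set trig_polys :: "(real \<Rightarrow> complex) set" where
  monomial: "(\<lambda>t. c * ee (of_int l * t)) \<in> trig_polys"
| add: "f \<in> trig_polys \<Longrightarrow> g \<in> trig_polys \<Longrightarrow> (\<lambda>t. f t + g t) \<in> trig_polys"

lemma trig_polys_const: "(\<lambda>t. c) \<in> trig_polys"
  using trig_polys.monomial[of c 0] by simp

lemma trig_polys_mult:
  assumes "f \<in> trig_polys" "g \<in> trig_polys"
  shows "(\<lambda>t. f t * g t) \<in> trig_polys"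
  using assms
proof (induction f arbitrary: g)
  case (monomial c l)
  from monomial show ?case
  proof (induction g)
    case (monomial d k)
    have "(\<lambda>t. c * ee (of_int l * t) * (d * ee (of_int k * t))) = (\<lambda>t. (c * d) * ee (of_int (l + k) * t))"
      by (simp only: of_int_add distrib_left distrib_right ee_add mult_ac)
    then show ?case by (simp only: trig_polys.monomial)
  next
    case (add f g)
    then show ?case using trig_polys.add by (simp add: distrib_left)
  qed
next
  case (add f h)
  then show ?case using trig_polys.add by (simp add: distrib_right)
qed

lemma Re_Im_ee: "of_real (Re (ee t)) = 1/2 * ee (of_int 1 * t) + 1/2 * ee (of_int (-1) * t)"
  "of_real (Im (ee t)) = - \<i>/2 * ee (of_int 1 * t) + \<i>/2 * ee (of_int (-1) * t)"
  by (auto simp: ee_def complex_eq_iff)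

text \<open>Real and imaginary part of \<open>e(t)\<close> are trigonometric polynomials, so polynomials in them are.\<close>
lemma real_polynomial_trig:
  fixes p :: "complex \<Rightarrow> real"
  assumes "real_polynomial_function p"
  shows "(\<lambda>t. of_real (p (ee t))) \<in> trig_polys"
  using assms
proof (induction p)
  case (linear f)
  interpret f: bounded_linear f by fact
  have eq: "f z = Re z * f 1 + Im z * f \<i>" for z
  proof -
    have "z = Re z *\<^sub>R 1 + Im z *\<^sub>R \<i>" by (simp add: complex_eq_iff)
    then have "f z = f (Re z *\<^sub>R 1 + Im z *\<^sub>R \<i>)" by simp
    then show ?thesis by (simp add: f.add f.scaleR)
  qed
  have "(\<lambda>t. complex_of_real (f (ee t))) =
    (\<lambda>t. (of_real (f 1) * (1/2 * ee (of_int 1 * t)) + of_real (f 1) * (1/2 * ee (of_int (-1) * t))) +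
         (of_real (f \<i>) * (- \<i>/2 * ee (of_int 1 * t)) + of_real (f \<i>) * (\<i>/2 * ee (of_int (-1) * t))))"
    by (subst eq) (simp only: of_real_add of_real_mult Re_Im_ee algebra_simps)
  also have "\<dots> \<in> trig_polys"
    unfolding mult.assoc[symmetric] by (intro trig_polys.intros)
  finally show ?case .
next
  case (const c)
  show ?case by (rule trig_polys_const)
next
  case (add f g)
  then show ?case by (simp add: trig_polys.add)
next
  case (mult f g)
  then show ?case by (simp add: trig_polys_mult)
qed

lemma periodic_of_int:
  fixes B :: "real \<Rightarrow> 'a"
  assumes "\<And>t. B (t + 1) = B t"
  shows "B (t + of_int k) = B t"
proof (induction k rule: int_induct[where k=0])
  case (step1 i)
  then show ?case using assms[of "t + of_int i"] by (simp add: algebra_simps)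
next
  case (step2 i)
  then show ?case using assms[of "t + of_int (i - 1)"] by (simp add: algebra_simps)
qed simp

text \<open>
  A continuous function of period \<open>1\<close> is a continuous function on the unit circle, where
  the Stone-Weierstrass theorem applies.  Continuity passes to the circle because \<open>e\<close> maps the
  compact interval \<open>[0, 1]\<close> onto it and is therefore closed.
\<close>
theorem periodic_trig_approx:
  fixes B :: "real \<Rightarrow> complex"
  assumes cont: "continuous_on UNIV B" and per: "\<And>t. B (t + 1) = B t" and "\<epsilon> > 0"
  obtains g where "g \<in> trig_polys" "\<And>t. cmod (B t - g t) \<le> \<epsilon>"
proof -
  have per': "B t = B s" if "ee t = ee s" for s t
  proof -
    from that obtain k where "t - s = of_int k" unfolding ee_eq_iff by (auto elim: Ints_cases)
    then have "t = s + of_int k" by simp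
    then show ?thesis using periodic_of_int[of B, OF per] by simp
  qed
  define F where "F z = B (Arg2pi z / (2 * pi))" for z
  have ee_Arg: "ee (Arg2pi z / (2 * pi)) = z" if "cmod z = 1" for z
    using Arg2pi_eq[of z] that by (simp add: ee_def cis_conv_exp)
  have F: "F (ee t) = B t" for t
    unfolding F_def by (rule per') (simp add: ee_Arg)
  have "continuous_on (sphere 0 1) F"
    unfolding continuous_on_closed_vimage[OF closed_sphere]
  proof (intro allI impI)
    fix C :: "complex set" assume C: "closed C"
    have "F -` C \<inter> sphere 0 1 = ee ` ({0..1} \<inter> B -` C)"
    proof (intro Set.set_eqI iffI)
      fix z assume z: "z \<in> F -` C \<inter> sphere 0 1"
      then have "z = ee (Arg2pi z / (2 * pi))" by (simp add: ee_Arg)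
      moreover have "Arg2pi z / (2 * pi) \<in> {0..1} \<inter> B -` C"
        using z Arg2pi_ge_0[of z] Arg2pi_lt_2pi[of z] by (simp add: F_def)
      ultimately show "z \<in> ee ` ({0..1} \<inter> B -` C)" by blast
    next
      fix z assume "z \<in> ee ` ({0..1} \<inter> B -` C)"
      then show "z \<in> F -` C \<inter> sphere 0 1" using F by auto
    qed
    moreover have "closed (B -` C)" using cont C by (simp add: closed_vimage)
    then have "compact ({0..1} \<inter> B -` C)" by (simp add: compact_Int_closed)
    then have "compact (ee ` ({0..1} \<inter> B -` C))"
      by (intro compact_continuous_image continuous_on_ee continuous_intros)
    ultimately show "closed (F -` C \<inter> sphere 0 1)" by (simp add: compact_imp_closed)
  qed
  from Stone_Weierstrass_polynomial_function[OF compact_sphere this \<open>\<epsilon> > 0\<close>]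
  obtain g where g: "polynomial_function g" "\<And>z. z \<in> sphere 0 1 \<Longrightarrow> cmod (F z - g z) < \<epsilon>" by blast
  have "real_polynomial_function (\<lambda>z. Re (g z))" "real_polynomial_function (\<lambda>z. Im (g z))"
    using g(1) bounded_linear_Re bounded_linear_Im unfolding polynomial_function_def o_def by blast+
  note this[THEN real_polynomial_trig]
  then have "(\<lambda>t. of_real (Re (g (ee t))) + \<i> * of_real (Im (g (ee t)))) \<in> trig_polys"
    by (intro trig_polys.add trig_polys_mult trig_polys_const)
  then have "(\<lambda>t. g (ee t)) \<in> trig_polys" by (simp flip: complex_eq)
  moreover have "cmod (B t - g (ee t)) \<le> \<epsilon>" for t using g(2)[of "ee t"] F[of t] by simp
  ultimately show ?thesis using that by blast
qed

text \<open>
  For \<open>B(t) = e(lt)\<close> this is a Weyl sum whose linear coefficient is shifted by \<open>l\<beta>\<close>.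
\<close>
lemma null_means_periodic_Weyl:
  assumes cont: "continuous_on UNIV B" and per: "\<And>t. B (t + 1) = B t"
    and irr: "\<And>l::int. coeff p 1 + of_int l * \<beta> \<notin> \<rat>"
  shows "null_means (\<lambda>s n. B (y + real n * \<beta>) * poly_phase p (s + int n))"
proof (rule null_means_approx)
  fix \<epsilon> :: real assume "\<epsilon> > 0"
  from periodic_trig_approx[OF cont per this] obtain g
    where g: "g \<in> trig_polys" "\<And>t. cmod (B t - g t) \<le> \<epsilon>" by blast
  have "null_means (\<lambda>s n. g (y + real n * \<beta>) * poly_phase p (s + int n))"
    using g(1)
  proof induction
    case (monomial c l)
    have "null_means (\<lambda>s n. poly_phase (p + [:0, of_int l * \<beta>:]) (s + int n))"
      using irr[of l] by (intro null_means_Weyl[of 1]) auto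
    from null_means_mult[OF this, of "\<lambda>s. c * ee (of_int l * y - of_int l * \<beta> * of_int s)" "cmod c"]
    have "null_means (\<lambda>s n. c * ee (of_int l * y - of_int l * \<beta> * of_int s) *
        poly_phase (p + [:0, of_int l * \<beta>:]) (s + int n))"
      by (simp add: norm_mult)
    moreover have "c * ee (of_int l * y - of_int l * \<beta> * of_int s) * poly_phase (p + [:0, of_int l * \<beta>:]) (s + int n)
      = c * ee (of_int l * (y + real n * \<beta>)) * poly_phase p (s + int n)" for s n
      unfolding poly_phase_def mult.assoc ee_add[symmetric] by (simp add: algebra_simps)
    ultimately show ?case by simp
  next
    case (add f g)
    then show ?case using null_means_add by (simp add: distrib_right)
  qed
  moreover have "cmod (B (y + real n * \<beta>) * poly_phase p (s + int n) - g (y + real n * \<beta>) * poly_phase p (s + int n)) \<le> \<epsilon>" for s n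
    using g(2) unfolding left_diff_distrib[symmetric] norm_mult by simp
  ultimately show "\<exists>v. null_means v \<and> (\<forall>s n. cmod (B (y + real n * \<beta>) * poly_phase p (s + int n) - v s n) \<le> \<epsilon>)"
    by blast
qed

definition rationally_independent :: "real \<Rightarrow> real \<Rightarrow> bool" where
  "rationally_independent \<alpha> \<beta> \<longleftrightarrow>
     (\<forall>p q r :: rat. of_rat p + of_rat q * \<alpha> + of_rat r * \<beta> = 0 \<longrightarrow> p = 0 \<and> q = 0 \<and> r = 0)"

lemma rationally_independentD:
  assumes "rationally_independent \<alpha> \<beta>" "a \<in> \<rat>" "b \<in> \<rat>" "c \<in> \<rat>" "a + b * \<alpha> + c * \<beta> = 0"
  shows "a = 0" "b = 0" "c = 0"
proof -
  from assms obtain p q r where "a = of_rat p" "b = of_rat q" "c = of_rat r"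
    by (auto elim!: Rats_cases)
  with assms show "a = 0" "b = 0" "c = 0" unfolding rationally_independent_def by auto
qed

lemma rationally_independent_distinct:
  assumes ind: "rationally_independent \<alpha> \<beta>"
  shows "\<alpha> \<noteq> 1" "\<beta> \<noteq> 1" "\<alpha> \<noteq> \<beta>"
  using rationally_independentD(2)[OF ind, of "-1" 1 0] rationally_independentD(3)[OF ind, of "-1" 0 1]
    rationally_independentD(2)[OF ind, of 0 1 "-1"] by auto

text \<open>
  Over \<open>\<rat>\<close> the independent numbers \<open>1, \<alpha>, \<beta>\<close> extend to a basis of \<open>\<real>\<close>; \<open>\<phi>\<close> is the coordinate of \<open>\<alpha>\<close>.
\<close>
lemma rational_functional:
  assumes ind: "rationally_independent \<alpha> \<beta>"
  obtains \<phi> :: "real \<Rightarrow> real" where "\<And>a b. \<phi> (a + b) = \<phi> a + \<phi> b"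
    "\<And>r a. r \<in> \<rat> \<Longrightarrow> \<phi> (r * a) = r * \<phi> a" "\<phi> \<alpha> = 1" "\<phi> \<beta> = 0" "\<And>r. r \<in> \<rat> \<Longrightarrow> \<phi> r = 0"
proof -
  let ?s = "\<lambda>(q::rat) (x::real). of_rat q * x"
  interpret V: vector_space_pair ?s ?s
    by unfold_locales (auto simp: algebra_simps of_rat_add of_rat_mult)
  note dist = rationally_independent_distinct[OF ind]
  have "V.vs1.independent {1, \<alpha>, \<beta>}"
    unfolding V.vs1.independent_explicit_module
  proof (intro allI impI)
    fix t u v assume t: "finite t" "t \<subseteq> {1, \<alpha>, \<beta>}" "(\<Sum>v\<in>t. ?s (u v) v) = 0" "v \<in> t"
    define u' where "u' x = (if x \<in> t then u x else 0)" for x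
    have "(\<Sum>v\<in>{1, \<alpha>, \<beta>}. ?s (u' v) v) = (\<Sum>v\<in>t. ?s (u v) v)"
      using t(2) by (intro sum.mono_neutral_cong_right) (auto simp: u'_def)
    then have "of_rat (u' 1) + of_rat (u' \<alpha>) * \<alpha> + of_rat (u' \<beta>) * \<beta> = 0"
      using t(3) dist by (simp add: add.assoc)
    then have "u' 1 = 0 \<and> u' \<alpha> = 0 \<and> u' \<beta> = 0" using ind unfolding rationally_independent_def by blast
    then have "u' v = 0" using t by auto
    then show "u v = 0" using t by (simp add: u'_def)
  qed
  from V.linear_independent_extend[OF this, of "\<lambda>x. if x = \<alpha> then 1 else 0"]
  obtain \<phi> where \<phi>: "Vector_Spaces.linear ?s ?s \<phi>" "\<forall>x\<in>{1, \<alpha>, \<beta>}. \<phi> x = (if x = \<alpha> then 1 else 0)" by blast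
  interpret \<phi>: Vector_Spaces.linear ?s ?s \<phi> by fact
  have scale: "\<phi> (r * a) = r * \<phi> a" if "r \<in> \<rat>" for r a
    using that \<phi>.scale by (auto elim!: Rats_cases)
  have "\<phi> r = 0" if "r \<in> \<rat>" for r using scale[OF that, of 1] \<phi>(2) dist by auto
  then show ?thesis using that[of \<phi>] \<phi>.add scale \<phi>(2) dist by auto
qed

text \<open>
  If the expression is rational, then \<open>\<phi>\<close> turns it into \<open>R(h) = m(k - h\<beta>)\<close> with a real
  polynomial \<open>R\<close> without constant term, so \<open>\<bar>R(h)\<bar> \<le> \<bar>m\<bar>\<close>.  For large \<open>h\<close> this is impossible unless
  \<open>R = 0\<close>, and then \<open>\<beta> = k/h\<close>.
\<close>
lemma large_times_nonresonant:
  fixes p :: "real poly"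
  assumes ind: "rationally_independent \<alpha> \<beta>" and p0: "coeff p 0 = 0" and "m \<noteq> (0::int)"
  obtains h0 :: nat where "\<And>h (k::int) (l::int). h \<ge> h0 \<Longrightarrow> \<bar>of_int k - real h * \<beta>\<bar> \<le> 1 \<Longrightarrow>
      poly p (real h) - of_int m * of_int k * \<alpha> + of_int l * \<beta> \<notin> \<rat>"
proof -
  obtain \<phi> where \<phi>: "\<And>a b. \<phi> (a + b) = \<phi> a + \<phi> b"
    "\<And>r a. r \<in> \<rat> \<Longrightarrow> \<phi> (r * a) = r * \<phi> a" "\<phi> \<alpha> = 1" "\<phi> \<beta> = 0" "\<And>r. r \<in> \<rat> \<Longrightarrow> \<phi> r = 0"
    using rational_functional[OF ind] by blast
  define R where "R = map_poly \<phi> p - [:0, of_int m * \<beta>:]"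
  have \<phi>_poly: "\<phi> (poly q (real h)) = poly (map_poly \<phi> q) (real h)" for q h
    using \<phi>(5)[of 0] by (induction q) (auto simp: map_poly_pCons \<phi>)
  have res: "poly R (real h) = of_int m * (of_int k - real h * \<beta>)"
    if "poly p (real h) - of_int m * of_int k * \<alpha> + of_int l * \<beta> \<in> \<rat>" for h k l
  proof -
    define r where "r = poly p (real h) - of_int m * of_int k * \<alpha> + of_int l * \<beta>"
    have "poly p (real h) = r + (of_int (m * k) * \<alpha> + of_int (- l) * \<beta>)" by (simp add: r_def)
    then have "\<phi> (poly p (real h)) = \<phi> r + (of_int (m * k) * \<phi> \<alpha> + of_int (- l) * \<phi> \<beta>)"
      using \<phi>(1,2) by (metis Rats_of_int)
    also have "\<dots> = of_int m * of_int k" using that \<phi>(3-5) by (simp add: r_def)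
    finally show ?thesis unfolding R_def \<phi>_poly by (simp add: algebra_simps)
  qed
  obtain R' where R: "R = pCons 0 R'"
    using p0 \<phi>(5)[of 0] by (cases R) (auto simp: R_def coeff_map_poly dest: arg_cong[where f="\<lambda>q. coeff q 0"])
  show ?thesis
  proof (cases "R' = 0")
    case True
    have "poly p (real h) - of_int m * of_int k * \<alpha> + of_int l * \<beta> \<notin> \<rat>" if "h \<ge> 1" for h k l
    proof
      assume "poly p (real h) - of_int m * of_int k * \<alpha> + of_int l * \<beta> \<in> \<rat>"
      from res[OF this] have "of_int (- k) + 0 * \<alpha> + real h * \<beta> = 0"
        using R True \<open>m \<noteq> 0\<close> by simp
      from rationally_independentD(3)[OF ind _ _ _ this] show False using that by simp
    qed
    then show ?thesis using that by blast
  next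
    case False
    from poly_infinity[OF this, of "\<bar>of_int m\<bar> + 1" 0] obtain r
      where r: "\<And>z. r \<le> \<bar>z\<bar> \<Longrightarrow> \<bar>of_int m\<bar> + 1 \<le> \<bar>poly R z\<bar>" unfolding R by auto
    show ?thesis
    proof (rule that)
      fix h :: nat and k l :: int assume h: "nat \<lceil>r\<rceil> \<le> h" "\<bar>of_int k - real h * \<beta>\<bar> \<le> 1"
      show "poly p (real h) - of_int m * of_int k * \<alpha> + of_int l * \<beta> \<notin> \<rat>"
      proof
        assume "poly p (real h) - of_int m * of_int k * \<alpha> + of_int l * \<beta> \<in> \<rat>"
        from res[OF this] have "\<bar>poly R (real h)\<bar> = \<bar>of_int m\<bar> * \<bar>of_int k - real h * \<beta>\<bar>"
          by (simp add: abs_mult)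
        also have "\<dots> \<le> \<bar>of_int m\<bar> * 1" by (intro mult_left_mono h) auto
        finally have "\<bar>poly R (real h)\<bar> \<le> \<bar>real_of_int m\<bar>" by simp
        moreover have "r \<le> \<bar>real h\<bar>" using h(1) by linarith
        ultimately show False using r[of "real h"] by linarith
      qed
    qed
  qed
qed


section \<open>Mean decay of the fibre coordinate\<close>

text \<open>A bump that vanishes exactly where the fibre coordinate jumps.\<close>
definition sin_sq :: "real \<Rightarrow> real" where "sin_sq t = (sin (pi * t))\<^sup>2"

lemma sin_sq_bounds: "0 \<le> sin_sq t" "sin_sq t \<le> 1"
  unfolding sin_sq_def by (auto simp: abs_square_le_1)

lemma sin_sq_add_1: "sin_sq (t + 1) = sin_sq t"
  by (simp add: sin_sq_def distrib_left)

lemma sin_sq_Ints: "t \<in> \<int> \<Longrightarrow> sin_sq t = 0"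
  by (auto simp: sin_sq_def mult.commute elim!: Ints_cases)

lemma continuous_on_sin_sq:
  fixes f :: "real \<Rightarrow> real"
  shows "continuous_on S f \<Longrightarrow> continuous_on S (\<lambda>t. sin_sq (f t))"
  unfolding sin_sq_def by (intro continuous_on_power continuous_on_sin continuous_on_mult continuous_on_const)

lemma continuous_on_mult_bounded:
  fixes g J :: "real \<Rightarrow> complex"
  assumes g: "continuous_on UNIV g" and J: "\<And>t. cmod (J t) \<le> 1" and "\<And>t. g t \<noteq> 0 \<Longrightarrow> isCont J t"
  shows "continuous_on UNIV (\<lambda>t. g t * J t)"
proof -
  have "isCont (\<lambda>t. g t * J t) t" for t
  proof (cases "g t = 0")
    case True
    have "isCont g t" using g by (simp add: continuous_on_eq_continuous_at)
    then have "(g \<longlongrightarrow> 0) (at t)" using True unfolding isCont_def by simp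
    then have lim: "((\<lambda>t. norm (g t)) \<longlongrightarrow> 0) (at t)" by (rule tendsto_norm_zero)
    have ev: "\<forall>\<^sub>F s in at t. norm (g s * J s) \<le> norm (g s)"
      unfolding norm_mult by (rule always_eventually) (simp add: mult_left_le J)
    have "((\<lambda>t. g t * J t) \<longlongrightarrow> 0) (at t)"
      by (rule Lim_null_comparison[OF ev lim])
    then show ?thesis using True by (simp add: isCont_def)
  next
    case False
    then show ?thesis using assms by (auto simp: continuous_on_eq_continuous_at)
  qed
  then show ?thesis by (simp add: continuous_on_eq_continuous_at)
qed

text \<open>
  The part of a correlation in which \<open>k\<close> integers are crossed on the way from \<open>t\<close> to \<open>t + d\<close>.  The last
  two factors jump only where \<open>t\<close> or \<open>t + d\<close> is an integer, and there the bumps vanish; so the function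
  is continuous.
\<close>
definition carry_phase :: "real \<Rightarrow> real \<Rightarrow> int \<Rightarrow> real \<Rightarrow> complex" where
  "carry_phase c d k t = of_real (sin_sq (t + d) * sin_sq t) *
     (ee (c * frac (t + d)) * (if \<lfloor>t + d\<rfloor> - \<lfloor>t\<rfloor> = k then 1 else 0))"

lemma carry_phase_add_1: "carry_phase c d k (t + 1) = carry_phase c d k t"
proof -
  have 1: "t + 1 + d = (t + d) + 1" by simp
  have fl: "\<lfloor>(t + d) + 1\<rfloor> = \<lfloor>t + d\<rfloor> + 1" "\<lfloor>t + 1\<rfloor> = \<lfloor>t\<rfloor> + 1" by linarith+
  then have fr: "frac ((t + d) + 1) = frac (t + d)" unfolding frac_def by simp
  show ?thesis unfolding carry_phase_def 1 sin_sq_add_1 fl fr by simp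
qed

lemma continuous_on_carry_phase: "continuous_on UNIV (carry_phase c d k)"
proof -
  let ?J = "\<lambda>t. ee (c * frac (t + d)) * (if \<lfloor>t + d\<rfloor> - \<lfloor>t\<rfloor> = k then 1 else 0)"
  have "continuous_on UNIV (\<lambda>t. complex_of_real (sin_sq (t + d) * sin_sq t) * ?J t)"
  proof (rule continuous_on_mult_bounded)
    show "continuous_on UNIV (\<lambda>t. complex_of_real (sin_sq (t + d) * sin_sq t))"
      by (intro continuous_intros continuous_on_sin_sq)
    show "cmod (?J t) \<le> 1" for t by (auto simp: norm_mult)
    fix t assume "complex_of_real (sin_sq (t + d) * sin_sq t) \<noteq> 0"
    then have nz: "t \<notin> \<int>" "t + d \<notin> \<int>" using sin_sq_Ints by auto
    have "((\<lambda>s. s) \<longlongrightarrow> t) (nhds t)" "((\<lambda>s. s + d) \<longlongrightarrow> t + d) (nhds t)"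
      by (auto intro!: tendsto_intros simp: filterlim_ident)
    from eventually_floor_eq[OF this(1) nz(1)] eventually_floor_eq[OF this(2) nz(2)]
    have "\<forall>\<^sub>F s in nhds t. ?J s = ee (c * (s + d - of_int \<lfloor>t + d\<rfloor>)) * (if \<lfloor>t + d\<rfloor> - \<lfloor>t\<rfloor> = k then 1 else 0)"
      by eventually_elim (simp add: frac_def)
    moreover have "isCont (\<lambda>s. ee (c * (s + d - of_int \<lfloor>t + d\<rfloor>)) * (if \<lfloor>t + d\<rfloor> - \<lfloor>t\<rfloor> = k then 1 else 0)) t"
      by (rule continuous_on_interior[of UNIV]) (auto intro!: continuous_intros continuous_on_ee)
    ultimately show "isCont ?J t" using isCont_cong by fast
  qed
  then show ?thesis unfolding carry_phase_def .
qed

text \<open>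
  The number \<open>z\<^sub>n - x\<^sub>n\<lfloor>y\<^sub>n - y0\<rfloor>\<close> for the \<open>n\<close>-th point \<open>(x\<^sub>n, y\<^sub>n, z\<^sub>n)\<close> of the orbit of \<open>(x, y, z)\<close>.  Modulo
  \<open>1\<close> it does not depend on the representative of the coset.
\<close>
definition fiber_coord :: "real \<Rightarrow> real \<Rightarrow> real \<Rightarrow> real \<Rightarrow> real \<Rightarrow> real \<Rightarrow> real \<Rightarrow> nat \<Rightarrow> real" where
  "fiber_coord \<alpha> \<beta> \<gamma> x y z y0 n =
     z + real n * \<gamma> + (real n)\<^sup>2 * \<alpha> * \<beta> / 2 + real n * \<alpha> * y
       - (x + real n * \<alpha>) * of_int \<lfloor>y + real n * \<beta> - y0\<rfloor>"

text \<open>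
  The terms \<open>nh\<alpha>\<beta>\<close> that come from the square and from the floor cancel; the only one left that grows
  with \<open>n\<close> is \<open>n\<alpha>k\<close>, where \<open>k\<close> is the number of integers crossed.
\<close>
lemma fiber_coord_diff:
  fixes h n :: nat and y y0 \<beta> :: real
  defines "t \<equiv> y + real n * \<beta> - y0"
  defines "k \<equiv> \<lfloor>t + real h * \<beta>\<rfloor> - \<lfloor>t\<rfloor>"
  shows "fiber_coord \<alpha> \<beta> \<gamma> x y z y0 (n + h) - fiber_coord \<alpha> \<beta> \<gamma> x y z y0 n =
    (real h * \<gamma> - (real h)\<^sup>2 * \<alpha> * \<beta> / 2 + real h * \<alpha> * y0 - x * of_int k)
    + real h * \<alpha> * frac (t + real h * \<beta>) - real n * \<alpha> * of_int k"
proof -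
  have "y + real (n + h) * \<beta> - y0 = t + real h * \<beta>" by (simp add: t_def algebra_simps)
  then have fl: "real_of_int \<lfloor>y + real (n + h) * \<beta> - y0\<rfloor> = t + real h * \<beta> - frac (t + real h * \<beta>)"
    by (simp add: frac_def)
  have fl2: "real_of_int \<lfloor>y + real n * \<beta> - y0\<rfloor> = t + real h * \<beta> - frac (t + real h * \<beta>) - of_int k"
    by (simp add: frac_def k_def t_def)
  show ?thesis
    unfolding fiber_coord_def fl fl2 unfolding t_def
    by (simp add: power2_eq_square field_simps)
qed

lemma coeff_1_eq_pderiv: "coeff p 1 = poly (pderiv p) 0"
  by (simp add: poly_0_coeff_0 coeff_pderiv)

lemma coeff_1_shift_diff: "coeff (shift_diff h p) 1 = poly (pderiv p) h - coeff p 1"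
  unfolding shift_diff_def coeff_1_eq_pderiv by (simp add: pderiv_diff pderiv_pcompose poly_pcompose pderiv_pCons)

text \<open>
  The correlation at distance \<open>h\<close> is a sum over the two possible values of \<open>k\<close> of a carry phase
  in \<open>y + n\<beta> - y0\<close> times the phase of \<open>p(n + h) - p(n) - mk\<alpha>n\<close>, and the linear coefficient of the latter is
  not resonant when \<open>h\<close> is large.
\<close>
theorem null_means_fiber_poly_phase:
  assumes ind: "rationally_independent \<alpha> \<beta>" and "m \<noteq> (0::int)"
  shows "null_means (\<lambda>s n. poly_phase p (s + int n) * (of_real (sin_sq (y + real n * \<beta> - y0)) *
    ee (of_int m * fiber_coord \<alpha> \<beta> \<gamma> x y z y0 n)))" (is "null_means ?u")
proof -
  define L where "L = pderiv p - [:coeff p 1:]"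
  have "coeff L 0 = 0" by (simp add: L_def coeff_pderiv)
  from large_times_nonresonant[OF ind this \<open>m \<noteq> 0\<close>] obtain h0 where
    h0: "\<And>h (k::int) (l::int). h \<ge> h0 \<Longrightarrow> \<bar>of_int k - real h * \<beta>\<bar> \<le> 1 \<Longrightarrow>
      poly L (real h) - of_int m * of_int k * \<alpha> + of_int l * \<beta> \<notin> \<rat>" by blast
  define t where "t n = y + real n * \<beta> - y0" for n
  show ?thesis
  proof (rule van_der_Corput[where M=1 and ?h0.0=h0])
    show "cmod (?u s n) \<le> 1" for s n
      using sin_sq_bounds by (simp add: norm_mult)
    fix h assume h: "h \<ge> h0"
    \<comment> \<open>Within \<open>h\<close> steps of size \<open>\<beta>\<close> one crosses \<open>\<lfloor>h\<beta>\<rfloor>\<close> or \<open>\<lfloor>h\<beta>\<rfloor> + 1\<close> integers.\<close>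
    define K where "K = {\<lfloor>real h * \<beta>\<rfloor>, \<lfloor>real h * \<beta>\<rfloor> + 1}"
    define c where "c k s = ee (of_int m * (real h * \<gamma> - (real h)\<^sup>2 * \<alpha> * \<beta> / 2 + real h * \<alpha> * y0 - x * of_int k)
       + of_int m * of_int k * \<alpha> * of_int s)" for k s :: int
    define q where "q k = shift_diff (real h) p + [:0, - (of_int m * of_int k * \<alpha>):]" for k :: int
    define B where "B k = carry_phase (of_int m * real h * \<alpha>) (real h * \<beta>) k" for k
    have "null_means (\<lambda>s n. c k s * (B k ((y - y0) + real n * \<beta>) * poly_phase (q k) (s + int n)))" if "k \<in> K" for k
    proof (rule null_means_mult[where C=1])
      show "null_means (\<lambda>s n. B k ((y - y0) + real n * \<beta>) * poly_phase (q k) (s + int n))"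
      proof (rule null_means_periodic_Weyl)
        show "continuous_on UNIV (B k)" unfolding B_def by (rule continuous_on_carry_phase)
        show "B k (t + 1) = B k t" for t unfolding B_def by (rule carry_phase_add_1)
        fix l :: int
        have "\<bar>of_int k - real h * \<beta>\<bar> \<le> 1" using that unfolding K_def by (auto; linarith)
        from h0[OF h this, of l] show "coeff (q k) 1 + of_int l * \<beta> \<notin> \<rat>"
          by (simp add: q_def coeff_1_shift_diff[simplified] L_def)
      qed
    qed (simp add: c_def)
    then have "null_means (\<lambda>s n. \<Sum>k\<in>K. c k s * (B k ((y - y0) + real n * \<beta>) * poly_phase (q k) (s + int n)))"
      by (rule null_means_sum)
    moreover have "?u s (n + h) * cnj (?u s n) =
      (\<Sum>k\<in>K. c k s * (B k ((y - y0) + real n * \<beta>) * poly_phase (q k) (s + int n)))" for s n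
    proof -
      define k where "k = \<lfloor>t n + real h * \<beta>\<rfloor> - \<lfloor>t n\<rfloor>"
      have tn: "(y - y0) + real n * \<beta> = t n" "y + real (n + h) * \<beta> - y0 = t n + real h * \<beta>"
        by (simp_all add: t_def algebra_simps)
      have "k \<in> K" unfolding K_def k_def by auto linarith
      have "(\<Sum>k\<in>K. c k s * (B k ((y - y0) + real n * \<beta>) * poly_phase (q k) (s + int n))) =
        (\<Sum>i\<in>K. if i = k then c k s * (B k ((y - y0) + real n * \<beta>) * poly_phase (q k) (s + int n)) else 0)"
        by (intro sum.cong) (auto simp: tn B_def carry_phase_def k_def)
      also have "\<dots> = c k s * (B k (t n) * poly_phase (q k) (s + int n))"
        using \<open>k \<in> K\<close> by (simp add: K_def tn)
      also have "\<dots> = of_real (sin_sq (t n + real h * \<beta>) * sin_sq (t n)) *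
        (ee (of_int m * (real h * \<gamma> - (real h)\<^sup>2 * \<alpha> * \<beta> / 2 + real h * \<alpha> * y0 - x * of_int k)
       + of_int m * of_int k * \<alpha> * of_int s) * ee (of_int m * real h * \<alpha> * frac (t n + real h * \<beta>)) *
        poly_phase (q k) (s + int n))"
        unfolding B_def c_def carry_phase_def by (simp add: k_def)
      also have "\<dots> = of_real (sin_sq (t n + real h * \<beta>) * sin_sq (t n)) *
        ee (of_int m * (fiber_coord \<alpha> \<beta> \<gamma> x y z y0 (n + h) - fiber_coord \<alpha> \<beta> \<gamma> x y z y0 n) +
         poly p (of_int (s + int n) + real h) - poly p (of_int (s + int n)))"
        unfolding poly_phase_def ee_add[symmetric] fiber_coord_diff q_def poly_add poly_shift_diff k_def t_def
        by (simp add: algebra_simps)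
      also have "\<dots> = ?u s (n + h) * cnj (?u s n)"
        unfolding tn(2) unfolding t_def[symmetric]
        by (simp add: poly_phase_def cnj_ee ee_add[symmetric] mult_ac) (simp add: algebra_simps ee_add)
      finally show ?thesis by simp
    qed
    ultimately show "null_means (\<lambda>s n. ?u s (n + h) * cnj (?u s n))" by simp
  qed
qed


section \<open>Translation algebras and their Gelfand spaces\<close>

lemma continuous_map_complex_mult:
  fixes f g :: "'a \<Rightarrow> complex"
  shows "continuous_map X euclidean f \<Longrightarrow> continuous_map X euclidean g \<Longrightarrow> continuous_map X euclidean (\<lambda>x. f x * g x)"
  by (simp add: continuous_map_atin tendsto_mult)

locale function_algebra =
  fixes A :: "(int \<Rightarrow> complex) set"
  assumes unital: "unital_subalgebra A" and conj: "conj_closed A"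
    and trans: "translation_invariant A" and closed: "uniformly_closed A"
begin

lemma const: "(\<lambda>n. c) \<in> A" using unital by (simp add: unital_subalgebra_def)
lemma add: "f \<in> A \<Longrightarrow> g \<in> A \<Longrightarrow> (\<lambda>n. f n + g n) \<in> A" using unital by (simp add: unital_subalgebra_def)
lemma mult: "f \<in> A \<Longrightarrow> g \<in> A \<Longrightarrow> (\<lambda>n. f n * g n) \<in> A" using unital by (simp add: unital_subalgebra_def)
lemma cnj: "f \<in> A \<Longrightarrow> (\<lambda>n. cnj (f n)) \<in> A" using conj by (simp add: conj_closed_def)
lemma translate: "f \<in> A \<Longrightarrow> (\<lambda>n. f (n + m)) \<in> A" using trans by (simp add: translation_invariant_def)
lemma cmult: "f \<in> A \<Longrightarrow> (\<lambda>n. c * f n) \<in> A" using mult[OF const] .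
lemma diff: "f \<in> A \<Longrightarrow> g \<in> A \<Longrightarrow> (\<lambda>n. f n - g n) \<in> A"
  using add[OF _ cmult[of g "-1"]] by simp
lemma sum: "(\<And>i. i \<in> I \<Longrightarrow> f i \<in> A) \<Longrightarrow> (\<lambda>n. \<Sum>i\<in>I. f i n) \<in> A"
  by (induction I rule: infinite_finite_induct) (auto intro: const add)
lemma sum_sq_dist:
  assumes "F \<subseteq> A"
  shows "(\<lambda>n. complex_of_real (\<Sum>f\<in>F. (cmod (f n - c f))\<^sup>2)) = (\<lambda>n. \<Sum>f\<in>F. (f n - c f) * cnj (f n - c f))"
    and "(\<lambda>n. complex_of_real (\<Sum>f\<in>F. (cmod (f n - c f))\<^sup>2)) \<in> A"
proof -
  show eq: "(\<lambda>n. complex_of_real (\<Sum>f\<in>F. (cmod (f n - c f))\<^sup>2)) = (\<lambda>n. \<Sum>f\<in>F. (f n - c f) * cnj (f n - c f))"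
    by (simp add: complex_norm_square del: of_real_power)
  show "(\<lambda>n. complex_of_real (\<Sum>f\<in>F. (cmod (f n - c f))\<^sup>2)) \<in> A"
    unfolding eq using assms by (intro sum mult diff cnj const) auto
qed
lemma bounded: assumes "f \<in> A" obtains M where "M > 0" "\<And>n. cmod (f n) \<le> M"
proof -
  have "bounded (range f)" using assms unital unfolding unital_subalgebra_def ell_infty_def by blast
  then show ?thesis using that unfolding bounded_pos by blast
qed

lemma limit:
  assumes "\<And>\<epsilon>. \<epsilon> > 0 \<Longrightarrow> \<exists>g\<in>A. \<forall>n. cmod (f n - g n) < \<epsilon>"
  shows "f \<in> A"
proof -
  have "\<forall>k. \<exists>g\<in>A. \<forall>n. cmod (f n - g n) < inverse (real (Suc k))"
    using assms by simp
  then obtain G where G: "\<And>k. G k \<in> A" "\<And>k n. cmod (f n - G k n) < inverse (real (Suc k))"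
    by metis
  have "uniform_limit UNIV G f sequentially"
    unfolding uniform_limit_iff
  proof (intro allI impI)
    fix \<epsilon> :: real assume "\<epsilon> > 0"
    then have "\<forall>\<^sub>F k in sequentially. inverse (real (Suc k)) < \<epsilon>"
      using LIMSEQ_inverse_real_of_nat by (rule order_tendstoD(2)[rotated])
    then show "\<forall>\<^sub>F k in sequentially. \<forall>n\<in>UNIV. dist (G k n) (f n) < \<epsilon>"
      by eventually_elim (use G(2) in \<open>auto simp: dist_norm norm_minus_commute intro: less_trans\<close>)
  qed
  then show ?thesis using closed G(1) unfolding uniformly_closed_def by blast
qed

text \<open>Approximate \<open>h\<close> by polynomials on \<open>S\<close>.\<close>
lemma continuous_calculus:
  fixes h :: "real \<Rightarrow> real"
  assumes f: "(\<lambda>n. complex_of_real (r n)) \<in> A" and S: "compact S" "\<And>n. r n \<in> S" and h: "continuous_on S h"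
  shows "(\<lambda>n. complex_of_real (h (r n))) \<in> A"
proof (rule limit)
  fix \<epsilon> :: real assume "\<epsilon> > 0"
  from Stone_Weierstrass_real_polynomial_function[OF S(1) h this]
  obtain g where g: "real_polynomial_function g" "\<And>x. x \<in> S \<Longrightarrow> \<bar>h x - g x\<bar> < \<epsilon>" by metis
  from g(1) have "(\<lambda>n. complex_of_real (g (r n))) \<in> A"
  proof induction
    case (linear f')
    then have "f' = (\<lambda>x. x * f' 1)" by (metis real_bounded_linear mult_1)
    then have "(\<lambda>n. complex_of_real (f' (r n))) = (\<lambda>n. of_real (f' 1) * complex_of_real (r n))"
      by (metis mult.commute of_real_mult)
    then show ?case using cmult[OF f] by simp
  qed (auto intro: const add mult)
  moreover have "cmod (complex_of_real (h (r n)) - complex_of_real (g (r n))) < \<epsilon>" for n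
    using g(2)[OF S(2)] by (metis norm_of_real of_real_diff)
  ultimately show "\<exists>g\<in>A. \<forall>n. cmod (complex_of_real (h (r n)) - g n) < \<epsilon>"
    by (intro bexI[of _ "\<lambda>n. complex_of_real (g (r n))"] allI)
qed

lemma inverse_of_real:
  assumes f: "(\<lambda>n. complex_of_real (r n)) \<in> A" and "\<delta> > 0" "\<And>n. r n \<ge> \<delta>"
  shows "(\<lambda>n. complex_of_real (inverse (r n))) \<in> A"
proof -
  obtain M where M: "\<And>n. \<bar>r n\<bar> \<le> M" using bounded[OF f] by (metis norm_of_real)
  show ?thesis
  proof (rule continuous_calculus[OF f])
    show "compact {\<delta>..M}" by simp
    show "r n \<in> {\<delta>..M}" for n using assms(3)[of n] M[of n] by auto
    show "continuous_on {\<delta>..M} inverse" using \<open>\<delta> > 0\<close> by (intro continuous_on_inverse continuous_on_id) auto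
  qed
qed

context
  fixes \<xi> assumes char: "\<xi> \<in> characters A"
begin

lemma char_const: "\<xi> (\<lambda>n. c) = c"
proof -
  have "\<xi> (\<lambda>n. c * f n) = c * \<xi> f" if "f \<in> A" for f using char that by (simp add: characters_def)
  from this[OF const[of 1]] show ?thesis using char by (simp add: characters_def)
qed
lemma char_add: "f \<in> A \<Longrightarrow> g \<in> A \<Longrightarrow> \<xi> (\<lambda>n. f n + g n) = \<xi> f + \<xi> g" using char by (simp add: characters_def)
lemma char_mult: "f \<in> A \<Longrightarrow> g \<in> A \<Longrightarrow> \<xi> (\<lambda>n. f n * g n) = \<xi> f * \<xi> g" using char by (simp add: characters_def)
lemma char_cmult: "f \<in> A \<Longrightarrow> \<xi> (\<lambda>n. c * f n) = c * \<xi> f" using char by (simp add: characters_def)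
lemma char_diff: "f \<in> A \<Longrightarrow> g \<in> A \<Longrightarrow> \<xi> (\<lambda>n. f n - g n) = \<xi> f - \<xi> g"
  using char_add[OF _ cmult[of g "-1"], of f] char_cmult[of g "-1"] by simp
lemma char_sum: "(\<And>i. i \<in> I \<Longrightarrow> f i \<in> A) \<Longrightarrow> \<xi> (\<lambda>n. \<Sum>i\<in>I. f i n) = (\<Sum>i\<in>I. \<xi> (f i))"
  by (induction I rule: infinite_finite_induct) (auto simp: char_const char_add sum)

text \<open>
  If no \<open>n\<close> were suitable, then \<open>\<Sum>f\<in>F. \<bar>f - \<xi> f\<bar>\<^sup>2\<close> would be bounded away from \<open>0\<close> and hence invertible
  in the algebra, although \<open>\<xi>\<close> maps it to \<open>0\<close>.  Via this density of the point evaluations, bounds and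
  positivity pass from functions to their values under \<open>\<xi>\<close>.
\<close>
theorem char_approx:
  assumes "finite F" "F \<subseteq> A" "\<epsilon> > 0"
  obtains n where "\<And>f. f \<in> F \<Longrightarrow> cmod (f n - \<xi> f) < \<epsilon>"
proof (rule ccontr)
  assume "\<not> thesis"
  then have far: "\<exists>f\<in>F. cmod (f n - \<xi> f) \<ge> \<epsilon>" for n using that by (meson not_less)
  define r where "r n = (\<Sum>f\<in>F. (cmod (f n - \<xi> f))\<^sup>2)" for n
  note eq = sum_sq_dist(1)[OF assms(2), of \<xi>, folded r_def] and rA = sum_sq_dist(2)[OF assms(2), of \<xi>, folded r_def]
  have inA: "(\<lambda>n. f n - \<xi> f) \<in> A" "(\<lambda>n. cnj (f n - \<xi> f)) \<in> A" if "f \<in> F" for f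
    using that assms(2) by (auto intro!: diff const cnj)
  have "\<xi> (\<lambda>n. complex_of_real (r n)) = (\<Sum>f\<in>F. \<xi> (\<lambda>n. (f n - \<xi> f) * cnj (f n - \<xi> f)))"
    unfolding eq by (intro char_sum mult inA)
  also have "\<dots> = (\<Sum>f\<in>F. 0)"
  proof (intro sum.cong refl)
    fix f assume f: "f \<in> F"
    have "\<xi> (\<lambda>n. f n - \<xi> f) = 0" using char_diff[OF _ const, of f "\<xi> f"] f assms(2) by (auto simp: char_const)
    then show "\<xi> (\<lambda>n. (f n - \<xi> f) * cnj (f n - \<xi> f)) = 0" using char_mult[OF inA[OF f]] by simp
  qed
  finally have zero: "\<xi> (\<lambda>n. complex_of_real (r n)) = 0" by simp
  have ge: "r n \<ge> \<epsilon>\<^sup>2" for n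
  proof -
    obtain f where f: "f \<in> F" "cmod (f n - \<xi> f) \<ge> \<epsilon>" using far by blast
    have "\<epsilon>\<^sup>2 \<le> (cmod (f n - \<xi> f))\<^sup>2" using f \<open>\<epsilon> > 0\<close> by (intro power_mono) auto
    also have "\<dots> \<le> r n" unfolding r_def using f(1) assms(1) by (intro member_le_sum) auto
    finally show ?thesis .
  qed
  have e2: "\<epsilon>\<^sup>2 > 0" using \<open>\<epsilon> > 0\<close> by simp
  have "\<xi> (\<lambda>n. complex_of_real (r n) * complex_of_real (inverse (r n))) =
     \<xi> (\<lambda>n. complex_of_real (r n)) * \<xi> (\<lambda>n. complex_of_real (inverse (r n)))"
    by (rule char_mult[OF rA inverse_of_real[OF rA e2 ge]])
  moreover have "(\<lambda>n. complex_of_real (r n) * complex_of_real (inverse (r n))) = (\<lambda>n. 1)"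
  proof
    fix n
    have "r n \<noteq> 0" using ge[of n] e2 by linarith
    then show "complex_of_real (r n) * complex_of_real (inverse (r n)) = 1"
      by (metis of_real_1 of_real_mult right_inverse)
  qed
  ultimately show False using zero char_const[of 1] by simp
qed

lemma char_bound:
  assumes "f \<in> A" "\<And>n. cmod (f n) \<le> M"
  shows "cmod (\<xi> f) \<le> M"
proof (rule field_le_epsilon)
  fix \<epsilon> :: real assume "\<epsilon> > 0"
  obtain n where "cmod (f n - \<xi> f) < \<epsilon>" using char_approx[of "{f}" \<epsilon>] assms(1) \<open>\<epsilon> > 0\<close> by auto
  then show "cmod (\<xi> f) \<le> M + \<epsilon>"
    using assms(2)[of n] norm_triangle_ineq2[of "\<xi> f" "f n"] by (simp add: norm_minus_commute)
qed

end

lemma char_nonneg: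
  assumes "\<xi> \<in> characters A" "(\<lambda>n. complex_of_real (r n)) \<in> A" "\<And>n. r n \<ge> 0"
  shows "Im (\<xi> (\<lambda>n. complex_of_real (r n))) = 0" "Re (\<xi> (\<lambda>n. complex_of_real (r n))) \<ge> 0"
proof -
  let ?z = "\<xi> (\<lambda>n. complex_of_real (r n))"
  have near: "\<exists>n. cmod (complex_of_real (r n) - ?z) < \<epsilon>" if "\<epsilon> > 0" for \<epsilon>
    using char_approx[OF assms(1), of "{\<lambda>n. complex_of_real (r n)}" \<epsilon>] assms(2) that by auto
  have "\<bar>Im ?z\<bar> \<le> 0"
  proof (rule field_le_epsilon)
    fix \<epsilon> :: real assume "\<epsilon> > 0"
    then obtain n where "cmod (complex_of_real (r n) - ?z) < \<epsilon>" using near by blast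
    then show "\<bar>Im ?z\<bar> \<le> 0 + \<epsilon>" using abs_Im_le_cmod[of "complex_of_real (r n) - ?z"] by simp
  qed
  then show "Im ?z = 0" by simp
  have "- Re ?z \<le> 0"
  proof (rule field_le_epsilon)
    fix \<epsilon> :: real assume "\<epsilon> > 0"
    then obtain n where "cmod (complex_of_real (r n) - ?z) < \<epsilon>" using near by blast
    then show "- Re ?z \<le> 0 + \<epsilon>"
      using abs_Re_le_cmod[of "complex_of_real (r n) - ?z"] assms(3)[of n] by simp
  qed
  then show "Re ?z \<ge> 0" by simp
qed

lemma evaluation_character: "(\<lambda>f\<in>A. f n) \<in> characters A"
  unfolding characters_def using const add mult cmult by auto

lemma char_translate:
  assumes "\<xi> \<in> characters A"
  shows "(\<lambda>f\<in>A. \<xi> (\<lambda>n. f (n + m))) \<in> characters A"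
proof -
  note a = char_add[OF assms translate[of _ m] translate[of _ m]]
    and b = char_mult[OF assms translate[of _ m] translate[of _ m]]
    and c = char_cmult[OF assms translate[of _ m]]
  show ?thesis
    unfolding characters_def using const add mult cmult
    by (auto simp: char_const[OF assms] a b c)
qed

lemma topspace_gelfand: "topspace (gelfand_space A) = characters A"
  unfolding gelfand_space_def topspace_subtopology topspace_product_topology
  by (auto simp: characters_def PiE_def)

lemma continuous_map_gelfand_eval: "f \<in> A \<Longrightarrow> continuous_map (gelfand_space A) euclidean (\<lambda>\<xi>. \<xi> f)"
  unfolding gelfand_space_def
  by (intro continuous_map_from_subtopology continuous_map_product_projection)

lemma Hausdorff_gelfand: "Hausdorff_space (gelfand_space A)"
  unfolding gelfand_space_def
  by (intro Hausdorff_space_subtopology) (simp add: Hausdorff_space_product_topology)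

lemma closedin_characters: "closedin (product_topology (\<lambda>f. euclidean) A) (characters A)"
proof -
  let ?P = "product_topology (\<lambda>f. euclidean) A :: ((int \<Rightarrow> complex) \<Rightarrow> complex) topology"
  have proj: "continuous_map ?P euclidean (\<lambda>\<xi>. \<xi> f)" if "f \<in> A" for f
    using that by (rule continuous_map_product_projection)
  have eqn: "closedin ?P {\<xi> \<in> topspace ?P. u \<xi> = v \<xi>}"
    if "continuous_map ?P euclidean u" "continuous_map ?P euclidean v" for u v :: "_ \<Rightarrow> complex"
    using that by (intro closedin_continuous_maps_eq) auto
  have ne: "A \<noteq> {}" using const by blast
  have "characters A = {\<xi> \<in> topspace ?P. \<xi> (\<lambda>n. 1) = 1} \<inter>
     (\<Inter>c. \<Inter>f\<in>A. {\<xi> \<in> topspace ?P. \<xi> (\<lambda>n. c * f n) = c * \<xi> f}) \<inter>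
     (\<Inter>f\<in>A. \<Inter>g\<in>A. {\<xi> \<in> topspace ?P. \<xi> (\<lambda>n. f n + g n) = \<xi> f + \<xi> g}) \<inter>
     (\<Inter>f\<in>A. \<Inter>g\<in>A. {\<xi> \<in> topspace ?P. \<xi> (\<lambda>n. f n * g n) = \<xi> f * \<xi> g})"
    unfolding characters_def topspace_product_topology using const[of 0]
    by (auto simp: PiE_def)
  also have "closedin ?P \<dots>"
    by (intro closedin_Int closedin_INT eqn proj const add mult cmult ne UNIV_not_empty
        continuous_map_add continuous_map_complex_mult) auto
  finally show ?thesis .
qed

text \<open>The characters form a closed subset of a product of closed discs.\<close>
lemma compact_gelfand: "compact_space (gelfand_space A)"
proof -
  let ?P = "product_topology (\<lambda>f. euclidean) A :: ((int \<Rightarrow> complex) \<Rightarrow> complex) topology"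
  have "\<forall>f\<in>A. \<exists>M. \<forall>n. cmod (f n) \<le> M" using bounded by metis
  then obtain M where M: "\<And>f n. f \<in> A \<Longrightarrow> cmod (f n) \<le> M f" by metis
  have "compactin ?P (PiE A (\<lambda>f. cball 0 (M f)))"
    by (simp add: compactin_PiE)
  moreover have "characters A \<subseteq> PiE A (\<lambda>f. cball 0 (M f))"
    using char_bound M by (auto simp: PiE_def characters_def extensional_def)
  ultimately have "compactin ?P (characters A)"
    using closedin_characters closed_compactin by blast
  then show ?thesis unfolding gelfand_space_def by (rule compact_space_subtopology)
qed

lemma gelfand_nbhd:
  assumes "openin (gelfand_space A) U" "\<xi> \<in> U"
  obtains F \<epsilon> where "finite F" "F \<subseteq> A" "\<epsilon> > 0"
    "\<And>\<eta>. \<eta> \<in> characters A \<Longrightarrow> (\<And>f. f \<in> F \<Longrightarrow> cmod (\<eta> f - \<xi> f) < \<epsilon>) \<Longrightarrow> \<eta> \<in> U"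
proof -
  let ?P = "product_topology (\<lambda>f. euclidean) A :: ((int \<Rightarrow> complex) \<Rightarrow> complex) topology"
  obtain W where W: "openin ?P W" "U = W \<inter> characters A"
    using assms(1) unfolding gelfand_space_def openin_subtopology by blast
  then obtain V where V: "finite {f \<in> A. V f \<noteq> UNIV}" "\<And>f. f \<in> A \<Longrightarrow> open (V f)" "\<xi> \<in> PiE A V" "PiE A V \<subseteq> W"
    using assms(2) unfolding openin_product_topology_alt by fastforce
  define F where "F = {f \<in> A. V f \<noteq> UNIV}"
  have "\<forall>f\<in>F. \<exists>e>0. ball (\<xi> f) e \<subseteq> V f"
    using V by (auto simp: F_def PiE_def Pi_def open_contains_ball)
  then obtain e where e: "\<And>f. f \<in> F \<Longrightarrow> e f > 0" "\<And>f. f \<in> F \<Longrightarrow> ball (\<xi> f) (e f) \<subseteq> V f" by metis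
  have fin: "finite F" using V(1) by (simp add: F_def)
  define \<epsilon> where "\<epsilon> = Min (insert 1 (e ` F))"
  have \<epsilon>: "\<epsilon> > 0" "\<And>f. f \<in> F \<Longrightarrow> \<epsilon> \<le> e f" unfolding \<epsilon>_def using fin e(1) by auto
  show ?thesis
  proof (rule that[OF fin _ \<epsilon>(1)])
    show "F \<subseteq> A" by (auto simp: F_def)
    fix \<eta> assume \<eta>: "\<eta> \<in> characters A" "\<And>f. f \<in> F \<Longrightarrow> cmod (\<eta> f - \<xi> f) < \<epsilon>"
    have "\<eta> f \<in> V f" if "f \<in> A" for f
    proof (cases "f \<in> F")
      case True
      then have "\<eta> f \<in> ball (\<xi> f) (e f)" using \<eta>(2)[of f] \<epsilon>(2)[of f] by (simp add: dist_norm norm_minus_commute)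
      then show ?thesis using e(2)[OF True] by blast
    next
      case False
      then show ?thesis using that by (simp add: F_def)
    qed
    then have "\<eta> \<in> PiE A V" using \<eta>(1) by (auto simp: characters_def PiE_def)
    then show "\<eta> \<in> U" using V(4) W(2) \<eta>(1) by blast
  qed
qed

lemma continuous_map_gelfand_translate:
  "continuous_map (gelfand_space A) (gelfand_space A) (\<lambda>\<xi>. \<lambda>f\<in>A. \<xi> (\<lambda>n. f (n + m)))"
  unfolding gelfand_space_def[of A] continuous_map_in_subtopology
proof (intro conjI)
  show "continuous_map (subtopology (product_topology (\<lambda>f. euclidean) A) (characters A))
     (product_topology (\<lambda>f. euclidean) A) (\<lambda>\<xi>. \<lambda>f\<in>A. \<xi> (\<lambda>n. f (n + m)))"
    unfolding continuous_map_componentwise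
    using continuous_map_gelfand_eval[OF translate] by (auto simp: gelfand_space_def)
  show "(\<lambda>\<xi>. \<lambda>f\<in>A. \<xi> (\<lambda>n. f (n + m))) \<in> topspace (subtopology (product_topology (\<lambda>f. euclidean) A) (characters A)) \<rightarrow> characters A"
    using char_translate by auto
qed

lemma gelfand_shift_eq: "gelfand_shift A = (\<lambda>\<xi>. \<lambda>f\<in>A. \<xi> (\<lambda>n. f (n + 1)))"
  by (simp add: gelfand_shift_def fun_eq_iff)

lemma translate_translate:
  assumes "\<xi> \<in> characters A"
  shows "(\<lambda>f\<in>A. (\<lambda>f\<in>A. \<xi> (\<lambda>n. f (n + a))) (\<lambda>n. f (n + b))) = (\<lambda>f\<in>A. \<xi> (\<lambda>n. f (n + (a + b))))"
  using translate by (auto simp: fun_eq_iff add.assoc)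

lemma translate_0: "\<xi> \<in> characters A \<Longrightarrow> (\<lambda>f\<in>A. \<xi> (\<lambda>n. f (n + 0))) = \<xi>"
  by (auto simp: characters_def extensional_def)

theorem flow_gelfand: "flow (gelfand_space A) (gelfand_shift A)"
  unfolding flow_def
proof (intro conjI)
  show "topspace (gelfand_space A) \<noteq> {}"
    using evaluation_character[of 0] unfolding topspace_gelfand by blast
  have "homeomorphic_maps (gelfand_space A) (gelfand_space A) (\<lambda>\<xi>. \<lambda>f\<in>A. \<xi> (\<lambda>n. f (n + 1)))
     (\<lambda>\<xi>. \<lambda>f\<in>A. \<xi> (\<lambda>n. f (n + (- 1))))"
    unfolding homeomorphic_maps_def topspace_gelfand
  proof (intro conjI continuous_map_gelfand_translate ballI)
    fix \<xi> assume "\<xi> \<in> characters A"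
    note * = translate_translate[OF this, of 1 "-1"] translate_translate[OF this, of "-1" 1] translate_0[OF this]
    show "(\<lambda>f\<in>A. (\<lambda>f\<in>A. \<xi> (\<lambda>n. f (n + 1))) (\<lambda>n. f (n + (- 1)))) = \<xi>"
      unfolding *(1) using *(3) by simp
    show "(\<lambda>f\<in>A. (\<lambda>f\<in>A. \<xi> (\<lambda>n. f (n + (- 1)))) (\<lambda>n. f (n + 1))) = \<xi>"
      unfolding *(2) using *(3) by simp
  qed
  then show "homeomorphic_map (gelfand_space A) (gelfand_space A) (gelfand_shift A)"
    unfolding gelfand_shift_eq homeomorphic_map_maps by blast
qed (rule compact_gelfand Hausdorff_gelfand)+

lemma gelfand_shift_funpow:
  assumes "\<xi> \<in> characters A"
  shows "(gelfand_shift A ^^ n) \<xi> = (\<lambda>f\<in>A. \<xi> (\<lambda>k. f (k + int n)))"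
proof (induction n)
  case 0
  then show ?case using translate_0[OF assms] by simp
next
  case (Suc n)
  have "(gelfand_shift A ^^ Suc n) \<xi> = gelfand_shift A (\<lambda>f\<in>A. \<xi> (\<lambda>k. f (k + int n)))"
    by (simp only: funpow.simps o_apply Suc)
  also have "\<dots> = (\<lambda>f\<in>A. \<xi> (\<lambda>k. f (k + (int n + 1))))"
    unfolding gelfand_shift_eq translate_translate[OF assms] ..
  finally show ?case by (simp add: add.commute)
qed

end


section \<open>The Weyl algebra\<close>

inductive_set phase_sums :: "(int \<Rightarrow> complex) set" where
  monomial: "(\<lambda>n. c * poly_phase p n) \<in> phase_sums"
| add: "f \<in> phase_sums \<Longrightarrow> g \<in> phase_sums \<Longrightarrow> (\<lambda>n. f n + g n) \<in> phase_sums"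

lemma phase_sums_mult:
  assumes "f \<in> phase_sums" "g \<in> phase_sums"
  shows "(\<lambda>n. f n * g n) \<in> phase_sums"
  using assms
proof (induction f arbitrary: g)
  case (monomial c p)
  from monomial show ?case
  proof (induction g)
    case (monomial d q)
    have "(\<lambda>n. c * poly_phase p n * (d * poly_phase q n)) = (\<lambda>n. (c * d) * poly_phase (p + q) n)"
      by (simp add: poly_phase_add mult_ac)
    then show ?case by (simp only: phase_sums.monomial)
  next
    case (add f g)
    then show ?case using phase_sums.add by (simp add: distrib_left)
  qed
next
  case (add f h)
  then show ?case using phase_sums.add by (simp add: distrib_right)
qed

lemma phase_sums_bounded:
  assumes "f \<in> phase_sums"
  obtains M where "\<And>n. cmod (f n) \<le> M"
proof -
  have "\<exists>M. \<forall>n. cmod (f n) \<le> M" using assms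
  proof induction
    case (monomial c p)
    then show ?case by (auto simp: norm_mult)
  next
    case (add f g)
    then obtain M M' where "\<forall>n. cmod (f n) \<le> M" "\<forall>n. cmod (g n) \<le> M'" by blast
    then have "\<forall>n. cmod (f n + g n) \<le> M + M'" by (meson add_mono norm_triangle_le)
    then show ?case by blast
  qed
  then show ?thesis using that by blast
qed

lemma phase_sums_cnj: "f \<in> phase_sums \<Longrightarrow> (\<lambda>n. cnj (f n)) \<in> phase_sums"
proof (induction rule: phase_sums.induct)
  case (monomial c p)
  have "(\<lambda>n. cnj (c * poly_phase p n)) = (\<lambda>n. cnj c * poly_phase (- p) n)"
    by (simp add: poly_phase_def cnj_ee)
  then show ?case by (simp only: phase_sums.monomial)
next
  case (add f g)
  then show ?case using phase_sums.add by simp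
qed

lemma phase_sums_translate: "f \<in> phase_sums \<Longrightarrow> (\<lambda>n. f (n + m)) \<in> phase_sums"
proof (induction rule: phase_sums.induct)
  case (monomial c p)
  have "(\<lambda>n. c * poly_phase p (n + m)) = (\<lambda>n. c * poly_phase (p \<circ>\<^sub>p [:of_int m, 1:]) n)"
    by (simp add: poly_phase_def poly_pcompose add.commute)
  then show ?case by (simp only: phase_sums.monomial)
next
  case (add f g)
  then show ?case using phase_sums.add by simp
qed

text \<open>The uniform closure of \<open>phase_sums\<close>, which turns out to be the Weyl algebra.\<close>
definition phase_closure :: "(int \<Rightarrow> complex) set" where
  "phase_closure = {f. \<forall>\<epsilon>>0. \<exists>g\<in>phase_sums. \<forall>n. cmod (f n - g n) \<le> \<epsilon>}"

lemma phase_closureD: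
  assumes "f \<in> phase_closure" "\<epsilon> > 0"
  obtains g where "g \<in> phase_sums" "\<And>n. cmod (f n - g n) \<le> \<epsilon>"
  using assms unfolding phase_closure_def by blast

lemma phase_closureI:
  assumes "\<And>\<epsilon>. \<epsilon> > 0 \<Longrightarrow> \<exists>g\<in>phase_sums. \<forall>n. cmod (f n - g n) \<le> \<epsilon>"
  shows "f \<in> phase_closure"
  using assms unfolding phase_closure_def by blast

lemma phase_sums_subset_closure: "phase_sums \<subseteq> phase_closure"
  by (auto intro!: phase_closureI bexI)

lemma phase_closure_bounded:
  assumes "f \<in> phase_closure"
  obtains M where "M > 0" "\<And>n. cmod (f n) \<le> M"
proof -
  obtain g where g: "g \<in> phase_sums" "\<And>n. cmod (f n - g n) \<le> 1"
    using phase_closureD[OF assms, of 1] by auto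
  obtain M where "\<And>n. cmod (g n) \<le> M" using phase_sums_bounded[OF g(1)] by blast
  then have "cmod (f n) \<le> \<bar>M\<bar> + 1" for n
    using g(2)[of n] norm_triangle_ineq2[of "f n" "g n"] by (smt (verit))
  then show ?thesis using that[of "\<bar>M\<bar> + 1"] by auto
qed

lemma phase_closure_mult:
  assumes "f \<in> phase_closure" "g \<in> phase_closure"
  shows "(\<lambda>n. f n * g n) \<in> phase_closure"
proof (rule phase_closureI)
  fix \<epsilon> :: real assume "\<epsilon> > 0"
  obtain M where M: "M > 0" "\<And>n. cmod (f n) \<le> M" using phase_closure_bounded[OF assms(1)] by blast
  obtain g' where g': "g' \<in> phase_sums" "\<And>n. cmod (g n - g' n) \<le> \<epsilon> / (2 * M)"
    using phase_closureD[OF assms(2), of "\<epsilon> / (2 * M)"] \<open>\<epsilon> > 0\<close> M by auto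
  obtain M' where M': "\<And>n. cmod (g' n) \<le> M'" using phase_sums_bounded[OF g'(1)] by blast
  obtain f' where f': "f' \<in> phase_sums" "\<And>n. cmod (f n - f' n) \<le> \<epsilon> / (2 * (\<bar>M'\<bar> + 1))"
    using phase_closureD[OF assms(1), of "\<epsilon> / (2 * (\<bar>M'\<bar> + 1))"] \<open>\<epsilon> > 0\<close> by auto
  have "cmod (f n * g n - f' n * g' n) \<le> \<epsilon>" for n
  proof -
    have "f n * g n - f' n * g' n = f n * (g n - g' n) + (f n - f' n) * g' n" by (simp add: algebra_simps)
    also have "cmod \<dots> \<le> cmod (f n) * cmod (g n - g' n) + cmod (f n - f' n) * cmod (g' n)"
      by (metis norm_mult norm_triangle_ineq)
    also have "\<dots> \<le> M * (\<epsilon> / (2 * M)) + \<epsilon> / (2 * (\<bar>M'\<bar> + 1)) * (\<bar>M'\<bar> + 1)"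
      using M'[of n] \<open>\<epsilon> > 0\<close> by (intro add_mono mult_mono M g' f') (auto simp: M less_imp_le)
    also have "\<dots> = \<epsilon>" using M(1) by (simp add: field_simps)
    finally show ?thesis .
  qed
  then show "\<exists>g''\<in>phase_sums. \<forall>n. cmod (f n * g n - g'' n) \<le> \<epsilon>"
    by (intro bexI[OF _ phase_sums_mult[OF f'(1) g'(1)]] allI)
qed

lemma phase_closure_add:
  assumes "f \<in> phase_closure" "g \<in> phase_closure"
  shows "(\<lambda>n. f n + g n) \<in> phase_closure"
proof (rule phase_closureI)
  fix \<epsilon> :: real assume "\<epsilon> > 0"
  then have e2: "\<epsilon>/2 > 0" by simp
  obtain f' g' where f': "f' \<in> phase_sums" "\<And>n. cmod (f n - f' n) \<le> \<epsilon>/2"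
    and g': "g' \<in> phase_sums" "\<And>n. cmod (g n - g' n) \<le> \<epsilon>/2"
    using phase_closureD[OF assms(1) e2] phase_closureD[OF assms(2) e2] by metis
  have "cmod (f n + g n - (f' n + g' n)) \<le> \<epsilon>" for n
    using norm_triangle_mono[OF f'(2)[of n] g'(2)[of n]] by (simp add: algebra_simps)
  then show "\<exists>h\<in>phase_sums. \<forall>n. cmod (f n + g n - h n) \<le> \<epsilon>"
    by (intro bexI[OF _ phase_sums.add[OF f'(1) g'(1)]] allI)
qed

lemma poly_phase_0 [simp]: "poly_phase 0 n = 1" by (simp add: poly_phase_def)

lemma unital_subalgebra_phase_closure: "unital_subalgebra phase_closure"
  unfolding unital_subalgebra_def ell_infty_def
proof (intro conjI subsetI ballI allI)
  fix f assume "f \<in> phase_closure"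
  then obtain M where "\<And>n. cmod (f n) \<le> M" using phase_closure_bounded by blast
  then show "f \<in> {f. bounded (range f)}" by (auto simp: bounded_iff)
next
  fix c :: complex
  have "(\<lambda>n. c) \<in> phase_sums" using phase_sums.monomial[of c 0] by simp
  then show "(\<lambda>n. c) \<in> phase_closure" using phase_sums_subset_closure by blast
qed (auto intro: phase_closure_add phase_closure_mult)

lemma conj_closed_phase_closure: "conj_closed phase_closure"
  unfolding conj_closed_def
proof (intro ballI phase_closureI)
  fix f and \<epsilon> :: real assume "f \<in> phase_closure" "\<epsilon> > 0"
  then obtain g where "g \<in> phase_sums" "\<And>n. cmod (f n - g n) \<le> \<epsilon>" using phase_closureD by blast
  then show "\<exists>g\<in>phase_sums. \<forall>n. cmod (cnj (f n) - g n) \<le> \<epsilon>"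
    using phase_sums_cnj by (metis complex_cnj_diff complex_mod_cnj)
qed

lemma translation_invariant_phase_closure: "translation_invariant phase_closure"
  unfolding translation_invariant_def
proof (intro ballI allI phase_closureI)
  fix f m and \<epsilon> :: real assume "f \<in> phase_closure" "\<epsilon> > 0"
  then obtain g where g: "g \<in> phase_sums" "\<And>n. cmod (f n - g n) \<le> \<epsilon>" using phase_closureD by blast
  show "\<exists>g\<in>phase_sums. \<forall>n. cmod (f (n + m) - g n) \<le> \<epsilon>"
    by (intro bexI[OF _ phase_sums_translate[OF g(1), of m]] allI g(2))
qed

lemma uniformly_closed_phase_closure: "uniformly_closed phase_closure"
  unfolding uniformly_closed_def
proof (intro allI impI phase_closureI)
  fix F f and \<epsilon> :: real
  assume F: "(\<forall>k. F k \<in> phase_closure) \<and> uniform_limit UNIV F f sequentially" and "\<epsilon> > 0"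
  then have "\<forall>\<^sub>F k in sequentially. \<forall>n\<in>UNIV. dist (F k n) (f n) < \<epsilon>/2"
    unfolding uniform_limit_iff using half_gt_zero by blast
  from eventually_happens[OF this] obtain k where k: "\<And>n. cmod (F k n - f n) < \<epsilon>/2"
    by (auto simp: dist_norm)
  obtain g where g: "g \<in> phase_sums" "\<And>n. cmod (F k n - g n) \<le> \<epsilon>/2"
    using F phase_closureD[of "F k" "\<epsilon>/2"] \<open>\<epsilon> > 0\<close> by auto
  have "cmod (f n - g n) \<le> \<epsilon>" for n
    using norm_triangle_ineq4[of "F k n - g n" "F k n - f n"] k[of n] g(2)[of n] by simp
  then show "\<exists>g\<in>phase_sums. \<forall>n. cmod (f n - g n) \<le> \<epsilon>" using g(1) by blast
qed

lemma weyl_function_eq_poly_phase: "weyl_function k \<theta> = poly_phase (monom \<theta> k)"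
  by (rule ext) (simp add: weyl_function_def poly_phase_def ee_def poly_monom mult.commute)

text \<open>
  Translating a polynomial phase gives a polynomial phase, so no larger algebra arises.
\<close>
theorem weyl_algebra_eq_phase_closure: "weyl_algebra = phase_closure"
proof
  have "weyl_function k \<theta> \<in> phase_closure" for k \<theta>
    using phase_sums.monomial[of 1 "monom \<theta> k"] phase_sums_subset_closure
    by (auto simp: weyl_function_eq_poly_phase)
  then show "weyl_algebra \<subseteq> phase_closure"
    unfolding weyl_algebra_def
    by (intro Inter_lower) (simp add: unital_subalgebra_phase_closure conj_closed_phase_closure
        translation_invariant_phase_closure uniformly_closed_phase_closure)
  show "phase_closure \<subseteq> weyl_algebra"
    unfolding weyl_algebra_def
  proof (intro Inter_greatest)
    fix A assume A: "A \<in> {A. unital_subalgebra A \<and> conj_closed A \<and> translation_invariant A \<and>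
          uniformly_closed A \<and> (\<forall>k \<theta>. weyl_function k \<theta> \<in> A)}"
    then interpret A: function_algebra A
      by unfold_locales auto
    from A have wf: "weyl_function k \<theta> \<in> A" for k \<theta> by auto
    have phase: "poly_phase p \<in> A" for p
    proof -
      have "poly_phase (\<Sum>i<d. monom (coeff p i) i) \<in> A" for d
      proof (induction d)
        case 0
        then show ?case using A.const[of 1] by (simp add: poly_phase_def)
      next
        case (Suc d)
        have "poly_phase (\<Sum>i<Suc d. monom (coeff p i) i) =
            (\<lambda>n. poly_phase (\<Sum>i<d. monom (coeff p i) i) n * weyl_function d (coeff p d) n)"
          by (simp add: poly_phase_add fun_eq_iff weyl_function_eq_poly_phase)
        then show ?case using A.mult[OF Suc.IH wf] by simp
      qed
      from this[of "Suc (degree p)"] show ?thesis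
        by (simp add: lessThan_Suc_atMost poly_as_sum_of_monoms)
    qed
    have sums: "f \<in> A" if "f \<in> phase_sums" for f using that
      by induction (auto intro: A.add A.cmult phase)
    show "phase_closure \<subseteq> A"
    proof
      fix f assume f: "f \<in> phase_closure"
      show "f \<in> A"
      proof (rule A.limit)
        fix \<epsilon> :: real assume "\<epsilon> > 0"
        then obtain g where g: "g \<in> phase_sums" "\<And>n. cmod (f n - g n) \<le> \<epsilon>/2"
          using phase_closureD[OF f, of "\<epsilon>/2"] by auto
        have "cmod (f n - g n) < \<epsilon>" for n using g(2)[of n] \<open>\<epsilon> > 0\<close> by simp
        then show "\<exists>g\<in>A. \<forall>n. cmod (f n - g n) < \<epsilon>" using sums[OF g(1)] by blast
      qed
    qed
  qed
qed

interpretation W: function_algebra weyl_algebra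
  unfolding weyl_algebra_eq_phase_closure
  by unfold_locales (rule unital_subalgebra_phase_closure conj_closed_phase_closure
      translation_invariant_phase_closure uniformly_closed_phase_closure)+

lemma poly_phase_in_weyl: "poly_phase p \<in> weyl_algebra"
  using phase_sums.monomial[of 1 p] phase_sums_subset_closure by (auto simp: weyl_algebra_eq_phase_closure)

lemma weyl_function_in_weyl: "weyl_function k \<theta> \<in> weyl_algebra"
  unfolding weyl_function_eq_poly_phase by (rule poly_phase_in_weyl)

lemma weyl_algebra_approx:
  assumes "f \<in> weyl_algebra" "\<epsilon> > 0"
  obtains g where "g \<in> phase_sums" "\<And>n. cmod (f n - g n) \<le> \<epsilon>"
  using phase_closureD assms unfolding weyl_algebra_eq_phase_closure by blast

text \<open>
  Since the phases span a dense subspace, the nontrivial characters of the fibre coordinate are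
  asymptotically orthogonal to the whole Weyl algebra.
\<close>
theorem null_means_fiber_weyl:
  assumes ind: "rationally_independent \<alpha> \<beta>" and m: "m \<noteq> (0::int)" and f: "f \<in> weyl_algebra"
  shows "null_means (\<lambda>s n. f (s + int n) * (of_real (sin_sq (y + real n * \<beta> - y0)) *
    ee (of_int m * fiber_coord \<alpha> \<beta> \<gamma> x y z y0 n)))" (is "null_means (\<lambda>s n. _ * ?w n)")
proof (rule null_means_approx)
  fix \<epsilon> :: real assume "\<epsilon> > 0"
  from weyl_algebra_approx[OF f this] obtain g
    where g: "g \<in> phase_sums" "\<And>n. cmod (f n - g n) \<le> \<epsilon>" by blast
  have "null_means (\<lambda>s n. g (s + int n) * ?w n)"
    using g(1)
  proof induction
    case (monomial c p)
    from null_means_mult[OF null_means_fiber_poly_phase[OF ind m], of "\<lambda>s. c" "cmod c"]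
    show ?case by (simp add: mult.assoc)
  next
    case (add f g)
    then show ?case using null_means_add by (simp add: distrib_right)
  qed
  moreover have "cmod (f (s + int n) * ?w n - g (s + int n) * ?w n) \<le> \<epsilon>" for s n
  proof -
    have "cmod (?w n) \<le> 1" using sin_sq_bounds by (simp add: norm_mult)
    then have "cmod (f (s + int n) - g (s + int n)) * cmod (?w n) \<le> \<epsilon> * 1"
      using \<open>\<epsilon> > 0\<close> by (intro mult_mono g) auto
    then show ?thesis unfolding left_diff_distrib[symmetric] norm_mult by simp
  qed
  ultimately show "\<exists>v. null_means v \<and> (\<forall>s n. cmod (f (s + int n) * ?w n - v s n) \<le> \<epsilon>)" by blast
qed


section \<open>Positive means in the Weyl algebra\<close>

lemma null_means_reindex: "null_means u \<Longrightarrow> null_means (\<lambda>s. u (\<sigma> s))"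
  unfolding null_means_def by (blast intro: eventually_mono)

lemma null_means_bounded_sums:
  assumes "\<And>s N. cmod (\<Sum>n<N. u s n) \<le> M"
  shows "null_means u"
  unfolding null_means_def
proof (intro allI impI)
  fix \<epsilon> :: real assume "\<epsilon> > 0"
  from eventually_const_le_real[OF this, of M]
  show "\<forall>\<^sub>F N in sequentially. \<forall>s. cmod (\<Sum>n<N. u s n) \<le> \<epsilon> * real N"
    by eventually_elim (meson assms order_trans)
qed

text \<open>
  A polynomial phase either has
  null means, or all its nonconstant coefficients are rational and it is periodic; in the second
  case a translation can be reduced modulo the period, where it changes only boundedly many terms.
\<close>
lemma null_means_translation_diff:
  assumes "f \<in> weyl_algebra"
  shows "null_means (\<lambda>s n. f (s + int n) - f (int n))"
proof (rule null_means_approx)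
  fix \<epsilon> :: real assume "\<epsilon> > 0"
  then have e2: "\<epsilon>/2 > 0" by simp
  from weyl_algebra_approx[OF assms this] obtain g
    where g: "g \<in> phase_sums" "\<And>n. cmod (f n - g n) \<le> \<epsilon>/2" by blast
  have "null_means (\<lambda>s n. g (s + int n) - g (int n))"
    using g(1)
  proof induction
    case (monomial c p)
    have "null_means (\<lambda>s n. poly_phase p (s + int n) - poly_phase p (int n))"
    proof (cases "\<exists>i\<ge>1. coeff p i \<notin> \<rat>")
      case True
      then obtain i where "i \<ge> 1" "coeff p i \<notin> \<rat>" by blast
      then have W: "null_means (\<lambda>s n. poly_phase p (s + int n))" by (rule null_means_Weyl)
      from null_means_add[OF this null_means_mult[OF null_means_reindex[OF W, of "\<lambda>s. 0"], of "\<lambda>s. -1" 1]]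
      show ?thesis by simp
    next
      case False
      define r where "r = p - [:coeff p 0:]"
      have "coeff r i \<in> \<rat>" for i using False by (cases i) (auto simp: r_def)
      then obtain q :: nat where q: "q > 0" "\<And>i. real q * coeff r i \<in> \<int>"
        using common_denominator by blast
      have per1: "poly_phase p (n + int q) = poly_phase p n" for n
        using poly_period_Ints(1)[OF q(2), of n] unfolding poly_phase_def ee_eq_iff r_def by simp
      have per: "poly_phase p (n + int q * k) = poly_phase p n" for n k
      proof (induction k rule: int_induct[where k=0])
        case (step1 i)
        then show ?case using per1[of "n + int q * i"] by (simp add: algebra_simps)
      next
        case (step2 i)
        then show ?case using per1[of "n + int q * (i - 1)"] by (simp add: algebra_simps)
      qed simp
      show ?thesis
      proof (rule null_means_bounded_sums[where M="2 * real q"])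
        fix s :: int and N
        define r where "r = nat (s mod int q)"
        have r: "s = int r + int q * (s div int q)" "r < q" using q(1) by (auto simp: r_def nat_less_iff)
        have "poly_phase p (s + int n) = poly_phase p (int (n + r))" for n
          using per[of "int (n + r)" "s div int q"] r(1) by (simp add: algebra_simps)
        then have "cmod (\<Sum>n<N. poly_phase p (s + int n) - poly_phase p (int n)) \<le> 2 * 1 * real r"
          using cmod_sum_shift_le[of "\<lambda>n. poly_phase p (int n)" 1 r N] by (simp add: sum_subtractf)
        also have "\<dots> \<le> 2 * real q" using r(2) by simp
        finally show "cmod (\<Sum>n<N. poly_phase p (s + int n) - poly_phase p (int n)) \<le> 2 * real q" .
      qed
    qed
    from null_means_mult[OF this, of "\<lambda>s. c" "cmod c"] show ?case by (simp add: right_diff_distrib)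
  next
    case (add f g)
    from null_means_add[OF add.IH] show ?case by (simp add: algebra_simps)
  qed
  moreover have "cmod (f (s + int n) - f (int n) - (g (s + int n) - g (int n))) \<le> \<epsilon>" for s n
    using norm_triangle_ineq4[of "f (s + int n) - g (s + int n)" "f (int n) - g (int n)"]
      g(2)[of "s + int n"] g(2)[of "int n"] by (simp add: algebra_simps)
  ultimately show "\<exists>v. null_means v \<and> (\<forall>s n. cmod (f (s + int n) - f (int n) - v s n) \<le> \<epsilon>)" by blast
qed

text \<open>
  Sums of polynomial phases with nonnegative coefficients.  The polynomials have no constant term, so
  that a phase which is constant along a progression \<open>q\<int>\<close> has the value \<open>1\<close> there; this is what makes the
  means along such progressions nonnegative.
\<close>
inductive_set nonneg_phase_sums :: "(int \<Rightarrow> complex) set" where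
  monomial: "c \<ge> 0 \<Longrightarrow> coeff p 0 = 0 \<Longrightarrow> (\<lambda>n. of_real c * poly_phase p n) \<in> nonneg_phase_sums"
| add: "f \<in> nonneg_phase_sums \<Longrightarrow> g \<in> nonneg_phase_sums \<Longrightarrow> (\<lambda>n. f n + g n) \<in> nonneg_phase_sums"

lemma nonneg_phase_sums_const: "c \<ge> 0 \<Longrightarrow> (\<lambda>n. of_real c) \<in> nonneg_phase_sums"
  using nonneg_phase_sums.monomial[of c 0] by simp

lemma nonneg_phase_sums_mult:
  assumes "f \<in> nonneg_phase_sums" "g \<in> nonneg_phase_sums"
  shows "(\<lambda>n. f n * g n) \<in> nonneg_phase_sums"
  using assms
proof (induction f arbitrary: g)
  case (monomial c p)
  from monomial(3,1,2) show ?case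
  proof (induction g)
    case (monomial d q)
    have "(\<lambda>n. of_real c * poly_phase p n * (of_real d * poly_phase q n)) = (\<lambda>n. of_real (c * d) * poly_phase (p + q) n)"
      by (simp add: poly_phase_add mult_ac)
    then show ?case using monomial by (simp only:) (rule nonneg_phase_sums.monomial, auto)
  next
    case (add f g)
    then show ?case using nonneg_phase_sums.add by (simp add: distrib_left)
  qed
next
  case (add f h)
  then show ?case using nonneg_phase_sums.add by (simp add: distrib_right)
qed

lemma nonneg_phase_sums_sum:
  assumes "finite I" "\<And>i. i \<in> I \<Longrightarrow> f i \<in> nonneg_phase_sums"
  shows "(\<lambda>n. \<Sum>i\<in>I. f i n) \<in> nonneg_phase_sums"
  using assms nonneg_phase_sums_const[of 0]
  by (induction I rule: finite_induct) (auto intro: nonneg_phase_sums.add)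

text \<open>
  Phases with an irrational coefficient have mean \<open>0\<close> along every progression; the others equal
  \<open>1\<close> along \<open>q\<int>\<close> once \<open>q\<close> is a multiple of their denominators.
\<close>
lemma nonneg_phase_sums_mean:
  assumes "f \<in> nonneg_phase_sums"
  shows "\<exists>q>0. \<forall>q'>0. q dvd q' \<longrightarrow>
     (\<exists>L\<ge>0. null_means (\<lambda>(s::unit) n. f (int (q' * n)) - complex_of_real L))"
  using assms
proof induction
  case (monomial c p)
  show ?case
  proof (cases "\<exists>i\<ge>1. coeff p i \<notin> \<rat>")
    case True
    then obtain i where i: "i \<ge> 1" "coeff p i \<notin> \<rat>" by blast
    have "null_means (\<lambda>(s::unit) n. of_real c * poly_phase p (int (q' * n)) - complex_of_real 0)" if "q' > 0" for q'
    proof -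
      have "coeff (p \<circ>\<^sub>p [:0, real q':]) i \<notin> \<rat>"
      proof
        assume "coeff (p \<circ>\<^sub>p [:0, real q':]) i \<in> \<rat>"
        then have "real q' ^ i * coeff p i / real q' ^ i \<in> \<rat>"
          unfolding coeff_pcompose_linear by (intro Rats_divide Rats_power) auto
        then show False using i that by simp
      qed
      from null_means_reindex[OF null_means_Weyl[OF i(1) this], of "\<lambda>s::unit. 0"]
      have "null_means (\<lambda>(s::unit) n. poly_phase p (int (q' * n)))"
        by (simp add: poly_phase_def poly_pcompose mult.commute)
      from null_means_mult[OF this, of "\<lambda>s. of_real c" "\<bar>c\<bar>"] show ?thesis by simp
    qed
    then show ?thesis by (intro exI[of _ 1]) force
  next
    case False
    obtain r where p: "p = pCons 0 r" using monomial(2) by (cases p) auto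
    have "coeff r i \<in> \<rat>" for i using False by (auto simp: p dest: spec[of _ "Suc i"])
    then obtain q :: nat where q: "q > 0" "\<And>i. real q * coeff r i \<in> \<int>"
      using common_denominator by blast
    have "null_means (\<lambda>(s::unit) n. of_real c * poly_phase p (int (q' * n)) - complex_of_real c)" if "q dvd q'" for q'
    proof -
      from that obtain j where j: "q' = q * j" by (elim dvdE)
      have "poly_phase p (int (q' * n)) = 1" for n
      proof -
        have "poly p (real (q' * n)) = real (j * n) * (real q * poly r (of_int (int (q' * n))))"
          by (simp add: p j)
        also have "\<dots> \<in> \<int>" by (intro Ints_mult poly_period_Ints(2)[OF q(2)]) auto
        finally show ?thesis unfolding poly_phase_def ee_eq_1_iff by simp
      qed
      then show ?thesis by (simp add: null_means_zero)
    qed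
    then show ?thesis using q(1) monomial(1) by blast
  qed
next
  case (add f g)
  then obtain q1 q2 where q: "q1 > 0" "q2 > 0"
    "\<And>q'. q' > 0 \<Longrightarrow> q1 dvd q' \<Longrightarrow> \<exists>L\<ge>0. null_means (\<lambda>(s::unit) n. f (int (q' * n)) - complex_of_real L)"
    "\<And>q'. q' > 0 \<Longrightarrow> q2 dvd q' \<Longrightarrow> \<exists>L\<ge>0. null_means (\<lambda>(s::unit) n. g (int (q' * n)) - complex_of_real L)"
    by blast
  have "\<exists>L\<ge>0. null_means (\<lambda>(s::unit) n. (f (int (q' * n)) + g (int (q' * n))) - complex_of_real L)"
    if q': "q' > 0" "q1 * q2 dvd q'" for q'
  proof -
    have "q1 dvd q'" "q2 dvd q'" using q'(2) by (auto dest: dvd_mult_left dvd_mult_right)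
    note 1 = q(3)[OF q'(1) this(1)] and 2 = q(4)[OF q'(1) this(2)]
    obtain L1 L2 where L: "L1 \<ge> 0" "L2 \<ge> 0"
      and n: "null_means (\<lambda>(s::unit) n. f (int (q' * n)) - complex_of_real L1)"
      "null_means (\<lambda>(s::unit) n. g (int (q' * n)) - complex_of_real L2)"
      using 1 2 by blast
    from null_means_add[OF n] have "null_means (\<lambda>(s::unit) n. (f (int (q' * n)) + g (int (q' * n))) - complex_of_real (L1 + L2))"
      by (simp add: algebra_simps)
    then show ?thesis using L by (intro exI[of _ "L1 + L2"]) auto
  qed
  moreover have "q1 * q2 > 0" using q(1,2) by simp
  ultimately show ?case by blast
qed

lemma ee_power: "ee t ^ n = ee (real n * t)"
  by (induction n) (auto simp: ee_add[symmetric] algebra_simps)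

text \<open>
  The Fourier expansion of the kernel \<open>cos\<^bsup>2K\<^esup>(\<pi>t)\<close>, which is concentrated near the integers; its
  coefficients are positive.
\<close>
lemma cos_power_eq: "complex_of_real (cos (pi * t) ^ (2 * K)) =
  (\<Sum>j\<le>2 * K. of_real (real ((2 * K) choose j) / 4 ^ K) * ee ((real j - real K) * t))"
proof -
  have "complex_of_real (cos (pi * t)) = (ee (t/2) + ee (- (t/2))) / 2"
    by (auto simp: ee_def complex_eq_iff)
  then have "complex_of_real (cos (pi * t) ^ (2 * K)) = (ee (t/2) + ee (- (t/2))) ^ (2 * K) / 4 ^ K"
    by (simp only: of_real_power power_divide) (simp add: power_mult)
  also have "\<dots> = (\<Sum>j\<le>2 * K. of_nat ((2 * K) choose j) * ee (t/2) ^ j * ee (- (t/2)) ^ (2 * K - j)) / 4 ^ K"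
    by (simp add: binomial_ring)
  also have "\<dots> = (\<Sum>j\<le>2 * K. of_real (real ((2 * K) choose j) / 4 ^ K) * ee ((real j - real K) * t))"
    unfolding sum_divide_distrib
  proof (intro sum.cong refl)
    fix j assume "j \<in> {..2 * K}"
    then have "real j * (t/2) + real (2 * K - j) * - (t/2) = (real j - real K) * t"
      by (simp add: of_nat_diff field_simps)
    then show "of_nat ((2 * K) choose j) * ee (t/2) ^ j * ee (- (t/2)) ^ (2 * K - j) / 4 ^ K =
        of_real (real ((2 * K) choose j) / 4 ^ K) * ee ((real j - real K) * t)"
      unfolding ee_power mult.assoc ee_add[symmetric] by simp
  qed
  finally show ?thesis .
qed

lemma cos_sq_eq: "(cos (pi * t))\<^sup>2 = 1 - (cmod (ee t - 1))\<^sup>2 / 4"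
proof -
  have "(cmod (ee t - 1))\<^sup>2 = (cos (2 * (pi * t)) - 1)\<^sup>2 + (sin (2 * (pi * t)))\<^sup>2"
    by (simp add: cmod_power2 ee_def mult.assoc)
  also have "\<dots> = 2 - 2 * cos (2 * (pi * t))"
    using sin_cos_squared_add[of "2 * (pi * t)"] by (simp add: power2_diff)
  also have "\<dots> = 4 - 4 * (cos (pi * t))\<^sup>2" unfolding cos_double_cos by simp
  finally show ?thesis by linarith
qed

lemma cos_even_power: "0 \<le> cos x ^ (2 * K)" "cos x ^ (2 * K) \<le> 1" for x :: real
  unfolding power_mult
  by (rule zero_le_power[OF zero_le_power2], rule power_le_one) (auto simp: abs_square_le_1)

text \<open>
  Multiplying kernels with nonnegative coefficients can only enlarge the constant coefficient
  beyond the product of the constant coefficients.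
\<close>
lemma prod_cos_power_nonneg:
  assumes "finite S" "\<And>p. p \<in> S \<Longrightarrow> coeff p 0 = 0"
  shows "\<exists>g\<in>nonneg_phase_sums. \<forall>n. (\<Prod>p\<in>S. complex_of_real (cos (pi * poly p (of_int n)) ^ (2 * K))) =
    of_real ((real ((2 * K) choose K) / 4 ^ K) ^ card S) + g n"
  using assms
proof (induction S rule: finite_induct)
  case empty
  show ?case using nonneg_phase_sums_const[of 0] by force
next
  case (insert p S)
  define c where "c = real ((2 * K) choose K) / 4 ^ K"
  have "c \<ge> 0" by (simp add: c_def)
  define f where "f n = (\<Sum>j\<in>{..2 * K} - {K}. of_real (real ((2 * K) choose j) / 4 ^ K) *
      poly_phase (smult (real j - real K) p) n)" for n
  have f: "f \<in> nonneg_phase_sums" unfolding f_def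
    by (intro nonneg_phase_sums_sum nonneg_phase_sums.monomial) (auto simp: insert.prems)
  have eq: "complex_of_real (cos (pi * poly p (of_int n)) ^ (2 * K)) = of_real c + f n" for n
    unfolding cos_power_eq f_def c_def by (subst sum.remove[of _ K]) (auto simp: poly_phase_def)
  from insert.IH insert.prems obtain g where g: "g \<in> nonneg_phase_sums"
    "\<And>n. (\<Prod>p\<in>S. complex_of_real (cos (pi * poly p (of_int n)) ^ (2 * K))) = of_real (c ^ card S) + g n"
    by (auto simp: c_def)
  define h where "h n = of_real c * g n + f n * of_real (c ^ card S) + f n * g n" for n
  have "h \<in> nonneg_phase_sums" unfolding h_def
    by (intro nonneg_phase_sums.add nonneg_phase_sums_mult nonneg_phase_sums_const f g) (auto simp: \<open>c \<ge> 0\<close>)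
  moreover have "(\<Prod>p\<in>insert p S. complex_of_real (cos (pi * poly p (of_int n)) ^ (2 * K))) =
      of_real (c ^ card (insert p S)) + h n" for n
    unfolding prod.insert[OF insert.hyps] eq g(2) using insert.hyps
    by (simp add: h_def algebra_simps)
  ultimately show ?case unfolding c_def by blast
qed

text \<open>
  The constant coefficient of the kernel decays like a power of \<open>K\<close>, whereas the kernel
  decays exponentially away from the integers.
\<close>
lemma central_binomial_beats_power:
  assumes "0 < \<rho>" "\<rho> < 1"
  obtains K :: nat where "K > 0" "\<rho> ^ K < (real ((2 * K) choose K) / 4 ^ K) ^ r"
proof -
  have "(\<lambda>K. (2 * real K) ^ r * \<rho> ^ K) \<longlonglongrightarrow> 0" using assms by real_asymp
  then have "\<forall>\<^sub>F K in sequentially. (2 * real K) ^ r * \<rho> ^ K < 1" by (rule order_tendstoD) simp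
  from eventually_happens[OF eventually_conj[OF eventually_gt_at_top[of 0] this]]
  obtain K where K: "K > 0" "(2 * real K) ^ r * \<rho> ^ K < 1" by auto
  have "4 ^ K / (2 * real K) \<le> real ((2 * K) choose K)" by (rule central_binomial_lower_bound[OF K(1)])
  then have "1 / (2 * real K) \<le> real ((2 * K) choose K) / 4 ^ K" using K by (simp add: field_simps)
  then have "(1 / (2 * real K)) ^ r \<le> (real ((2 * K) choose K) / 4 ^ K) ^ r" by (intro power_mono) auto
  moreover have "\<rho> ^ K < (1 / (2 * real K)) ^ r" using K by (simp add: power_divide field_simps)
  ultimately show ?thesis using that K(1) by simp
qed

text \<open>
  The product of the kernels \<open>cos\<^bsup>2K\<^esup>(\<pi>p(n))\<close> is at most \<open>\<rho>\<^sup>K\<close> whenever some \<open>p(n)\<close> is far from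
  the integers, but along a suitable progression its mean is at least its constant coefficient.
\<close>
lemma polynomial_recurrence:
  assumes S: "finite S" "\<And>p. p \<in> S \<Longrightarrow> coeff p 0 = 0" and "\<epsilon> > 0"
  obtains \<eta> :: real and q :: nat where "\<eta> > 0" "q > 0"
    "\<forall>\<^sub>F N in sequentially. \<eta> * real N \<le> real (card {n. n < N \<and> (\<forall>p\<in>S. cmod (poly_phase p (int (q * n)) - 1) < \<epsilon>)})"
proof -
  define \<rho> where "\<rho> = max (1/2) (1 - \<epsilon>\<^sup>2 / 4)"
  have \<rho>: "0 < \<rho>" "\<rho> < 1" using \<open>\<epsilon> > 0\<close> by (auto simp: \<rho>_def)
  define r where "r = card S"
  obtain K :: nat where K: "\<rho> ^ K < (real ((2 * K) choose K) / 4 ^ K) ^ r"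
    using central_binomial_beats_power[OF \<rho>] by blast
  define c where "c = real ((2 * K) choose K) / 4 ^ K"
  have c: "\<rho> ^ K < c ^ r" using K by (simp add: c_def)
  define \<eta> where "\<eta> = (c ^ r - \<rho> ^ K) / 2"
  have "\<eta> > 0" using c by (simp add: \<eta>_def)
  obtain g where g: "g \<in> nonneg_phase_sums"
    "\<And>n. (\<Prod>p\<in>S. complex_of_real (cos (pi * poly p (of_int n)) ^ (2 * K))) = of_real (c ^ r) + g n"
    using prod_cos_power_nonneg[OF S, of K] unfolding c_def r_def by blast
  obtain q L where q: "q > 0" "L \<ge> 0" "null_means (\<lambda>(s::unit) n. g (int (q * n)) - complex_of_real L)"
    using nonneg_phase_sums_mean[OF g(1)] by (metis dvd_refl)
  define F where "F n = (\<Prod>p\<in>S. cos (pi * poly p (of_int n)) ^ (2 * K))" for n :: int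
  have F: "complex_of_real (F n) = of_real (c ^ r) + g n" for n unfolding F_def of_real_prod by (rule g(2))
  define G where "G = {n. \<forall>p\<in>S. cmod (poly_phase p (int (q * n)) - 1) < \<epsilon>}"
  have F_le: "F (int (q * n)) \<le> indicator G n + \<rho> ^ K" for n
  proof (cases "n \<in> G")
    case True
    have "F (int (q * n)) \<le> (\<Prod>p\<in>S. 1)" unfolding F_def
      by (intro prod_mono conjI cos_even_power)
    then show ?thesis using True zero_less_power[OF \<rho>(1), of K] by simp
  next
    case False
    then obtain p where p: "p \<in> S" "cmod (poly_phase p (int (q * n)) - 1) \<ge> \<epsilon>" by (auto simp: G_def not_less)
    have "F (int (q * n)) = cos (pi * poly p (of_int (int (q * n)))) ^ (2 * K) *
        (\<Prod>p\<in>S - {p}. cos (pi * poly p (of_int (int (q * n)))) ^ (2 * K))"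
      unfolding F_def by (rule prod.remove[OF S(1) p(1)])
    also have "\<dots> \<le> \<rho> ^ K * (\<Prod>p\<in>S - {p}. 1)"
    proof (intro mult_mono prod_mono prod_nonneg)
      have "(cos (pi * poly p (of_int (int (q * n)))))\<^sup>2 \<le> 1 - \<epsilon>\<^sup>2 / 4"
        unfolding cos_sq_eq using p(2) \<open>\<epsilon> > 0\<close> power_mono[of \<epsilon> "cmod (ee (poly p (of_int (int (q * n)))) - 1)" 2]
        by (simp add: poly_phase_def)
      then have "(cos (pi * poly p (of_int (int (q * n)))))\<^sup>2 \<le> \<rho>" by (simp add: \<rho>_def)
      then show "cos (pi * poly p (of_int (int (q * n)))) ^ (2 * K) \<le> \<rho> ^ K"
        unfolding power_mult by (intro power_mono) auto
    qed (use \<rho> in \<open>auto simp: cos_even_power\<close>)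
    finally show ?thesis using False by simp
  qed
  show ?thesis
  proof (rule that[OF \<open>\<eta> > 0\<close> q(1)])
    from null_meansD[OF q(3) \<open>\<eta> > 0\<close>]
    show "\<forall>\<^sub>F N in sequentially. \<eta> * real N \<le> real (card {n. n < N \<and> (\<forall>p\<in>S. cmod (poly_phase p (int (q * n)) - 1) < \<epsilon>)})"
    proof eventually_elim
      case (elim N)
      have "(\<Sum>n<N. g (int (q * n)) - complex_of_real L) = of_real ((\<Sum>n<N. F (int (q * n))) - N * (c ^ r + L))"
      proof -
        have "g n = of_real (F n - c ^ r)" for n using F[of n] by (simp add: algebra_simps)
        note g_eq = this
        show ?thesis unfolding g_eq by (simp add: sum_subtractf algebra_simps)
      qed
      then have "\<bar>(\<Sum>n<N. F (int (q * n))) - N * (c ^ r + L)\<bar> \<le> \<eta> * N"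
        using elim by (metis norm_of_real)
      moreover have "real N * (c ^ r + L) \<ge> N * c ^ r" using q(2) by (intro mult_left_mono) auto
      ultimately have "N * c ^ r - \<eta> * N \<le> (\<Sum>n<N. F (int (q * n)))" by linarith
      also have "\<dots> \<le> (\<Sum>n<N. indicator G n + \<rho> ^ K)" by (intro sum_mono F_le)
      also have "\<dots> = real (card {n. n < N \<and> n \<in> G}) + N * \<rho> ^ K"
      proof -
        have "(\<Sum>n<N. indicator G n :: real) = real (card {n. n < N \<and> n \<in> G})"
          by (subst sum.mono_neutral_cong_right[of "{..<N}" "{n. n < N \<and> n \<in> G}" _ "\<lambda>_. 1"])
            (auto simp: indicator_def)
        then show ?thesis by (simp add: sum.distrib)
      qed
      finally have "N * c ^ r - \<eta> * N - N * \<rho> ^ K \<le> real (card {n. n < N \<and> n \<in> G})" by simp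
      moreover have "N * c ^ r - \<eta> * N - N * \<rho> ^ K = \<eta> * N" by (simp add: \<eta>_def field_simps)
      ultimately show ?case by (simp add: G_def)
    qed
  qed
qed

text \<open>
  This turns a simultaneous return of finitely many polynomials to the integers into a return of the
  function to its value at \<open>0\<close>.
\<close>
lemma phase_sums_near:
  assumes "g \<in> phase_sums" "\<delta> > 0"
  obtains S \<epsilon> where "finite S" "\<epsilon> > 0" "\<And>p. p \<in> S \<Longrightarrow> coeff p 0 = 0"
    "\<And>n. (\<And>p. p \<in> S \<Longrightarrow> cmod (poly_phase p n - 1) < \<epsilon>) \<Longrightarrow> cmod (g n - g 0) \<le> \<delta>"
proof -
  have "\<exists>S \<epsilon>. finite S \<and> \<epsilon> > 0 \<and> (\<forall>p\<in>S. coeff p 0 = 0) \<and>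
      (\<forall>n. (\<forall>p\<in>S. cmod (poly_phase p n - 1) < \<epsilon>) \<longrightarrow> cmod (g n - g 0) \<le> \<delta>)"
    using assms
  proof (induction arbitrary: \<delta>)
    case (monomial c p)
    define p0 where "p0 = p - [:coeff p 0:]"
    have eq: "poly_phase p n = ee (coeff p 0) * poly_phase p0 n" for n
      unfolding poly_phase_def ee_add[symmetric] by (simp add: p0_def)
    have p0: "poly_phase p0 0 = 1" by (simp add: poly_phase_def p0_def poly_0_coeff_0)
    have "cmod (c * poly_phase p n - c * poly_phase p 0) \<le> \<delta>" if "cmod (poly_phase p0 n - 1) < \<delta> / (cmod c + 1)" for n
    proof -
      have "c * poly_phase p n - c * poly_phase p 0 = c * ee (coeff p 0) * (poly_phase p0 n - 1)"
        unfolding eq p0 by (simp add: algebra_simps)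
      then have "cmod (c * poly_phase p n - c * poly_phase p 0) = cmod c * cmod (poly_phase p0 n - 1)"
        by (simp add: norm_mult)
      also have "\<dots> \<le> (cmod c + 1) * (\<delta> / (cmod c + 1))" using that by (intro mult_mono) auto
      also have "\<dots> = \<delta>" by (simp add: add_nonneg_eq_0_iff)
      finally show ?thesis .
    qed
    moreover have "\<delta> / (cmod c + 1) > 0" using monomial by (simp add: add_nonneg_pos)
    ultimately show ?case by (intro exI[of _ "{p0}"] exI[of _ "\<delta> / (cmod c + 1)"]) (auto simp: p0_def)
  next
    case (add f g)
    from add.IH(1)[of "\<delta>/2"] add.prems obtain S \<epsilon> where 1: "finite S" "\<epsilon> > 0" "\<forall>p\<in>S. coeff p 0 = 0"
      "\<And>n. (\<forall>p\<in>S. cmod (poly_phase p n - 1) < \<epsilon>) \<longrightarrow> cmod (f n - f 0) \<le> \<delta>/2" by auto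
    from add.IH(2)[of "\<delta>/2"] add.prems obtain S' \<epsilon>' where 2: "finite S'" "\<epsilon>' > 0" "\<forall>p\<in>S'. coeff p 0 = 0"
      "\<And>n. (\<forall>p\<in>S'. cmod (poly_phase p n - 1) < \<epsilon>') \<longrightarrow> cmod (g n - g 0) \<le> \<delta>/2" by auto
    have "cmod (f n + g n - (f 0 + g 0)) \<le> \<delta>"
      if "\<forall>p\<in>S \<union> S'. cmod (poly_phase p n - 1) < min \<epsilon> \<epsilon>'" for n
    proof -
      have "cmod (f n - f 0) \<le> \<delta>/2" "cmod (g n - g 0) \<le> \<delta>/2" using 1(4)[of n] 2(4)[of n] that by auto
      then show ?thesis using norm_triangle_ineq[of "f n - f 0" "g n - g 0"] by (simp add: algebra_simps)
    qed
    moreover have "finite (S \<union> S')" "min \<epsilon> \<epsilon>' > 0" "\<forall>p\<in>S \<union> S'. coeff p 0 = 0" using 1 2 by auto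
    ultimately show ?case by blast
  qed
  then obtain S \<epsilon> where "finite S" "\<epsilon> > 0" "\<forall>p\<in>S. coeff p 0 = 0"
    "\<forall>n. (\<forall>p\<in>S. cmod (poly_phase p n - 1) < \<epsilon>) \<longrightarrow> cmod (g n - g 0) \<le> \<delta>"
    by (elim exE conjE)
  then show ?thesis by (intro that[of S \<epsilon>]) auto
qed

text \<open>
  Near \<open>j\<close> the function is positive at many points by recurrence; the translation-invariance
  of means carries the lower bound over to every starting point \<open>s\<close>.  Recurrence holds along a
  progression \<open>q\<int>\<close>, so that the argument gives the bound when \<open>N\<close> is a multiple of \<open>q\<close>.
\<close>
theorem weyl_algebra_positive_means:
  assumes w: "(\<lambda>n. complex_of_real (w n)) \<in> weyl_algebra" and nonneg: "\<And>n. w n \<ge> 0" and "w j > 0"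
  obtains \<eta> :: real where "\<eta> > 0" "\<And>N0. \<exists>N\<ge>N0. N > 0 \<and> (\<forall>s::int. \<eta> * real N \<le> (\<Sum>n<N. w (s + int n)))"
proof -
  have tr: "(\<lambda>n. complex_of_real (w (n + j))) \<in> weyl_algebra" by (rule W.translate[OF w])
  obtain g where g: "g \<in> phase_sums" "\<And>n. cmod (complex_of_real (w (n + j)) - g n) \<le> w j / 4"
    using weyl_algebra_approx[OF tr, of "w j / 4"] \<open>w j > 0\<close> by auto
  obtain S \<epsilon> where S: "finite S" "\<epsilon> > 0" "\<And>p. p \<in> S \<Longrightarrow> coeff p 0 = 0"
    "\<And>n. (\<And>p. p \<in> S \<Longrightarrow> cmod (poly_phase p n - 1) < \<epsilon>) \<Longrightarrow> cmod (g n - g 0) \<le> w j / 4"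
    by (rule phase_sums_near[OF g(1), of "w j / 4"]) (use \<open>w j > 0\<close> in auto)
  obtain \<eta> :: real and q :: nat where q: "\<eta> > 0" "q > 0"
    "\<forall>\<^sub>F N in sequentially. \<eta> * real N \<le> real (card {n. n < N \<and> (\<forall>p\<in>S. cmod (poly_phase p (int (q * n)) - 1) < \<epsilon>)})"
    by (rule polynomial_recurrence[OF S(1,3,2)])
  define G where "G = {n. \<forall>p\<in>S. cmod (poly_phase p (int (q * n)) - 1) < \<epsilon>}"
  have big: "w (int (q * n) + j) \<ge> w j / 4" if "n \<in> G" for n
  proof -
    have "cmod (g (int (q * n)) - g 0) \<le> w j / 4" using S(4) that by (auto simp: G_def)
    moreover have "cmod (complex_of_real (w j) - complex_of_real (w (int (q * n) + j))) \<le>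
      cmod (complex_of_real (w (0 + j)) - g 0) + cmod (g (int (q * n)) - g 0)
        + cmod (complex_of_real (w (int (q * n) + j)) - g (int (q * n)))" (is "_ \<le> cmod ?a + cmod ?b + cmod ?c")
      using norm_triangle_ineq4[of "?a - ?b" ?c] norm_triangle_ineq4[of ?a ?b] by simp
    ultimately have "cmod (complex_of_real (w j) - complex_of_real (w (int (q * n) + j))) \<le> 3 * (w j / 4)"
      using g(2)[of 0] g(2)[of "int (q * n)"] by linarith
    then have "\<bar>w j - w (int (q * n) + j)\<bar> \<le> 3 * (w j / 4)" by (metis norm_of_real of_real_diff)
    then show ?thesis by linarith
  qed
  define \<kappa> where "\<kappa> = w j * \<eta> / (8 * real q)"
  have "\<kappa> > 0" using q \<open>w j > 0\<close> by (simp add: \<kappa>_def)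
  then have k2: "\<kappa> / 2 > 0" by simp
  have ev: "\<forall>\<^sub>F N in sequentially. \<forall>s. cmod (\<Sum>n<N. complex_of_real (w (s + int n)) - complex_of_real (w (int n))) \<le> \<kappa> / 2 * real N"
    using null_meansD[OF null_means_translation_diff[OF w] k2] .
  then have "\<forall>\<^sub>F N in sequentially. \<forall>s. cmod (\<Sum>n<q * N. complex_of_real (w (s + int n)) - complex_of_real (w (int n))) \<le> \<kappa> / 2 * real (q * N)"
    using q(2) by (intro eventually_compose_filterlim[OF ev]) (auto intro: mult_nat_left_at_top)
  with q(3) have evN: "\<forall>\<^sub>F N in sequentially. \<forall>s::int. \<kappa> * real (q * N) \<le> (\<Sum>n<q * N. w (s + int n))"
  proof eventually_elim
    case (elim N)
    have "\<bar>(\<Sum>n<q * N. w (s + int n)) - (\<Sum>n<q * N. w (int n))\<bar> \<le> \<kappa> / 2 * real (q * N)" for s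
      using elim(2)[THEN spec, of s] by (simp flip: of_real_diff of_real_sum add: sum_subtractf)
    note near = this
    have "w j / 4 * (\<eta> * real N) \<le> w j / 4 * real (card {n. n < N \<and> n \<in> G})"
      using elim(1) \<open>w j > 0\<close> unfolding G_def by (intro mult_left_mono) auto
    also have "\<dots> = (\<Sum>n\<in>{n. n < N \<and> n \<in> G}. w j / 4)" by simp
    also have "\<dots> \<le> (\<Sum>n\<in>{n. n < N \<and> n \<in> G}. w (j + int (q * n)))"
      using big by (intro sum_mono) (auto simp: add.commute)
    also have "\<dots> = (\<Sum>n\<in>(\<lambda>n. q * n) ` {n. n < N \<and> n \<in> G}. w (j + int n))"
      using q(2) by (subst sum.reindex) (auto simp: inj_on_def)
    also have "\<dots> \<le> (\<Sum>n<q * N. w (j + int n))"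
      using q(2) by (intro sum_mono2) (auto simp: nonneg)
    finally have "2 * \<kappa> * real (q * N) \<le> (\<Sum>n<q * N. w (j + int n))" using q(2) by (simp add: \<kappa>_def field_simps)
    note large = this
    have halves: "\<kappa> / 2 * real (q * N) = (\<kappa> * real (q * N)) / 2" "2 * \<kappa> * real (q * N) = 2 * (\<kappa> * real (q * N))"
      by simp_all
    show ?case
    proof
      fix s
      show "\<kappa> * real (q * N) \<le> (\<Sum>n<q * N. w (s + int n))"
        using near[of s] near[of j] large unfolding halves by linarith
    qed
  qed
  show ?thesis
  proof (rule that[OF \<open>\<kappa> > 0\<close>])
    fix N0
    from eventually_happens[OF eventually_conj[OF eventually_ge_at_top[of "Suc N0"] evN]]
    obtain N where N: "N \<ge> Suc N0" "\<forall>s::int. \<kappa> * real (q * N) \<le> (\<Sum>n<q * N. w (s + int n))" by auto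
    moreover have "q * N \<ge> N" using q(2) by simp
    then have "q * N \<ge> N0" "q * N > 0" using N(1) by linarith+
    ultimately show "\<exists>N\<ge>N0. N > 0 \<and> (\<forall>s::int. \<kappa> * real N \<le> (\<Sum>n<N. w (s + int n)))"
      by blast
  qed
qed


section \<open>Coset spaces of the Heisenberg group\<close>

text \<open>The Heisenberg group law in the coordinates \<open>(x, y, z)\<close>.\<close>
definition hmul :: "real \<times> real \<times> real \<Rightarrow> real \<times> real \<times> real \<Rightarrow> real \<times> real \<times> real" where
  "hmul g h = (fst g + fst h, fst (snd g) + fst (snd h), snd (snd g) + snd (snd h) + fst g * fst (snd h))"

definition hinv :: "real \<times> real \<times> real \<Rightarrow> real \<times> real \<times> real" where
  "hinv g = (- fst g, - fst (snd g), - snd (snd g) + fst g * fst (snd g))"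

definition hmat :: "real \<times> real \<times> real \<Rightarrow> real^3^3" where
  "hmat g = heis (fst g) (fst (snd g)) (snd (snd g))"

lemma hmul_Pair [simp]: "hmul (x, y, z) (p, q, r) = (x + p, y + q, z + r + x * q)"
  by (simp add: hmul_def)

lemma hmul_assoc: "hmul (hmul a b) c = hmul a (hmul b c)"
  by (simp add: hmul_def algebra_simps)

lemma hmul_0 [simp]: "hmul g 0 = g" "hmul 0 g = g"
  by (simp_all add: hmul_def prod_eq_iff)

lemma hmul_hinv [simp]: "hmul g (hinv g) = 0" "hmul (hinv g) g = 0"
  by (simp_all add: hmul_def hinv_def prod_eq_iff)

lemma hmul_hinv_cancel [simp]: "hmul g (hmul (hinv g) h) = h" "hmul (hinv g) (hmul g h) = h"
  by (simp_all flip: hmul_assoc)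

lemma continuous_on_hmul [continuous_intros]:
  "continuous_on A f \<Longrightarrow> continuous_on A g \<Longrightarrow> continuous_on A (\<lambda>x. hmul (f x) (g x))"
  unfolding hmul_def by (intro continuous_intros)

lemma continuous_on_hinv [continuous_intros]:
  "continuous_on A f \<Longrightarrow> continuous_on A (\<lambda>x. hinv (f x))"
  unfolding hinv_def by (intro continuous_intros)

lemma hmat_hmul: "hmat (hmul g h) = hmat g ** hmat h"
  by (simp add: hmat_def hmul_def heis_mult)

lemma inj_hmat: "inj hmat"
  by (auto simp: inj_def hmat_def heis_eq_iff prod_eq_iff)

lemma carrier_heis: "carrier heis_group = range hmat"
  by (auto simp: heis_group_def hmat_def image_def)

lemma continuous_on_hmat: "continuous_on UNIV hmat"
proof -
  have "continuous_on UNIV (\<lambda>g. hmat g $ i $ j)" for i j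
    using exhaust_3[of i] exhaust_3[of j]
    by (elim disjE) (simp_all add: hmat_def heis_def continuous_on_fst continuous_on_snd continuous_on_id)
  then have "continuous_on UNIV (\<lambda>g. \<chi> i j. hmat g $ i $ j)"
    by (intro continuous_on_vec_lambda)
  then show ?thesis by simp
qed

lemma openin_hmat_image: "openin (top_of_set (range hmat)) (hmat ` V) \<longleftrightarrow> open V"
proof
  assume "openin (top_of_set (range hmat)) (hmat ` V)"
  then have "open (hmat -` (hmat ` V))"
    using continuous_openin_preimage[OF continuous_on_hmat, of "range hmat" "hmat ` V"] by auto
  then show "open V" by (simp add: inj_vimage_image_eq[OF inj_hmat])
next
  assume V: "open V"
  define c :: "real^3^3 \<Rightarrow> real \<times> real \<times> real" where "c m = (m $ 1 $ 2, m $ 2 $ 3, m $ 1 $ 3)" for m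
  have c: "c (hmat g) = g" for g by (simp add: c_def hmat_def heis_def)
  have "continuous_on (range hmat) c" unfolding c_def by (intro continuous_intros)
  from continuous_openin_preimage[OF this, of UNIV V] V
  have "openin (top_of_set (range hmat)) (range hmat \<inter> c -` V)" by simp
  moreover have "range hmat \<inter> c -` V = hmat ` V" using c by auto
  ultimately show "openin (top_of_set (range hmat)) (hmat ` V)" by simp
qed

text \<open>The coset of \<open>g\<close> modulo the subgroup with coordinates \<open>S\<close>, as a set of matrices.\<close>
definition hcoset :: "(real \<times> real \<times> real) set \<Rightarrow> real \<times> real \<times> real \<Rightarrow> (real^3^3) set" where
  "hcoset S g = hmat ` hmul g ` S"

abbreviation coset_space :: "(real \<times> real \<times> real) set \<Rightarrow> (real^3^3) set topology" where
  "coset_space S \<equiv> heis_quotient (hmat ` S)"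

lemma l_coset_hmat: "hmat g <#\<^bsub>heis_group\<^esub> (hmat ` S) = hcoset S g"
  by (simp add: l_coset_def hcoset_def heis_group_def image_image hmat_hmul UNION_singleton_eq_range)

lemma openin_coset_space: "openin (coset_space S) U \<longleftrightarrow> U \<subseteq> range (hcoset S) \<and> open (hcoset S -` U)"
proof -
  have "(\<lambda>g. g <#\<^bsub>heis_group\<^esub> (hmat ` S)) ` range hmat = range (hcoset S)"
    by (simp add: image_image l_coset_hmat)
  moreover have "{x \<in> range hmat. x <#\<^bsub>heis_group\<^esub> (hmat ` S) \<in> U} = hmat ` (hcoset S -` U)"
    by (auto simp: l_coset_hmat)
  ultimately show ?thesis
    unfolding heis_quotient_def openin_quotient_topology carrier_heis topspace_euclidean_subtopology
    by (simp only: openin_hmat_image)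
qed

lemma topspace_coset_space [simp]: "topspace (coset_space S) = range (hcoset S)"
  unfolding heis_quotient_def topspace_quotient_topology carrier_heis topspace_euclidean_subtopology
  by (simp add: image_image l_coset_hmat)

lemma continuous_map_hcoset: "continuous_map euclidean (coset_space S) (hcoset S)"
  unfolding continuous_map_def by (auto simp: openin_coset_space vimage_def)

lemma continuous_map_from_coset_space:
  assumes "continuous_map euclidean Y (\<lambda>g. f (hcoset S g))"
  shows "continuous_map (coset_space S) Y f"
  unfolding continuous_map_def
proof (intro conjI allI impI)
  show "f \<in> topspace (coset_space S) \<rightarrow> topspace Y" using assms by (auto simp: continuous_map_def)
  fix U assume "openin Y U"
  then have "openin euclidean {g \<in> topspace euclidean. f (hcoset S g) \<in> U}"
    using assms by (simp only: continuous_map_def)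
  then have "open {g. f (hcoset S g) \<in> U}" by simp
  moreover have "hcoset S -` {x \<in> topspace (coset_space S). f x \<in> U} = {g. f (hcoset S g) \<in> U}" by auto
  ultimately show "openin (coset_space S) {x \<in> topspace (coset_space S). f x \<in> U}"
    unfolding openin_coset_space by auto
qed

definition hsubgroup :: "(real \<times> real \<times> real) set \<Rightarrow> bool" where
  "hsubgroup S \<longleftrightarrow> 0 \<in> S \<and> (\<forall>a\<in>S. hinv a \<in> S) \<and> (\<forall>a\<in>S. \<forall>b\<in>S. hmul a b \<in> S)"

lemma hcoset_eq_iff:
  assumes S: "hsubgroup S"
  shows "hcoset S g = hcoset S g' \<longleftrightarrow> hmul (hinv g) g' \<in> S"
proof -
  have "hcoset S g = hcoset S g' \<longleftrightarrow> hmul g ` S = hmul g' ` S"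
    unfolding hcoset_def by (rule inj_image_eq_iff[OF inj_hmat])
  also have "\<dots> \<longleftrightarrow> hmul (hinv g) g' \<in> S"
  proof
    assume eq: "hmul g ` S = hmul g' ` S"
    have "hmul g' 0 \<in> hmul g' ` S" using S unfolding hsubgroup_def by blast
    then have "g' \<in> hmul g ` S" unfolding eq by simp
    then show "hmul (hinv g) g' \<in> S" by auto
  next
    assume s: "hmul (hinv g) g' \<in> S"
    define s where "s = hmul (hinv g) g'"
    have g': "g' = hmul g s" by (simp add: s_def)
    have "hmul s ` S = S"
    proof
      show "hmul s ` S \<subseteq> S" using S s unfolding hsubgroup_def s_def by blast
      show "S \<subseteq> hmul s ` S"
      proof
        fix a assume "a \<in> S"
        then have "hmul (hinv s) a \<in> S" using S s unfolding hsubgroup_def s_def by blast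
        then have "hmul s (hmul (hinv s) a) \<in> hmul s ` S" by (rule imageI)
        then show "a \<in> hmul s ` S" by simp
      qed
    qed
    then have "hmul g ` hmul s ` S = hmul g ` S" by simp
    then show "hmul g ` S = hmul g' ` S" unfolding g' by (simp add: image_image hmul_assoc)
  qed
  finally show ?thesis .
qed

lemma hcoset_hmul:
  assumes "hsubgroup S" "s \<in> S"
  shows "hcoset S (hmul g s) = hcoset S g"
proof -
  have "hcoset S g = hcoset S (hmul g s)" using assms by (simp add: hcoset_eq_iff)
  then show ?thesis ..
qed

lemma openin_hcoset_image:
  assumes S: "hsubgroup S" and "open W"
  shows "openin (coset_space S) (hcoset S ` W)"
proof -
  have "hcoset S -` hcoset S ` W = (\<Union>s\<in>S. (\<lambda>g. hmul g s) -` W)"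
  proof (intro Set.set_eqI iffI)
    fix g assume "g \<in> hcoset S -` hcoset S ` W"
    then obtain w where "w \<in> W" "hcoset S g = hcoset S w" by auto
    then have "hmul (hinv g) w \<in> S" "hmul g (hmul (hinv g) w) \<in> W" using hcoset_eq_iff[OF S] by auto
    then show "g \<in> (\<Union>s\<in>S. (\<lambda>g. hmul g s) -` W)" by blast
  next
    fix g assume "g \<in> (\<Union>s\<in>S. (\<lambda>g. hmul g s) -` W)"
    then obtain s where s: "s \<in> S" "hmul g s \<in> W" by blast
    then show "g \<in> hcoset S -` hcoset S ` W" using hcoset_hmul[OF S s(1), of g] by (metis imageI vimageI2)
  qed
  moreover have "open ((\<lambda>g. hmul g s) -` W)" for s
    using \<open>open W\<close> by (intro open_vimage continuous_intros)
  ultimately show ?thesis unfolding openin_coset_space by auto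
qed

text \<open>
  The quotient map is open, and \<open>g, h\<close> lie in the same coset iff \<open>g\<^sup>-\<^sup>1h \<in> S\<close>, a closed condition; so distinct
  cosets are separated by the images of a product neighbourhood.
\<close>
lemma Hausdorff_coset_space:
  assumes S: "hsubgroup S" and "closed S"
  shows "Hausdorff_space (coset_space S)"
  unfolding Hausdorff_space_def
proof (intro allI impI)
  fix x y assume "x \<in> topspace (coset_space S) \<and> y \<in> topspace (coset_space S) \<and> x \<noteq> y"
  then have "x \<in> range (hcoset S)" "y \<in> range (hcoset S)" and xy: "x \<noteq> y" by simp_all
  then obtain g h where gh: "x = hcoset S g" "y = hcoset S h" by (elim rangeE)
  define R where "R = (\<lambda>p. hmul (hinv (fst p)) (snd p)) -` S"
  have "closed R" unfolding R_def using \<open>closed S\<close> by (intro closed_vimage continuous_intros)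
  then have "open (- R)" by (simp add: open_Compl)
  moreover have "(g, h) \<in> - R" using xy gh hcoset_eq_iff[OF S] by (simp add: R_def)
  ultimately obtain A B where AB: "open A" "open B" "g \<in> A" "h \<in> B" "A \<times> B \<subseteq> - R"
    by (rule open_prod_elim) auto
  have "disjnt (hcoset S ` A) (hcoset S ` B)"
    unfolding disjnt_def
  proof (rule ccontr)
    assume "hcoset S ` A \<inter> hcoset S ` B \<noteq> {}"
    then obtain a b where "a \<in> A" "b \<in> B" "hcoset S a = hcoset S b" by auto
    then have "(a, b) \<in> R \<inter> A \<times> B" using hcoset_eq_iff[OF S] by (simp add: R_def)
    then show False using AB(5) by blast
  qed
  then show "\<exists>U V. openin (coset_space S) U \<and> openin (coset_space S) V \<and> x \<in> U \<and> y \<in> V \<and> disjnt U V"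
    using AB openin_hcoset_image[OF S] gh by blast
qed

lemma lattice_representative:
  obtains s where "s \<in> \<int> \<times> \<int> \<times> \<int>" "hmul g s \<in> {0..1} \<times> {0..1} \<times> {0..1}"
proof -
  obtain x y z where g: "g = (x, y, z)" by (cases g)
  let ?s = "(- of_int \<lfloor>x\<rfloor>, - of_int \<lfloor>y\<rfloor>, - of_int \<lfloor>z - x * of_int \<lfloor>y\<rfloor>\<rfloor>)"
  have "?s \<in> \<int> \<times> \<int> \<times> \<int>" by auto
  moreover have "hmul g ?s \<in> {0..1} \<times> {0..1} \<times> {0..1}"
    unfolding g hmul_Pair mem_Times_iff fst_conv snd_conv atLeastAtMost_iff by (intro conjI) linarith+
  ultimately show ?thesis by (rule that)
qed

lemma compact_coset_space:
  assumes S: "hsubgroup S" and "\<int> \<times> \<int> \<times> \<int> \<subseteq> S"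
  shows "compact_space (coset_space S)"
proof -
  have "compact ({0..1} \<times> {0..1} \<times> {0..1} :: (real \<times> real \<times> real) set)"
    by (intro compact_Times compact_Icc)
  then have "compactin (coset_space S) (hcoset S ` ({0..1} \<times> {0..1} \<times> {0..1}))"
    by (intro image_compactin[OF _ continuous_map_hcoset]) simp
  moreover have "hcoset S ` ({0..1} \<times> {0..1} \<times> {0..1}) = topspace (coset_space S)"
  proof
    show "topspace (coset_space S) \<subseteq> hcoset S ` ({0..1} \<times> {0..1} \<times> {0..1})"
    proof
      fix C assume "C \<in> topspace (coset_space S)"
      then obtain g where "C = hcoset S g" by auto
      moreover obtain s where "s \<in> \<int> \<times> \<int> \<times> \<int>" "hmul g s \<in> {0..1} \<times> {0..1} \<times> {0..1}"
        using lattice_representative[of g] by blast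
      ultimately show "C \<in> hcoset S ` ({0..1} \<times> {0..1} \<times> {0..1})"
        using hcoset_hmul[OF S, of s g] assms(2) by (metis imageI subsetD)
    qed
  qed auto
  ultimately show ?thesis by (simp add: compact_space_def)
qed

text \<open>The coordinates of the translating element.\<close>
definition htau :: "real \<Rightarrow> real \<Rightarrow> real \<Rightarrow> real \<times> real \<times> real" where
  "htau \<alpha> \<beta> \<gamma> = (\<alpha>, \<beta>, \<gamma> + \<alpha> * \<beta> / 2)"

lemma nil_translation_hcoset: "nil_translation \<alpha> \<beta> \<gamma> (hcoset S g) = hcoset S (hmul (htau \<alpha> \<beta> \<gamma>) g)"
proof -
  have "heis_tau \<alpha> \<beta> \<gamma> = hmat (htau \<alpha> \<beta> \<gamma>)" by (simp add: heis_tau_def hmat_def htau_def)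
  then show ?thesis
    unfolding nil_translation_def hcoset_def[of S g] by (simp only: l_coset_hmat) (simp add: hcoset_def image_image hmul_assoc)
qed

lemma hinv_htau: "hinv (htau \<alpha> \<beta> \<gamma>) = htau (- \<alpha>) (- \<beta>) (- \<gamma>)"
  by (simp add: hinv_def htau_def)

lemma continuous_map_nil_translation: "continuous_map (coset_space S) (coset_space S) (nil_translation \<alpha> \<beta> \<gamma>)"
proof (rule continuous_map_from_coset_space)
  have "continuous_map euclidean euclidean (\<lambda>g. hmul (htau \<alpha> \<beta> \<gamma>) g)"
    unfolding continuous_map_iff_continuous2 by (intro continuous_intros)
  from continuous_map_compose[OF this continuous_map_hcoset, of S]
  show "continuous_map euclidean (coset_space S) (\<lambda>g. nil_translation \<alpha> \<beta> \<gamma> (hcoset S g))"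
    by (simp add: nil_translation_hcoset o_def)
qed

lemma homeomorphic_maps_nil_translation:
  "homeomorphic_maps (coset_space S) (coset_space S) (nil_translation \<alpha> \<beta> \<gamma>) (nil_translation (- \<alpha>) (- \<beta>) (- \<gamma>))"
proof -
  have "nil_translation (- \<alpha>) (- \<beta>) (- \<gamma>) (nil_translation \<alpha> \<beta> \<gamma> (hcoset S g)) = hcoset S g" for g \<alpha> \<beta> \<gamma>
    by (simp add: nil_translation_hcoset flip: hinv_htau)
  from this this[of "- \<alpha>" "- \<beta>" "- \<gamma>"] show ?thesis
    unfolding homeomorphic_maps_def by (auto simp: continuous_map_nil_translation)
qed

lemma flow_coset_space:
  assumes "hsubgroup S" "closed S" "\<int> \<times> \<int> \<times> \<int> \<subseteq> S"
  shows "flow (coset_space S) (nil_translation \<alpha> \<beta> \<gamma>)"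
  unfolding flow_def
  using compact_coset_space[OF assms(1,3)] Hausdorff_coset_space[OF assms(1,2)] homeomorphic_maps_nil_translation[of S \<alpha> \<beta> \<gamma>]
  by (auto simp: homeomorphic_map_maps)

lemma nil_translation_funpow:
  "(nil_translation \<alpha> \<beta> \<gamma> ^^ n) (hcoset S (x, y, z)) =
    hcoset S (x + real n * \<alpha>, y + real n * \<beta>, z + real n * \<gamma> + (real n)\<^sup>2 * \<alpha> * \<beta> / 2 + real n * \<alpha> * y)"
proof (induction n)
  case (Suc n)
  have "hmul (htau \<alpha> \<beta> \<gamma>) (x + real n * \<alpha>, y + real n * \<beta>,
        z + real n * \<gamma> + (real n)\<^sup>2 * \<alpha> * \<beta> / 2 + real n * \<alpha> * y) =
      (x + real (Suc n) * \<alpha>, y + real (Suc n) * \<beta>,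
        z + real (Suc n) * \<gamma> + (real (Suc n))\<^sup>2 * \<alpha> * \<beta> / 2 + real (Suc n) * \<alpha> * y)"
    by (simp add: htau_def power2_eq_square field_simps)
  then show ?case
    by (simp only: funpow.simps o_apply Suc nil_translation_hcoset)
qed simp

text \<open>Coordinates of the lattice \<open>\<Gamma>\<close> and of \<open>B\<Gamma>\<close>, where \<open>B\<close> is the centre.\<close>
abbreviation Zlat :: "(real \<times> real \<times> real) set" where "Zlat \<equiv> \<int> \<times> \<int> \<times> \<int>"
abbreviation Zcen :: "(real \<times> real \<times> real) set" where "Zcen \<equiv> \<int> \<times> \<int> \<times> UNIV"

lemma heis_lattice_eq: "heis_lattice = hmat ` Zlat"
  by (force simp: heis_lattice_def hmat_def)

lemma center_lattice_eq: "center_lattice = hmat ` Zcen"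
proof (intro Set.set_eqI iffI)
  fix g assume "g \<in> center_lattice"
  then show "g \<in> hmat ` Zcen"
    unfolding center_lattice_def set_mult_def heis_center_def heis_lattice_def
    by (auto simp: heis_group_def heis_mult hmat_def image_iff) blast
next
  fix g assume "g \<in> hmat ` Zcen"
  then obtain x y z where g: "g = heis x y z" "x \<in> \<int>" "y \<in> \<int>" by (auto simp: hmat_def)
  then have "g = heis 0 0 z \<otimes>\<^bsub>heis_group\<^esub> heis x y 0" by (simp add: heis_group_def heis_mult)
  moreover have "heis 0 0 z \<in> heis_center" "heis x y 0 \<in> heis_lattice"
    using g Ints_0 unfolding heis_center_def heis_lattice_def by blast+
  ultimately show "g \<in> center_lattice" unfolding center_lattice_def set_mult_def by blast
qed

lemma nil_space_eq: "nil_space = coset_space Zlat" by (simp add: nil_space_def heis_lattice_eq)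
lemma torus_space_eq: "torus_space = coset_space Zcen" by (simp add: torus_space_def center_lattice_eq)

lemma hsubgroup_Zlat: "hsubgroup Zlat" by (auto simp: hsubgroup_def hmul_def hinv_def zero_prod_def)
lemma hsubgroup_Zcen: "hsubgroup Zcen" by (auto simp: hsubgroup_def hmul_def hinv_def zero_prod_def)
lemma closed_Zlat: "closed Zlat" by (intro closed_Times closed_Ints)
lemma closed_Zcen: "closed Zcen" by (intro closed_Times closed_Ints closed_UNIV)

lemma hcoset_Zcen_eq_iff: "hcoset Zcen (x, y, z) = hcoset Zcen (x', y', z') \<longleftrightarrow> x' - x \<in> \<int> \<and> y' - y \<in> \<int>"
  unfolding hcoset_eq_iff[OF hsubgroup_Zcen] by (simp add: hinv_def)

lemma set_mult_hcoset: "hcoset S g <#>\<^bsub>heis_group\<^esub> (hmat ` S') = (\<Union>s\<in>S. hcoset S' (hmul g s))"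
  by (simp add: set_mult_def hcoset_def heis_group_def image_image hmat_hmul UNION_singleton_eq_range)

lemma nil_proj_hcoset: "nil_proj (hcoset Zlat g) = hcoset Zcen g"
proof -
  have "hcoset Zcen (hmul g s) = hcoset Zcen g" if "s \<in> Zlat" for s
    using that by (intro hcoset_hmul hsubgroup_Zcen) auto
  moreover have "0 \<in> Zlat" by (simp add: zero_prod_def)
  ultimately show ?thesis
    unfolding nil_proj_def center_lattice_eq set_mult_hcoset by blast
qed

lemma flow_nil: "flow nil_space (nil_translation \<alpha> \<beta> \<gamma>)"
  unfolding nil_space_eq by (rule flow_coset_space[OF hsubgroup_Zlat closed_Zlat]) simp

lemma flow_torus: "flow torus_space (nil_translation \<alpha> \<beta> \<gamma>)"
  unfolding torus_space_eq by (rule flow_coset_space[OF hsubgroup_Zcen closed_Zcen]) auto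

lemma flow_hom_nil_proj:
  "flow_hom nil_space (nil_translation \<alpha> \<beta> \<gamma>) torus_space (nil_translation \<alpha> \<beta> \<gamma>) nil_proj"
  unfolding flow_hom_def
proof (intro conjI flow_nil flow_torus)
  show "continuous_map nil_space torus_space nil_proj"
    unfolding nil_space_eq torus_space_eq
    by (rule continuous_map_from_coset_space) (simp add: nil_proj_hcoset continuous_map_hcoset)
  show "nil_proj ` topspace nil_space = topspace torus_space"
    unfolding nil_space_eq torus_space_eq by (simp add: image_image nil_proj_hcoset)
  show "\<forall>x\<in>topspace nil_space. nil_proj (nil_translation \<alpha> \<beta> \<gamma> x) = nil_translation \<alpha> \<beta> \<gamma> (nil_proj x)"
    unfolding nil_space_eq by (auto simp: nil_proj_hcoset nil_translation_hcoset)
qed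

lemma flow_power_of_nat: "flow_power X T (int n) = T ^^ n"
  by (simp add: flow_power_def)

lemma flow_power_torus:
  "flow_power torus_space (nil_translation \<alpha> \<beta> \<gamma>) n (hcoset Zcen (x, y, z)) =
     hcoset Zcen (x + of_int n * \<alpha>, y + of_int n * \<beta>, z)"
proof (cases "0 \<le> n")
  case True
  then show ?thesis
    by (simp add: flow_power_def nil_translation_funpow hcoset_Zcen_eq_iff)
next
  case False
  define T where "T = nil_translation \<alpha> \<beta> \<gamma>"
  have "inj_on T (topspace torus_space)"
    using flow_torus homeomorphic_imp_injective_map unfolding flow_def T_def by blast
  have inv: "inv_into (topspace torus_space) T (hcoset Zcen (x, y, z)) = hcoset Zcen (x - \<alpha>, y - \<beta>, z)" for x y
  proof (rule inv_into_f_eq)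
    show "inj_on T (topspace torus_space)" by fact
    show "hcoset Zcen (x - \<alpha>, y - \<beta>, z) \<in> topspace torus_space" by (simp add: torus_space_eq)
    show "T (hcoset Zcen (x - \<alpha>, y - \<beta>, z)) = hcoset Zcen (x, y, z)"
      by (simp add: T_def nil_translation_hcoset htau_def hcoset_Zcen_eq_iff)
  qed
  have "(inv_into (topspace torus_space) T ^^ k) (hcoset Zcen (x, y, z)) = hcoset Zcen (x - real k * \<alpha>, y - real k * \<beta>, z)" for k
    by (induction k) (auto simp: inv algebra_simps)
  from this[of "nat (- n)"] show ?thesis using False by (simp add: flow_power_def T_def)
qed

text \<open>
  By compactness a neighbourhood of the diagonal contains all pairs whose coordinates differ by less
  than some \<open>\<epsilon>\<close>, and rotations preserve the differences of coordinates.
\<close>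
theorem equicontinuous_torus: "equicontinuous_flow torus_space (nil_translation \<alpha> \<beta> \<gamma>)"
  unfolding equicontinuous_flow_def
proof (intro conjI flow_torus allI impI)
  fix U assume U: "openin (prod_topology torus_space torus_space) U \<and> (\<forall>x\<in>topspace torus_space. (x, x) \<in> U)"
  let ?c = "hcoset Zcen"
  let ?K = "{0..1} \<times> {0..1} \<times> {0..1} :: (real \<times> real \<times> real) set"
  define P where "P = (\<lambda>p. (?c (fst p), ?c (snd p))) -` U"
  have c: "continuous_map euclidean (coset_space Zcen) (?c \<circ> f)"
    if "continuous_map euclidean euclidean f" for f :: "(real \<times> real \<times> real) \<times> (real \<times> real \<times> real) \<Rightarrow> real \<times> real \<times> real"
    using continuous_map_compose[OF that continuous_map_hcoset] .
  have "continuous_map euclidean (prod_topology torus_space torus_space) (\<lambda>p. ((?c \<circ> fst) p, (?c \<circ> snd) p))"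
    unfolding torus_space_eq
    by (rule continuous_map_pairedI[OF c c]; unfold continuous_map_iff_continuous2)
      (intro continuous_on_fst continuous_on_snd continuous_on_id)+
  then have "continuous_map euclidean (prod_topology torus_space torus_space) (\<lambda>p. (?c (fst p), ?c (snd p)))"
    unfolding o_apply .
  from openin_continuous_map_preimage[OF this] U have opn: "open P"
    by (simp add: P_def vimage_def)
  have sub: "(\<lambda>g. (g, g)) ` ?K \<subseteq> P"
    using U by (auto simp: P_def torus_space_eq)
  have cpt: "compact ((\<lambda>g. (g, g)) ` ?K)"
    by (intro compact_continuous_image compact_Times compact_Icc continuous_intros)
  obtain \<epsilon> where \<epsilon>: "\<epsilon> > 0" "(\<Union>p\<in>(\<lambda>g. (g, g)) ` ?K. ball p \<epsilon>) \<subseteq> P"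
    by (rule compact_subset_open_imp_ball_epsilon_subset[OF cpt opn sub])
  have near: "(?c g, ?c h) \<in> U" if "dist g h < \<epsilon>" "g \<in> ?K" for g h
  proof -
    have "(g, h) \<in> ball (g, g) \<epsilon>" using that by (simp add: dist_Pair_Pair)
    then have "(g, h) \<in> P" using \<epsilon>(2) that(2) by blast
    then show ?thesis by (simp add: P_def)
  qed
  have near': "(?c (x, y, 0), ?c (x', y', 0)) \<in> U" if "dist (x, y) (x', y') < \<epsilon>" for x y x' y'
  proof -
    define g h where "g = (frac x, frac y, 0::real)" and "h = (x' - of_int \<lfloor>x\<rfloor>, y' - of_int \<lfloor>y\<rfloor>, 0::real)"
    have "g \<in> ?K" using frac_lt_1[of x] frac_lt_1[of y] by (auto simp: g_def intro: less_imp_le)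
    moreover have "dist g h < \<epsilon>" using that by (simp add: g_def h_def dist_Pair_Pair dist_real_def frac_def algebra_simps)
    ultimately have "(?c g, ?c h) \<in> U" by (rule near[rotated])
    moreover have "?c g = ?c (x, y, 0)" "?c h = ?c (x', y', 0)"
      by (simp_all add: g_def h_def hcoset_Zcen_eq_iff frac_def)
    ultimately show ?thesis by simp
  qed
  define V where "V = (\<Union>g. (?c ` ball g (\<epsilon>/2)) \<times> (?c ` ball g (\<epsilon>/2)))"
  have "openin (prod_topology torus_space torus_space) V"
    unfolding V_def torus_space_eq
    by (intro openin_Union) (auto simp: openin_prod_Times_iff intro!: openin_hcoset_image hsubgroup_Zcen)
  moreover have "(x, x) \<in> V" if "x \<in> topspace torus_space" for x
  proof -
    from that have "x \<in> range ?c" by (simp add: torus_space_eq)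
    then obtain g where "x = ?c g" by (elim rangeE)
    then have "x \<in> ?c ` ball g (\<epsilon>/2)" using \<epsilon>(1) by simp
    then show ?thesis unfolding V_def by blast
  qed
  moreover have "(flow_power torus_space (nil_translation \<alpha> \<beta> \<gamma>) n a, flow_power torus_space (nil_translation \<alpha> \<beta> \<gamma>) n b) \<in> U"
    if "(a, b) \<in> V" for a b n
  proof -
    from that obtain k where "a \<in> ?c ` ball k (\<epsilon>/2)" "b \<in> ?c ` ball k (\<epsilon>/2)"
      unfolding V_def by blast
    then obtain g h where gh: "a = ?c g" "b = ?c h" "g \<in> ball k (\<epsilon>/2)" "h \<in> ball k (\<epsilon>/2)"
      by (elim imageE)
    obtain x y z x' y' z' where xy: "g = (x, y, z)" "h = (x', y', z')" by (cases g, cases h) auto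
    have "dist g h < \<epsilon>" using gh(3,4) by (metis dist_commute dist_triangle_half_l mem_ball)
    moreover have "dist (x, y) (x', y') \<le> dist g h"
      unfolding xy dist_Pair_Pair by (intro real_sqrt_le_mono) auto
    ultimately have "dist (x + of_int n * \<alpha>, y + of_int n * \<beta>) (x' + of_int n * \<alpha>, y' + of_int n * \<beta>) < \<epsilon>"
      by (simp add: dist_Pair_Pair dist_real_def)
    from near'[OF this] have "(?c (x + of_int n * \<alpha>, y + of_int n * \<beta>, 0), ?c (x' + of_int n * \<alpha>, y' + of_int n * \<beta>, 0)) \<in> U" .
    moreover have "?c (u, v, w) = ?c (u, v, 0)" for u v w by (simp add: hcoset_Zcen_eq_iff)
    ultimately show ?thesis
      unfolding gh(1,2) xy flow_power_torus by metis
  qed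
  ultimately show "\<exists>V. openin (prod_topology torus_space torus_space) V \<and> (\<forall>x\<in>topspace torus_space. (x, x) \<in> V) \<and>
      (\<forall>(x, y)\<in>V. \<forall>n. (flow_power torus_space (nil_translation \<alpha> \<beta> \<gamma>) n x, flow_power torus_space (nil_translation \<alpha> \<beta> \<gamma>) n y) \<in> U)"
    by blast
qed


section \<open>Flows and fibre products\<close>

lemma minimal_flowI:
  assumes "flow X T"
    and hit: "\<And>x U. x \<in> topspace X \<Longrightarrow> openin X U \<Longrightarrow> U \<noteq> {} \<Longrightarrow> \<exists>n::nat. (T ^^ n) x \<in> U"
  shows "minimal_flow X T"
  unfolding minimal_flow_def
proof (intro conjI ballI assms(1))
  fix x assume x: "x \<in> topspace X"
  show "X closure_of range (\<lambda>n. flow_power X T n x) = topspace X"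
  proof (rule antisym[OF closure_of_subset_topspace], rule subsetI)
    fix y assume "y \<in> topspace X"
    have "\<exists>z. z \<in> range (\<lambda>n. flow_power X T n x) \<and> z \<in> U" if "y \<in> U \<and> openin X U" for U
    proof -
      have "openin X U" "U \<noteq> {}" using that by auto
      then obtain n :: nat where "(T ^^ n) x \<in> U" using hit[OF x] by blast
      then have "flow_power X T (int n) x \<in> U" by (simp add: flow_power_of_nat)
      then show ?thesis by blast
    qed
    then show "y \<in> X closure_of range (\<lambda>n. flow_power X T n x)"
      unfolding in_closure_of using \<open>y \<in> topspace X\<close> by blast
  qed
qed

lemma topspace_fiber_product:
  "topspace (fiber_product X p Z q) = {(x, z). x \<in> topspace X \<and> z \<in> topspace Z \<and> p x = q z}"
  by (auto simp: fiber_product_def)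

lemma continuous_map_fiber_product:
  assumes "continuous_map X X f" "continuous_map Z Z g"
    and "\<And>x z. x \<in> topspace X \<Longrightarrow> z \<in> topspace Z \<Longrightarrow> p x = q z \<Longrightarrow> p (f x) = q (g z)"
  shows "continuous_map (fiber_product X p Z q) (fiber_product X p Z q) (map_prod f g)"
proof -
  have "continuous_map (prod_topology X Z) (prod_topology X Z) (\<lambda>(x, z). (f x, g z))"
    using assms(1,2) by (simp add: continuous_map_prod_top)
  then have "continuous_map (prod_topology X Z) (prod_topology X Z) (map_prod f g)"
    by (simp add: map_prod_def)
  moreover have "map_prod f g \<in> topspace (fiber_product X p Z q) \<rightarrow> {(x, z). x \<in> topspace X \<and> z \<in> topspace Z \<and> p x = q z}"
    unfolding topspace_fiber_product using assms by (auto simp: continuous_map_def)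
  ultimately show ?thesis
    unfolding fiber_product_def continuous_map_in_subtopology
    by (auto intro: continuous_map_from_subtopology)
qed

text \<open>
  The fibre product is closed in the product because the base is Hausdorff.  The inverse of
  \<open>T \<times> S\<close> preserves it because the base map is injective.
\<close>
lemma flow_fiber_product:
  assumes p: "flow_hom X T Y R p" and q: "flow_hom Z S Y R q"
  shows "flow (fiber_product X p Z q) (map_prod T S)"
proof -
  have X: "flow X T" and Z: "flow Z S" and Y: "flow Y R" using p q by (auto simp: flow_hom_def)
  let ?D = "{(x, z). x \<in> topspace X \<and> z \<in> topspace Z \<and> p x = q z}"
  have top: "topspace (fiber_product X p Z q) = ?D" by (rule topspace_fiber_product)
  have "?D \<noteq> {}"
  proof -
    obtain y where "y \<in> topspace Y" using Y unfolding flow_def by blast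
    then have "y \<in> p ` topspace X" "y \<in> q ` topspace Z" using p q by (simp_all add: flow_hom_def)
    then show ?thesis by blast
  qed
  have "closedin (prod_topology X Z) {w \<in> topspace (prod_topology X Z). (p \<circ> fst) w = (q \<circ> snd) w}"
  proof (rule closedin_continuous_maps_eq)
    show "Hausdorff_space Y" using Y by (simp add: flow_def)
    show "continuous_map (prod_topology X Z) Y (p \<circ> fst)" "continuous_map (prod_topology X Z) Y (q \<circ> snd)"
      using p q unfolding flow_hom_def
      by (auto intro: continuous_map_compose continuous_map_fst continuous_map_snd)
  qed
  moreover have "{w \<in> topspace (prod_topology X Z). (p \<circ> fst) w = (q \<circ> snd) w} = ?D" by auto
  ultimately have "closedin (prod_topology X Z) ?D" by simp
  moreover have "compact_space (prod_topology X Z)"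
    using X Z by (simp add: flow_def compact_space_prod_topology)
  ultimately have "compact_space (fiber_product X p Z q)"
    unfolding fiber_product_def by (intro compact_space_subtopology closedin_compact_space)
  moreover have "Hausdorff_space (fiber_product X p Z q)"
    using X Z unfolding fiber_product_def
    by (intro Hausdorff_space_subtopology) (simp add: flow_def Hausdorff_space_prod_topology)
  moreover have "homeomorphic_map (fiber_product X p Z q) (fiber_product X p Z q) (map_prod T S)"
  proof -
    obtain T' where T': "homeomorphic_maps X X T T'" using X by (auto simp: flow_def homeomorphic_map_maps)
    obtain S' where S': "homeomorphic_maps Z Z S S'" using Z by (auto simp: flow_def homeomorphic_map_maps)
    have inj: "inj_on R (topspace Y)" using Y homeomorphic_imp_injective_map unfolding flow_def by blast
    have pT: "p (T x) = R (p x)" "p x \<in> topspace Y" if "x \<in> topspace X" for x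
      using p that by (auto simp: flow_hom_def)
    have qS: "q (S z) = R (q z)" "q z \<in> topspace Y" if "z \<in> topspace Z" for z
      using q that by (auto simp: flow_hom_def)
    have T'_in: "T' x \<in> topspace X" "T (T' x) = x" "T' (T x) = x" if "x \<in> topspace X" for x
      using T' that by (auto simp: homeomorphic_maps_def continuous_map_def)
    have S'_in: "S' z \<in> topspace Z" "S (S' z) = z" "S' (S z) = z" if "z \<in> topspace Z" for z
      using S' that by (auto simp: homeomorphic_maps_def continuous_map_def)
    have inv: "p (T' x) = q (S' z)" if "x \<in> topspace X" "z \<in> topspace Z" "p x = q z" for x z
    proof (rule inj_onD[OF inj])
      show "R (p (T' x)) = R (q (S' z))"
        using pT(1)[of "T' x"] qS(1)[of "S' z"] T'_in[OF that(1)] S'_in[OF that(2)] that(3) by simp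
    qed (use pT qS T'_in S'_in that in auto)
    have "homeomorphic_maps (fiber_product X p Z q) (fiber_product X p Z q) (map_prod T S) (map_prod T' S')"
      unfolding homeomorphic_maps_def
    proof (intro conjI continuous_map_fiber_product)
      show "continuous_map X X T" "continuous_map X X T'" using T' by (auto simp: homeomorphic_maps_def)
      show "continuous_map Z Z S" "continuous_map Z Z S'" using S' by (auto simp: homeomorphic_maps_def)
    qed (auto simp: topspace_fiber_product pT qS inv T'_in S'_in)
    then show ?thesis by (auto simp: homeomorphic_map_maps)
  qed
  ultimately show ?thesis
    unfolding flow_def top using \<open>?D \<noteq> {}\<close> by simp
qed


section \<open>The largest equicontinuous factor of the nil-flow\<close>

lemma Hausdorff_separate_closed:
  assumes X: "compact_space X" "Hausdorff_space X" and ab: "a \<in> topspace X" "b \<in> topspace X" "a \<noteq> b"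
  obtains A A' B B' where "openin X A" "closedin X A'" "a \<in> A" "A \<subseteq> A'"
    "openin X B" "closedin X B'" "b \<in> B" "B \<subseteq> B'" "A' \<inter> B' = {}"
proof -
  obtain U V where UV: "openin X U" "openin X V" "a \<in> U" "b \<in> V" "disjnt U V"
    using X(2)[unfolded Hausdorff_space_def, THEN spec, THEN spec, of a b] ab by blast
  have "neighbourhood_base_of (closedin X) X"
    using compact_Hausdorff_imp_regular_space[OF X] by (simp add: neighbourhood_base_of_closedin)
  then have nb: "\<exists>U V. openin X U \<and> closedin X V \<and> x \<in> U \<and> U \<subseteq> V \<and> V \<subseteq> W" if "openin X W" "x \<in> W" for W x
    using that unfolding neighbourhood_base_of by blast
  from nb[OF UV(1,3)] obtain A A' where A: "openin X A" "closedin X A'" "a \<in> A" "A \<subseteq> A'" "A' \<subseteq> U"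
    by (elim exE conjE)
  from nb[OF UV(2,4)] obtain B B' where B: "openin X B" "closedin X B'" "b \<in> B" "B \<subseteq> B'" "B' \<subseteq> V"
    by (elim exE conjE)
  have "A' \<inter> B' = {}" using A(5) B(5) UV(5) unfolding disjnt_def by blast
  then show ?thesis by (rule that[OF A(1-4) B(1-4)])
qed

lemma flow_hom_funpow:
  assumes "flow_hom X T Y S p" "x \<in> topspace X"
  shows "(T ^^ n) x \<in> topspace X \<and> p ((T ^^ n) x) = (S ^^ n) (p x)"
proof (induction n)
  case (Suc n)
  have "T y \<in> topspace X" if "y \<in> topspace X" for y
    using assms(1) that by (auto simp: flow_hom_def flow_def dest: homeomorphic_imp_surjective_map)
  then show ?case using Suc assms(1) by (auto simp: flow_hom_def)
qed (use assms in auto)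

text \<open>
  Compare the orbits of the cosets of \<open>(0, 0, 0)\<close> and \<open>(0, \<epsilon>\<^sub>n, 0)\<close> at time \<open>n\<close>, where \<open>\<epsilon>\<^sub>n = c/(n\<alpha>)\<close>.
  The starting points converge to each other, so by equicontinuity the images at time \<open>n\<close> are
  arbitrarily close in \<open>E\<close>; but the two points at time \<open>n\<close> differ by \<open>(0, \<epsilon>\<^sub>n, c)\<close>.  In the limit along
  a convergent subsequence the factor map identifies two points that differ by \<open>(0, 0, c)\<close>.
\<close>
lemma equicontinuous_factor_merges_vertical_pair:
  fixes E :: "'e topology"
  assumes "\<alpha> \<noteq> 0" and E: "equicontinuous_flow E R" and q: "flow_hom nil_space (nil_translation \<alpha> \<beta> \<gamma>) E R q"
  shows "\<exists>l. q (hcoset Zlat l) = q (hcoset Zlat (hmul (0, 0, c) l))"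
proof -
  let ?h = "hcoset Zlat" and ?T = "nil_translation \<alpha> \<beta> \<gamma>"
  define \<epsilon> where "\<epsilon> n = c / (real n * \<alpha>)" for n
  have \<epsilon>0: "\<epsilon> \<longlonglongrightarrow> 0" 
  proof -
    have "(\<lambda>n. (c / \<alpha>) * (1 / real n)) \<longlonglongrightarrow> 0" by (intro tendsto_mult_right_zero lim_1_over_n)
    then show ?thesis by (simp add: \<epsilon>_def[abs_def] field_simps)
  qed
  define G where "G n = (real n * \<alpha>, real n * \<beta>, real n * \<gamma> + (real n)\<^sup>2 * \<alpha> * \<beta> / 2)" for n :: nat
  have T0: "(?T ^^ n) (?h (0, 0, 0)) = ?h (G n)" for n
    by (simp add: nil_translation_funpow G_def)
  have T1: "(?T ^^ n) (?h (0, \<epsilon> n, 0)) = ?h (hmul (0, \<epsilon> n, c) (G n))" if "n > 0" for n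
    using that \<open>\<alpha> \<noteq> 0\<close> by (simp add: nil_translation_funpow G_def \<epsilon>_def add.commute)
  have "\<forall>n. \<exists>s. s \<in> Zlat \<and> hmul (G n) s \<in> {0..1} \<times> {0..1} \<times> {0..1}"
    using lattice_representative by metis
  then obtain s where s: "\<And>n. s n \<in> Zlat" "\<And>n. hmul (G n) (s n) \<in> {0..1} \<times> {0..1} \<times> {0..1}" by metis
  have "compact ({0..1} \<times> {0..1} \<times> {0..1} :: (real \<times> real \<times> real) set)"
    by (intro compact_Times compact_Icc)
  from this[unfolded compact_def, THEN spec, of "\<lambda>n. hmul (G n) (s n)"] s(2)
  obtain l r where lr: "strict_mono (r :: nat \<Rightarrow> nat)" "((\<lambda>n. hmul (G n) (s n)) \<circ> r) \<longlonglongrightarrow> l"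
    by blast
  define k where "k n = hmul (G (r n)) (s (r n))" for n
  have k: "k \<longlonglongrightarrow> l" using lr(2) by (simp add: k_def[abs_def] o_def)
  have hk: "?h (hmul g (G (r n))) = ?h (hmul g (k n))" for g n
    using hcoset_hmul[OF hsubgroup_Zlat s(1), of "hmul g (G (r n))" "r n"] by (simp add: k_def hmul_assoc)
  have r_lim: "filterlim r sequentially sequentially" using lr(1) by (rule filterlim_subseq)
  have "flow E R" using E by (simp add: equicontinuous_flow_def)
  then have cE: "compact_space E" "Hausdorff_space E" by (auto simp: flow_def)
  have qh: "continuous_map euclidean E (\<lambda>g. q (?h g))"
    using continuous_map_compose[OF continuous_map_hcoset, of Zlat E q] q
    unfolding flow_hom_def nil_space_eq by (simp add: o_def)
  then have open_pre: "open {g. q (?h g) \<in> W}" if "openin E W" for W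
    using openin_continuous_map_preimage[OF qh that] by simp
  have qtop: "q (?h g) \<in> topspace E" for g using qh by (auto simp: continuous_map_def)
  define b where "b = hmul (0, 0, c) l"
  have "q (?h l) = q (?h b)"
  proof (rule ccontr)
    assume "q (?h l) \<noteq> q (?h b)"
    then obtain A A' B B' where AB: "openin E A" "closedin E A'" "q (?h l) \<in> A" "A \<subseteq> A'"
      "openin E B" "closedin E B'" "q (?h b) \<in> B" "B \<subseteq> B'" "A' \<inter> B' = {}"
      by (rule Hausdorff_separate_closed[OF cE qtop qtop])
    define U where "U = topspace (prod_topology E E) - A' \<times> B'"
    have "openin (prod_topology E E) U"
      unfolding U_def using AB by (intro openin_diff) (auto simp: closedin_prod_Times_iff openin_prod_Times_iff)
    moreover have "\<forall>x\<in>topspace E. (x, x) \<in> U" using AB(9) by (auto simp: U_def)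
    ultimately have "\<exists>V. openin (prod_topology E E) V \<and> (\<forall>x\<in>topspace E. (x, x) \<in> V) \<and>
        (\<forall>(x, y)\<in>V. \<forall>n. (flow_power E R n x, flow_power E R n y) \<in> U)"
      using E[unfolded equicontinuous_flow_def, THEN conjunct2, THEN spec, of U] by blast
    then obtain V where V: "openin (prod_topology E E) V" "\<forall>x\<in>topspace E. (x, x) \<in> V"
      and V': "\<forall>(x, y)\<in>V. \<forall>n. (flow_power E R n x, flow_power E R n y) \<in> U"
      by (elim exE conjE)
    have V3: "(flow_power E R n x, flow_power E R n y) \<in> U" if "(x, y) \<in> V" for x y n
      using bspec[OF V' that] by simp
    obtain V1 where V1: "openin E V1" "q (?h (0, 0, 0)) \<in> V1" "V1 \<times> V1 \<subseteq> V"
    proof -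
      have "(q (?h (0, 0, 0)), q (?h (0, 0, 0))) \<in> V" using V(2) qtop by blast
      from V(1)[unfolded openin_prod_topology_alt, THEN spec, THEN spec, THEN mp, OF this]
      obtain V1 V2 where "openin E V1" "openin E V2" "q (?h (0, 0, 0)) \<in> V1" "q (?h (0, 0, 0)) \<in> V2" "V1 \<times> V2 \<subseteq> V"
        by (elim exE conjE)
      then show ?thesis by (intro that[of "V1 \<inter> V2"]) auto
    qed
    have lim0: "(\<lambda>n. (0, \<epsilon> n, 0)) \<longlonglongrightarrow> (0, 0, 0 :: real)" by (intro tendsto_intros \<epsilon>0)
    have "\<forall>\<^sub>F n in sequentially. (0, \<epsilon> n, 0) \<in> {g. q (?h g) \<in> V1}"
      by (rule topological_tendstoD[OF lim0 open_pre[OF V1(1)]]) (simp add: V1(2))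
    then have "\<forall>\<^sub>F n in sequentially. (0, \<epsilon> (r n), 0) \<in> {g. q (?h g) \<in> V1}"
      using r_lim by (rule eventually_compose_filterlim)
    moreover have "\<forall>\<^sub>F n in sequentially. k n \<in> {g. q (?h g) \<in> A}"
      using k open_pre[OF AB(1)] AB(3) by (intro topological_tendstoD) auto
    moreover have "(\<lambda>n. hmul (0, \<epsilon> (r n), c) (k n)) \<longlonglongrightarrow> hmul (0, 0, c) l"
      unfolding hmul_def
      by (intro tendsto_intros k filterlim_compose[OF \<epsilon>0 r_lim])
    then have "\<forall>\<^sub>F n in sequentially. hmul (0, \<epsilon> (r n), c) (k n) \<in> {g. q (?h g) \<in> B}"
      using open_pre[OF AB(5)] AB(7) by (intro topological_tendstoD) (auto simp: b_def)
    moreover have "\<forall>\<^sub>F n in sequentially. r n > 0"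
      by (rule eventually_compose_filterlim[OF eventually_gt_at_top r_lim])
    ultimately have "\<forall>\<^sub>F n in sequentially. False"
    proof eventually_elim
      case (elim n)
      have "(q (?h (0, 0, 0)), q (?h (0, \<epsilon> (r n), 0))) \<in> V" using elim(1) V1 by blast
      from V3[OF this, of "int (r n)"]
      have "((R ^^ r n) (q (?h (0, 0, 0))), (R ^^ r n) (q (?h (0, \<epsilon> (r n), 0)))) \<in> U"
        by (simp only: flow_power_of_nat)
      moreover have "(R ^^ r n) (q (?h g)) = q ((?T ^^ r n) (?h g))" for g
        using flow_hom_funpow[OF q, of "?h g" "r n"] by (simp add: nil_space_eq)
      ultimately have "(q (?h (G (r n))), q (?h (hmul (0, \<epsilon> (r n), c) (G (r n))))) \<in> U"
        by (simp only: T0 T1[OF elim(4)])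
      then have "(q (?h (k n)), q (?h (hmul (0, \<epsilon> (r n), c) (k n)))) \<in> U"
        using hk[of 0] hk by simp
      then show False using elim(2,3) AB(4,8) by (auto simp: U_def)
    qed
    then show False by simp
  qed
  then show ?thesis unfolding b_def by blast
qed

text \<open>
  The points that the factor map does not separate from their translate by \<open>(0, 0, c)\<close> form a closed
  invariant set, nonempty by the previous lemma and hence everything.  So the factor map is constant
  on the fibres over the torus.
\<close>
theorem largest_equicontinuous_factor_nil:
  assumes "\<alpha> \<noteq> 0"
    and hit: "\<And>C U. C \<in> topspace nil_space \<Longrightarrow> openin nil_space U \<Longrightarrow> U \<noteq> {} \<Longrightarrow>
      \<exists>n::nat. (nil_translation \<alpha> \<beta> \<gamma> ^^ n) C \<in> U"
  shows "largest_equicontinuous_factor nil_space (nil_translation \<alpha> \<beta> \<gamma>)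
     torus_space (nil_translation \<alpha> \<beta> \<gamma>) nil_proj"
  unfolding largest_equicontinuous_factor_def
proof (intro conjI flow_hom_nil_proj equicontinuous_torus allI impI)
  let ?h = "hcoset Zlat" and ?T = "nil_translation \<alpha> \<beta> \<gamma>"
  fix E :: "(real^3^3) set set topology" and R q
  assume "equicontinuous_flow E R \<and> flow_hom nil_space ?T E R q"
  then have E: "equicontinuous_flow E R" and q: "flow_hom nil_space ?T E R q" by auto
  have fE: "flow E R" using E by (simp add: equicontinuous_flow_def)
  have vertical: "q (?h g) = q (?h (hmul (0, 0, c) g))" for g c
  proof -
    \<comment> \<open>Translation by a central element is itself a nil-translation.\<close>
    have tau0: "htau 0 0 c = (0, 0, c)" by (simp add: htau_def)
    define P where "P = {C \<in> topspace nil_space. q C = (q \<circ> nil_translation 0 0 c) C}"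
    have closed: "closedin nil_space P"
      unfolding P_def
    proof (rule closedin_continuous_maps_eq)
      show "Hausdorff_space E" using fE by (simp add: flow_def)
      show "continuous_map nil_space E q" using q by (simp add: flow_hom_def)
      then show "continuous_map nil_space E (q \<circ> nil_translation 0 0 c)"
        unfolding nil_space_eq by (rule continuous_map_compose[OF continuous_map_nil_translation])
    qed
    obtain l where l: "q (?h l) = q (?h (hmul (0, 0, c) l))"
      using equicontinuous_factor_merges_vertical_pair[OF \<open>\<alpha> \<noteq> 0\<close> E q] by blast
    have comm: "(?T ^^ n) (?h (hmul (0, 0, c) g)) = nil_translation 0 0 c ((?T ^^ n) (?h g))" for n g
    proof -
      obtain x y z where "g = (x, y, z)" by (cases g)
      then show ?thesis by (simp add: nil_translation_funpow nil_translation_hcoset tau0 algebra_simps)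
    qed
    have orbit: "(?T ^^ n) (?h l) \<in> P" for n
    proof -
      have "q ((?T ^^ n) (?h l)) = (R ^^ n) (q (?h l))"
        using flow_hom_funpow[OF q, of "?h l" n] by (simp add: nil_space_eq)
      also have "\<dots> = q ((?T ^^ n) (?h (hmul (0, 0, c) l)))"
        unfolding l using flow_hom_funpow[OF q, of "?h (hmul (0, 0, c) l)" n] by (simp add: nil_space_eq)
      finally have "q ((?T ^^ n) (?h l)) = q (nil_translation 0 0 c ((?T ^^ n) (?h l)))" unfolding comm .
      moreover have "(?T ^^ n) (?h l) \<in> topspace nil_space"
        using flow_hom_funpow[OF q, of "?h l" n] by (simp add: nil_space_eq)
      ultimately show ?thesis by (simp add: P_def)
    qed
    have "topspace nil_space - P = {}"
    proof (rule ccontr)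
      assume "topspace nil_space - P \<noteq> {}"
      moreover have "openin nil_space (topspace nil_space - P)" using closed by blast
      moreover have "?h l \<in> topspace nil_space" by (simp add: nil_space_eq)
      ultimately obtain n where "(?T ^^ n) (?h l) \<in> topspace nil_space - P" using hit by blast
      then show False using orbit by blast
    qed
    then have "?h g \<in> P" by (auto simp: nil_space_eq)
    then show ?thesis by (simp add: P_def nil_translation_hcoset tau0)
  qed
  have fibre: "q (?h g) = q (?h g')" if "hcoset Zcen g = hcoset Zcen g'" for g g'
  proof -
    obtain x y z x' y' z' where g: "g = (x, y, z)" "g' = (x', y', z')" by (cases g, cases g') auto
    have "(x' - x, y' - y, 0) \<in> Zlat" using that unfolding g hcoset_Zcen_eq_iff by simp
    from hcoset_hmul[OF hsubgroup_Zlat this, of g]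
    have "?h g = ?h (x', y', z + x * (y' - y))" by (simp add: g)
    also have "q \<dots> = q (?h (hmul (0, 0, z' - (z + x * (y' - y))) (x', y', z + x * (y' - y))))" by (rule vertical)
    also have "\<dots> = q (?h g')" by (simp add: g)
    finally show ?thesis .
  qed
  define r where "r D = q (?h (SOME g. hcoset Zcen g = D))" for D
  have r: "r (hcoset Zcen g) = q (?h g)" for g
    unfolding r_def by (rule fibre, rule someI[of "\<lambda>g'. hcoset Zcen g' = hcoset Zcen g" g]) simp
  have "flow_hom torus_space ?T E R r"
    unfolding flow_hom_def
  proof (intro conjI flow_torus fE)
    have "continuous_map euclidean E (q \<circ> ?h)"
      using q unfolding flow_hom_def nil_space_eq by (blast intro: continuous_map_compose[OF continuous_map_hcoset])
    then show "continuous_map torus_space E r"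
      unfolding torus_space_eq by (intro continuous_map_from_coset_space) (simp add: r o_def)
    have "q ` topspace nil_space = topspace E" using q by (simp add: flow_hom_def)
    then show "r ` topspace torus_space = topspace E"
      by (simp add: torus_space_eq nil_space_eq image_image r)
    have "q (?T (?h g)) = R (q (?h g))" for g
      using q unfolding flow_hom_def nil_space_eq topspace_coset_space by blast
    then show "\<forall>x\<in>topspace torus_space. r (?T x) = R (r x)"
      by (auto simp: torus_space_eq nil_translation_hcoset r)
  qed
  moreover have "\<forall>x\<in>topspace nil_space. q x = r (nil_proj x)"
    by (auto simp: nil_space_eq nil_proj_hcoset r)
  ultimately show "\<exists>r. flow_hom torus_space ?T E R r \<and> (\<forall>x\<in>topspace nil_space. q x = r (nil_proj x))" by blast
qed


section \<open>The map from the Gelfand space to the torus\<close>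

text \<open>
  On the compact set \<open>\<delta> \<le> \<bar>t\<bar> \<le> 1/2\<close> the distance of \<open>e(t)\<close> from \<open>1\<close> has a positive minimum.
\<close>
lemma ee_near_1_imp_near_int:
  assumes "\<delta> > 0"
  obtains \<epsilon> where "\<epsilon> > 0" "\<And>t. cmod (ee t - 1) < \<epsilon> \<Longrightarrow> \<bar>t - of_int (round t)\<bar> < \<delta>"
proof (cases "{t::real. \<delta> \<le> \<bar>t\<bar> \<and> \<bar>t\<bar> \<le> 1/2} = {}")
  case True
  have "\<bar>t - of_int (round t)\<bar> < \<delta>" for t :: real
    using True of_int_round_abs_le[of t] by (force simp: abs_minus_commute)
  then show ?thesis using that[of 1] by simp
next
  case False
  let ?S = "{t::real. \<delta> \<le> \<bar>t\<bar> \<and> \<bar>t\<bar> \<le> 1/2}"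
  have "?S = {-1/2..1/2} \<inter> {t. \<delta> \<le> \<bar>t\<bar>}" by auto
  moreover have "closed {t::real. \<delta> \<le> \<bar>t\<bar>}" by (intro closed_Collect_le continuous_intros)
  ultimately have "compact ?S" by (simp add: compact_Int_closed)
  moreover have "continuous_on ?S (\<lambda>t. cmod (ee t - 1))" by (intro continuous_intros)
  ultimately obtain t0 where t0: "t0 \<in> ?S" "\<And>t. t \<in> ?S \<Longrightarrow> cmod (ee t0 - 1) \<le> cmod (ee t - 1)"
    using continuous_attains_inf[of ?S] False by blast
  have "t0 \<notin> \<int>"
  proof
    assume "t0 \<in> \<int>"
    then obtain k :: int where "t0 = of_int k" by (elim Ints_cases)
    then show False using t0(1) assms by (cases "k = 0") (auto simp: abs_if split: if_splits)
  qed
  show ?thesis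
  proof (rule that)
    show "cmod (ee t0 - 1) > 0" using \<open>t0 \<notin> \<int>\<close> by (simp add: ee_eq_1_iff)
    fix t assume t: "cmod (ee t - 1) < cmod (ee t0 - 1)"
    show "\<bar>t - of_int (round t)\<bar> < \<delta>"
    proof (rule ccontr)
      assume "\<not> \<bar>t - of_int (round t)\<bar> < \<delta>"
      then have "t - of_int (round t) \<in> ?S" using of_int_round_abs_le[of t] by (simp add: abs_minus_commute)
      from t0(2)[OF this] have "cmod (ee t0 - 1) \<le> cmod (ee (t - of_int (round t)) - 1)" .
      moreover have "ee (t - of_int (round t)) = ee t" by (simp add: ee_eq_iff)
      ultimately show False using t by simp
    qed
  qed
qed

lemma weyl_function_1: "weyl_function 1 \<theta> n = ee (of_int n * \<theta>)"
  by (simp add: weyl_function_def ee_def)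

lemma char_weyl_function:
  assumes "\<xi> \<in> characters weyl_algebra"
  obtains x where "\<xi> (weyl_function 1 \<theta>) = ee x"
proof (rule unit_eq_ee)
  have b: "cmod (\<xi> (weyl_function 1 \<theta>)) \<le> 1" for \<theta>
    by (rule W.char_bound[OF assms weyl_function_in_weyl]) (simp only: weyl_function_1 cmod_ee order_refl)
  have "(\<lambda>n. weyl_function 1 \<theta> n * weyl_function 1 (- \<theta>) n) = (\<lambda>n. 1)"
    by (simp only: weyl_function_1 ee_add[symmetric]) simp
  then have "\<xi> (weyl_function 1 \<theta>) * \<xi> (weyl_function 1 (- \<theta>)) = 1"
    using W.char_mult[OF assms weyl_function_in_weyl weyl_function_in_weyl, of 1 \<theta> 1 "- \<theta>"] W.char_const[OF assms, of 1]
    by simp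
  then have "cmod (\<xi> (weyl_function 1 \<theta>)) * cmod (\<xi> (weyl_function 1 (- \<theta>))) = 1" by (metis norm_mult norm_one)
  moreover have "cmod (\<xi> (weyl_function 1 \<theta>)) * cmod (\<xi> (weyl_function 1 (- \<theta>))) \<le> cmod (\<xi> (weyl_function 1 \<theta>))"
    using b by (intro mult_left_le) auto
  ultimately show "cmod (\<xi> (weyl_function 1 \<theta>)) = 1" using b[of \<theta>] by linarith
qed

lemma char_weyl_function_translate:
  assumes "\<xi> \<in> characters weyl_algebra"
  shows "\<xi> (\<lambda>n. weyl_function 1 \<theta> (n + m)) = ee (of_int m * \<theta>) * \<xi> (weyl_function 1 \<theta>)"
proof -
  have "(\<lambda>n. weyl_function 1 \<theta> (n + m)) = (\<lambda>n. ee (of_int m * \<theta>) * weyl_function 1 \<theta> n)"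
    unfolding weyl_function_1 of_int_add distrib_right ee_add by (simp add: mult.commute)
  then show ?thesis using W.char_cmult[OF assms weyl_function_in_weyl] by simp
qed

lemma weyl_proj_hcoset:
  assumes "\<xi> (weyl_function 1 \<alpha>) = ee a" "\<xi> (weyl_function 1 \<beta>) = ee b"
  shows "weyl_proj \<alpha> \<beta> \<xi> = hcoset Zcen (a, b, c)"
proof -
  have "weyl_proj \<alpha> \<beta> \<xi> = heis a b c <#\<^bsub>heis_group\<^esub> center_lattice"
    using assms unfolding ee_def by (rule weyl_proj_eq_coset)
  also have "heis a b c = hmat (a, b, c)" by (simp add: hmat_def)
  finally show ?thesis unfolding center_lattice_eq l_coset_hmat .
qed

lemma open_triple_box:
  fixes S :: "(real \<times> real \<times> real) set"
  assumes "open S" "(x, y, z) \<in> S"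
  obtains \<delta> where "\<delta> > 0" "\<And>a b c. \<bar>a - x\<bar> < \<delta> \<Longrightarrow> \<bar>b - y\<bar> < \<delta> \<Longrightarrow> \<bar>c - z\<bar> < \<delta> \<Longrightarrow> (a, b, c) \<in> S"
proof -
  obtain e where e: "e > 0" "\<And>p. dist p (x, y, z) < e \<Longrightarrow> p \<in> S"
    using assms unfolding open_dist by blast
  show ?thesis
  proof (rule that[of "e/3"])
    fix a b c assume "\<bar>a - x\<bar> < e/3" "\<bar>b - y\<bar> < e/3" "\<bar>c - z\<bar> < e/3"
    moreover have "dist (a, b, c) (x, y, z) \<le> \<bar>a - x\<bar> + (\<bar>b - y\<bar> + \<bar>c - z\<bar>)"
      unfolding dist_Pair_Pair
      using sqrt_sum_squares_le_sum_abs[of "a - x" "sqrt ((dist b y)\<^sup>2 + (dist c z)\<^sup>2)"]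
        sqrt_sum_squares_le_sum_abs[of "b - y" "c - z"] by (simp add: dist_real_def)
    ultimately show "(a, b, c) \<in> S" by (intro e(2)) linarith
  qed (use e in auto)
qed

lemma continuous_map_weyl_proj: "continuous_map (gelfand_space weyl_algebra) torus_space (weyl_proj \<alpha> \<beta>)"
  unfolding continuous_map_def
proof (intro conjI allI impI)
  let ?X = "gelfand_space weyl_algebra"
  show "weyl_proj \<alpha> \<beta> \<in> topspace ?X \<rightarrow> topspace torus_space"
  proof
    fix \<xi> assume "\<xi> \<in> topspace ?X"
    then have \<xi>: "\<xi> \<in> characters weyl_algebra" by (simp add: W.topspace_gelfand)
    obtain a where a: "\<xi> (weyl_function 1 \<alpha>) = ee a" by (rule char_weyl_function[OF \<xi>])
    obtain b where b: "\<xi> (weyl_function 1 \<beta>) = ee b" by (rule char_weyl_function[OF \<xi>])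
    show "weyl_proj \<alpha> \<beta> \<xi> \<in> topspace torus_space"
      using weyl_proj_hcoset[OF a b, of 0] by (simp add: torus_space_eq)
  qed
  fix U assume U: "openin torus_space U"
  show "openin ?X {\<xi> \<in> topspace ?X. weyl_proj \<alpha> \<beta> \<xi> \<in> U}"
    unfolding openin_subopen[of _ "{\<xi> \<in> topspace ?X. weyl_proj \<alpha> \<beta> \<xi> \<in> U}"]
  proof
    fix \<xi> assume "\<xi> \<in> {\<xi> \<in> topspace ?X. weyl_proj \<alpha> \<beta> \<xi> \<in> U}"
    then have \<xi>: "\<xi> \<in> characters weyl_algebra" "weyl_proj \<alpha> \<beta> \<xi> \<in> U" by (auto simp: W.topspace_gelfand)
    obtain a where a: "\<xi> (weyl_function 1 \<alpha>) = ee a" by (rule char_weyl_function[OF \<xi>(1)])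
    obtain b where b: "\<xi> (weyl_function 1 \<beta>) = ee b" by (rule char_weyl_function[OF \<xi>(1)])
    have "open (hcoset Zcen -` U)" using U unfolding torus_space_eq openin_coset_space by blast
    moreover have "(a, b, 0) \<in> hcoset Zcen -` U" using weyl_proj_hcoset[OF a b, of 0] \<xi>(2) by simp
    ultimately obtain \<delta> where \<delta>: "\<delta> > 0"
      "\<And>x y z. \<bar>x - a\<bar> < \<delta> \<Longrightarrow> \<bar>y - b\<bar> < \<delta> \<Longrightarrow> \<bar>z - 0\<bar> < \<delta> \<Longrightarrow> (x, y, z) \<in> hcoset Zcen -` U"
      by (rule open_triple_box) blast
    obtain \<epsilon> where \<epsilon>: "\<epsilon> > 0" "\<And>t. cmod (ee t - 1) < \<epsilon> \<Longrightarrow> \<bar>t - of_int (round t)\<bar> < \<delta>"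
      by (rule ee_near_1_imp_near_int[OF \<delta>(1)]) blast
    define V where "V \<theta> t = {\<eta> \<in> topspace ?X. \<eta> (weyl_function 1 \<theta>) \<in> ball (ee t) \<epsilon>}" for \<theta> t
    have V: "openin ?X (V \<theta> t)" for \<theta> t
      unfolding V_def
      by (rule openin_continuous_map_preimage[OF W.continuous_map_gelfand_eval[OF weyl_function_in_weyl]]) simp
    have "V \<alpha> a \<inter> V \<beta> b \<subseteq> {\<xi> \<in> topspace ?X. weyl_proj \<alpha> \<beta> \<xi> \<in> U}"
    proof
      fix \<eta> assume \<eta>: "\<eta> \<in> V \<alpha> a \<inter> V \<beta> b"
      then have ch: "\<eta> \<in> characters weyl_algebra" by (simp add: V_def W.topspace_gelfand)
      obtain x where x: "\<eta> (weyl_function 1 \<alpha>) = ee x" by (rule char_weyl_function[OF ch])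
      obtain y where y: "\<eta> (weyl_function 1 \<beta>) = ee y" by (rule char_weyl_function[OF ch])
      have "cmod (ee (x - a) - 1) < \<epsilon>" "cmod (ee (y - b) - 1) < \<epsilon>"
        using \<eta> unfolding V_def cmod_ee_diff[symmetric] Int_iff mem_Collect_eq x y
        by (simp_all add: dist_norm norm_minus_commute)
      note near = this[THEN \<epsilon>(2)]
      have "(x - of_int (round (x - a)), y - of_int (round (y - b)), 0) \<in> hcoset Zcen -` U"
        using near by (intro \<delta>(2)) (auto simp: \<delta>(1) algebra_simps)
      moreover have "weyl_proj \<alpha> \<beta> \<eta> = hcoset Zcen (x - of_int (round (x - a)), y - of_int (round (y - b)), 0)"
        by (rule weyl_proj_hcoset; unfold x y ee_eq_iff; simp)
      ultimately show "\<eta> \<in> {\<xi> \<in> topspace ?X. weyl_proj \<alpha> \<beta> \<xi> \<in> U}"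
        using ch by (simp add: W.topspace_gelfand)
    qed
    moreover have "\<xi> \<in> V \<alpha> a \<inter> V \<beta> b" 
      using \<epsilon>(1) \<xi>(1) unfolding V_def W.topspace_gelfand Int_iff mem_Collect_eq a b by simp
    ultimately show "\<exists>T. openin ?X T \<and> \<xi> \<in> T \<and> T \<subseteq> {\<xi> \<in> topspace ?X. weyl_proj \<alpha> \<beta> \<xi> \<in> U}"
      by (intro exI[of _ "V \<alpha> a \<inter> V \<beta> b"] conjI openin_Int V)
  qed
qed

lemma Kronecker_pair:
  assumes ind: "rationally_independent \<alpha> \<beta>" and "\<epsilon> > 0"
  obtains k m n :: int where "\<bar>of_int k * \<alpha> - of_int m - x\<bar> < \<epsilon>" "\<bar>of_int k * \<beta> - of_int n - y\<bar> < \<epsilon>"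
proof -
  let ?s = "\<lambda>r x. of_int r * x :: real"
  define \<theta> :: "nat \<Rightarrow> real" where "\<theta> i = (if i = 0 then \<alpha> else if i = 1 then \<beta> else 1)" for i
  interpret M: Modules.module ?s by unfold_locales (auto simp: algebra_simps)
  note dist = rationally_independent_distinct[OF ind]
  have img: "\<theta> ` {..2} = {1, \<alpha>, \<beta>}"
    by (auto simp: \<theta>_def numeral_2_eq_2 atMost_Suc)
  have indep: "M.independent (\<theta> ` {..2})"
    unfolding M.independent_explicit_module img
  proof (intro allI impI)
    fix t u v assume t: "finite t" "t \<subseteq> {1, \<alpha>, \<beta>}" "(\<Sum>v\<in>t. ?s (u v) v) = 0" "v \<in> t"
    define u' where "u' x = (if x \<in> t then u x else 0)" for x
    have "(\<Sum>v\<in>{1, \<alpha>, \<beta>}. ?s (u' v) v) = (\<Sum>v\<in>t. ?s (u v) v)"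
      using t(2) by (intro sum.mono_neutral_cong_right) (auto simp: u'_def)
    then have eq: "of_int (u' 1) + of_int (u' \<alpha>) * \<alpha> + of_int (u' \<beta>) * \<beta> = 0"
      using t(3) dist by (simp add: add.assoc)
    have "u' 1 = 0 \<and> u' \<alpha> = 0 \<and> u' \<beta> = 0"
      using rationally_independentD[OF ind _ _ _ eq] by simp
    then have "u' v = 0" using t by auto
    then show "u v = 0" using t by (simp add: u'_def)
  qed
  have inj: "inj_on \<theta> {..2}" using dist by (auto simp: inj_on_def \<theta>_def)
  obtain k m where "\<And>i. i < 2 \<Longrightarrow> \<bar>of_int k * \<theta> i - of_int (m i) - (if i = 0 then x else y)\<bar> < \<epsilon>"
    by (rule Kronecker_thm_2[OF indep inj _ \<open>\<epsilon> > 0\<close>, of "\<lambda>i. if i = 0 then x else y"]) (auto simp: \<theta>_def)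
  from this[of 0] this[of 1] show ?thesis by (intro that) (simp_all add: \<theta>_def)
qed

text \<open>
  The image is compact, and it contains the images of the point evaluations, that is, the
  points \<open>(k\<alpha>, k\<beta>)\<close>, which are dense.
\<close>
theorem flow_hom_weyl_proj:
  assumes ind: "rationally_independent \<alpha> \<beta>"
  shows "flow_hom (gelfand_space weyl_algebra) (gelfand_shift weyl_algebra)
    torus_space (nil_translation \<alpha> \<beta> \<gamma>) (weyl_proj \<alpha> \<beta>)"
  unfolding flow_hom_def
proof (intro conjI W.flow_gelfand flow_torus continuous_map_weyl_proj ballI)
  let ?X = "gelfand_space weyl_algebra"
  have "compactin torus_space (weyl_proj \<alpha> \<beta> ` topspace ?X)"
    using W.compact_gelfand by (intro image_compactin[OF _ continuous_map_weyl_proj]) (simp add: compact_space_def)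
  then have closed: "closedin torus_space (weyl_proj \<alpha> \<beta> ` topspace ?X)"
    using flow_torus by (intro compactin_imp_closedin) (auto simp: flow_def)
  show "weyl_proj \<alpha> \<beta> ` topspace ?X = topspace torus_space"
  proof (rule ccontr)
    assume "weyl_proj \<alpha> \<beta> ` topspace ?X \<noteq> topspace torus_space"
    then obtain D where D: "D \<in> topspace torus_space" "D \<notin> weyl_proj \<alpha> \<beta> ` topspace ?X"
      using closedin_subset[OF closed] by blast
    define U where "U = topspace torus_space - weyl_proj \<alpha> \<beta> ` topspace ?X"
    have "openin torus_space U" using closed unfolding U_def by blast
    then have "open (hcoset Zcen -` U)" unfolding torus_space_eq openin_coset_space by blast
    moreover obtain x y z where "D = hcoset Zcen (x, y, z)" using D(1) by (auto simp: torus_space_eq)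
    then have "(x, y, z) \<in> hcoset Zcen -` U" using D by (simp add: U_def)
    ultimately obtain \<delta> where \<delta>: "\<delta> > 0"
      "\<And>a b c. \<bar>a - x\<bar> < \<delta> \<Longrightarrow> \<bar>b - y\<bar> < \<delta> \<Longrightarrow> \<bar>c - z\<bar> < \<delta> \<Longrightarrow> (a, b, c) \<in> hcoset Zcen -` U"
      by (rule open_triple_box) blast
    obtain k m n :: int where k: "\<bar>of_int k * \<alpha> - of_int m - x\<bar> < \<delta>" "\<bar>of_int k * \<beta> - of_int n - y\<bar> < \<delta>"
      using Kronecker_pair[OF ind \<delta>(1)] by metis
    have "hcoset Zcen (of_int k * \<alpha> - of_int m, of_int k * \<beta> - of_int n, z) \<in> U"
      using \<delta>(2)[OF k, of z] \<delta>(1) by simp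
    moreover have "weyl_proj \<alpha> \<beta> (\<lambda>f\<in>weyl_algebra. f k) =
        hcoset Zcen (of_int k * \<alpha> - of_int m, of_int k * \<beta> - of_int n, z)"
      by (rule weyl_proj_hcoset) (simp_all add: weyl_function_in_weyl weyl_function_1[simplified] ee_eq_iff)
    moreover have "(\<lambda>f\<in>weyl_algebra. f k) \<in> topspace ?X"
      unfolding W.topspace_gelfand by (rule W.evaluation_character)
    ultimately show False unfolding U_def by (metis DiffD2 imageI)
  qed
  fix \<xi> assume "\<xi> \<in> topspace ?X"
  then have \<xi>: "\<xi> \<in> characters weyl_algebra" by (simp add: W.topspace_gelfand)
  obtain a where a: "\<xi> (weyl_function 1 \<alpha>) = ee a" by (rule char_weyl_function[OF \<xi>])
  obtain b where b: "\<xi> (weyl_function 1 \<beta>) = ee b" by (rule char_weyl_function[OF \<xi>])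
  have sh: "gelfand_shift weyl_algebra \<xi> (weyl_function 1 \<theta>) = ee (of_int 1 * \<theta>) * \<xi> (weyl_function 1 \<theta>)" for \<theta>
    unfolding gelfand_shift_def using weyl_function_in_weyl[of 1 \<theta>] char_weyl_function_translate[OF \<xi>, of \<theta> 1] by simp
  have "weyl_proj \<alpha> \<beta> (gelfand_shift weyl_algebra \<xi>) = hcoset Zcen (\<alpha> + a, \<beta> + b, \<gamma> + \<alpha> * \<beta> / 2 + 0 + \<alpha> * b)"
    by (rule weyl_proj_hcoset) (simp_all only: sh a b ee_add of_int_1 mult_1)
  also have "\<dots> = nil_translation \<alpha> \<beta> \<gamma> (weyl_proj \<alpha> \<beta> \<xi>)"
    unfolding weyl_proj_hcoset[OF a b, of 0] nil_translation_hcoset htau_def hmul_Pair ..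
  finally show "weyl_proj \<alpha> \<beta> (gelfand_shift weyl_algebra \<xi>) = nil_translation \<alpha> \<beta> \<gamma> (weyl_proj \<alpha> \<beta> \<xi>)" .
qed


section \<open>Orbits in the fibre product\<close>

lemma sin_sq_add_half: "sin_sq (t + 1/2) = 1 - (cmod (ee t - 1))\<^sup>2 / 4"
proof -
  have "sin (pi * (t + 1/2)) = cos (pi * t)" by (simp add: distrib_left sin_add)
  then show ?thesis unfolding sin_sq_def cos_sq_eq[symmetric] by simp
qed

text \<open>
  With \<open>r(k) = \<Sum>f\<in>F. \<bar>f(k) - \<xi> f\<bar>\<^sup>2\<close> the function \<open>max 0 (\<epsilon>\<^sup>2 - r)\<close> is a bump around \<open>\<xi>\<close>; it is somewhere
  positive because point evaluations approximate \<open>\<xi>\<close>.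
\<close>
lemma weyl_bump:
  assumes \<xi>: "\<xi> \<in> characters weyl_algebra" and F: "finite F" "F \<subseteq> weyl_algebra" and "\<epsilon> > 0"
  obtains w :: "int \<Rightarrow> real" where "(\<lambda>k. complex_of_real (w k)) \<in> weyl_algebra" "\<And>k. w k \<ge> 0"
    "\<exists>k. w k > 0" "\<And>k f. w k > 0 \<Longrightarrow> f \<in> F \<Longrightarrow> cmod (f k - \<xi> f) < \<epsilon>"
proof -
  define r where "r k = (\<Sum>f\<in>F. (cmod (f k - \<xi> f))\<^sup>2)" for k
  note rW = W.sum_sq_dist(2)[OF F(2), of \<xi>, folded r_def]
  obtain M where M: "\<And>n. \<bar>r n\<bar> \<le> M" using W.bounded[OF rW] by (metis norm_of_real)
  define w where "w k = max 0 (\<epsilon>\<^sup>2 - r k)" for k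
  have "continuous_on {-M..M} (\<lambda>t. max 0 (\<epsilon>\<^sup>2 - t))" by (intro continuous_intros)
  from W.continuous_calculus[OF rW compact_Icc _ this]
  have "(\<lambda>k. complex_of_real (w k)) \<in> weyl_algebra" using M by (simp add: w_def abs_le_iff minus_le_iff)
  moreover have "\<exists>k. w k > 0"
  proof -
    define \<eta> where "\<eta> = \<epsilon> / (real (card F) + 1)"
    have "\<eta> > 0" using \<open>\<epsilon> > 0\<close> by (simp add: \<eta>_def add_nonneg_pos)
    then obtain k where k: "\<And>f. f \<in> F \<Longrightarrow> cmod (f k - \<xi> f) < \<eta>" using W.char_approx[OF \<xi> F] by metis
    have "r k \<le> (\<Sum>f\<in>F. \<eta>\<^sup>2)" unfolding r_def using k by (intro sum_mono power_mono) (auto intro: less_imp_le)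
    also have "\<dots> < (real (card F) + 1) * \<eta>\<^sup>2" using \<open>\<eta> > 0\<close> by simp
    also have "\<dots> \<le> (real (card F) + 1)\<^sup>2 * \<eta>\<^sup>2" by (intro mult_right_mono) (auto simp: power2_eq_square)
    also have "\<dots> = \<epsilon>\<^sup>2" by (simp add: \<eta>_def power_divide add_nonneg_eq_0_iff)
    finally show ?thesis by (intro exI[of _ k]) (simp add: w_def)
  qed
  moreover have "cmod (f k - \<xi> f) < \<epsilon>" if "w k > 0" "f \<in> F" for k f
  proof -
    have "(cmod (f k - \<xi> f))\<^sup>2 \<le> r k" unfolding r_def using F(1) that(2) by (intro member_le_sum) auto
    also have "\<dots> < \<epsilon>\<^sup>2" using that(1) by (simp add: w_def split: if_splits)
    finally show ?thesis using \<open>\<epsilon> > 0\<close> by (simp add: power2_less_imp_less)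
  qed
  ultimately show ?thesis by (intro that[of w]) (auto simp: w_def)
qed

text \<open>
  The quantities \<open>v\<close> are the weights, \<open>b\<close> is the bump that hides the jump of the fibre coordinate, and
  \<open>q\<close> is a trigonometric polynomial in \<open>\<zeta>\<close> with positive mean \<open>\<kappa>0\<close> that is at most \<open>0\<close> away from \<open>z'\<close>.
  If no time of positive weight has \<open>\<zeta>\<close> near \<open>z'\<close>, then \<open>\<Sum> v b q \<le> 0\<close>.  But the oscillating part
  \<open>e\<close> of \<open>q\<close> averages to \<open>0\<close>, and the constant part contributes at least \<open>\<kappa>0/2\<close> times the mean of the weights.
  The jump is placed at \<open>y' - 1/2\<close>, opposite to the target, so that \<open>b\<close> is at least \<open>1/2\<close> at
  the times that matter.
\<close>
lemma fiber_orbit_hit: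
  assumes ind: "rationally_independent \<alpha> \<beta>"
    and \<xi>: "\<xi> \<in> characters weyl_algebra" "\<xi> (weyl_function 1 \<beta>) = ee y"
    and \<xi>': "\<xi>' \<in> characters weyl_algebra" "\<xi>' (weyl_function 1 \<beta>) = ee y'"
    and F: "finite F" "F \<subseteq> weyl_algebra" and "\<epsilon> > 0"
  obtains n :: nat where "\<And>f. f \<in> F \<Longrightarrow> cmod (\<xi> (\<lambda>k. f (k + int n)) - \<xi>' f) < \<epsilon>"
    "cmod (ee (fiber_coord \<alpha> \<beta> \<gamma> x y z (y' - 1/2) n - z') - 1) < \<epsilon>"
proof (rule ccontr)
  assume no: "\<not> thesis"
  note found = that
  define \<epsilon>0 where "\<epsilon>0 = min \<epsilon> 1"
  have e0: "\<epsilon>0 > 0" "\<epsilon>0 \<le> \<epsilon>" "\<epsilon>0 \<le> 1" using \<open>\<epsilon> > 0\<close> by (auto simp: \<epsilon>0_def)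
  then have e02: "\<epsilon>0/2 > 0" by simp
  define F0 where "F0 = insert (weyl_function 1 \<beta>) F"
  have F0: "finite F0" "F0 \<subseteq> weyl_algebra" using F weyl_function_in_weyl by (auto simp: F0_def)
  define \<zeta> where "\<zeta> n = fiber_coord \<alpha> \<beta> \<gamma> x y z (y' - 1/2) n" for n
  obtain w where w: "(\<lambda>k. complex_of_real (w k)) \<in> weyl_algebra" "\<And>k. w k \<ge> 0" "\<exists>k. w k > 0"
    "\<And>k f. w k > 0 \<Longrightarrow> f \<in> F0 \<Longrightarrow> cmod (f k - \<xi>' f) < \<epsilon>0/2"
    using weyl_bump[OF \<xi>'(1) F0 e02] by metis
  have wn: "(\<lambda>k. complex_of_real (w (k + m))) \<in> weyl_algebra" for m using W.translate[OF w(1)] .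
  define v where "v n = Re (\<xi> (\<lambda>k. complex_of_real (w (k + int n))))" for n
  have v: "\<xi> (\<lambda>k. complex_of_real (w (k + int n))) = complex_of_real (v n)" "v n \<ge> 0" for n
    using W.char_nonneg[OF \<xi>(1) wn[of "int n"] w(2)] by (auto simp: v_def complex_eq_iff)
  have near: "cmod (\<xi> (\<lambda>k. f (k + int n)) - \<xi>' f) < \<epsilon>0" if "v n > 0" "f \<in> F0" for n f
  proof -
    have fin: "finite {\<lambda>k. complex_of_real (w (k + int n)), \<lambda>k. f (k + int n)}" by simp
    have sub: "{\<lambda>k. complex_of_real (w (k + int n)), \<lambda>k. f (k + int n)} \<subseteq> weyl_algebra"
      using wn W.translate F0(2) that(2) by blast
    have pos: "min (v n) (\<epsilon>0/2) > 0" using that(1) e02 by simp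
    obtain k where k: "\<And>g. g \<in> {\<lambda>k. complex_of_real (w (k + int n)), \<lambda>k. f (k + int n)} \<Longrightarrow>
        cmod (g k - \<xi> g) < min (v n) (\<epsilon>0/2)"
      using W.char_approx[OF \<xi>(1) fin sub pos] by blast
    have "cmod (complex_of_real (w (k + int n)) - complex_of_real (v n)) < v n"
      using k[of "\<lambda>k. complex_of_real (w (k + int n))"] by (simp add: v(1))
    then have "\<bar>w (k + int n) - v n\<bar> < v n" by (metis norm_of_real of_real_diff)
    then have "w (k + int n) > 0" by linarith
    from w(4)[OF this that(2)] have "cmod (f (k + int n) - \<xi>' f) < \<epsilon>0/2" .
    moreover have "cmod (f (k + int n) - \<xi> (\<lambda>k. f (k + int n))) < \<epsilon>0/2"
      using k[of "\<lambda>k. f (k + int n)"] by simp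
    ultimately show ?thesis
      using norm_triangle_ineq4[of "f (k + int n) - \<xi>' f" "f (k + int n) - \<xi> (\<lambda>k. f (k + int n))"] by simp
  qed
  have far: "cmod (ee (\<zeta> n - z') - 1) \<ge> \<epsilon>0" if "v n > 0" for n
  proof (rule ccontr)
    assume "\<not> cmod (ee (\<zeta> n - z') - 1) \<ge> \<epsilon>0"
    then have "cmod (ee (\<zeta> n - z') - 1) < \<epsilon>" using e0 by simp
    moreover have "cmod (\<xi> (\<lambda>k. f (k + int n)) - \<xi>' f) < \<epsilon>" if "f \<in> F" for f
      using near[OF \<open>v n > 0\<close>, of f] that e0(2) by (simp add: F0_def)
    ultimately show False using no found[of n] unfolding \<zeta>_def by blast
  qed
  define b where "b n = sin_sq (y + real n * \<beta> - (y' - 1/2))" for n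
  have b: "b n \<ge> 1/2" if "v n > 0" for n
  proof -
    have "cmod (ee (real n * \<beta>) * ee y - ee y') < \<epsilon>0"
      using near[OF that, of "weyl_function 1 \<beta>"]
      unfolding char_weyl_function_translate[OF \<xi>(1)] \<xi>(2) \<xi>'(2) by (simp add: F0_def)
    then have "cmod (ee (y + real n * \<beta> - y') - 1) < 1"
      using e0(3) by (simp add: cmod_ee_diff add.commute flip: ee_add)
    then have "(cmod (ee (y + real n * \<beta> - y') - 1))\<^sup>2 \<le> 1" by (simp add: power_le_one)
    moreover have "b n = 1 - (cmod (ee (y + real n * \<beta> - y') - 1))\<^sup>2 / 4"
      unfolding b_def sin_sq_add_half[symmetric] by (simp add: algebra_simps)
    ultimately show ?thesis by simp
  qed
  define \<rho> where "\<rho> = 1 - \<epsilon>0\<^sup>2 / 4"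
  have "\<epsilon>0\<^sup>2 \<le> 1" "\<epsilon>0\<^sup>2 > 0" using e0 by (auto intro: power_le_one)
  then have \<rho>: "0 < \<rho>" "\<rho> < 1" by (auto simp: \<rho>_def)
  obtain K :: nat where K: "K > 0" "\<rho> ^ K < (real ((2 * K) choose K) / 4 ^ K) ^ 1"
    using central_binomial_beats_power[OF \<rho>] by metis
  define c where "c j = real ((2 * K) choose j) / 4 ^ K" for j
  define \<kappa>0 where "\<kappa>0 = c K - \<rho> ^ K"
  have "\<kappa>0 > 0" using K(2) by (simp add: \<kappa>0_def c_def)
  define q where "q n = cos (pi * (\<zeta> n - z')) ^ (2 * K) - \<rho> ^ K" for n
  have q: "q n \<le> 0" if "v n > 0" for n
  proof -
    have "(cos (pi * (\<zeta> n - z')))\<^sup>2 \<le> \<rho>"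
      unfolding cos_sq_eq \<rho>_def using power_mono[OF far[OF that], of 2] e0(1) by simp
    then have "((cos (pi * (\<zeta> n - z')))\<^sup>2) ^ K \<le> \<rho> ^ K" by (intro power_mono) auto
    then show ?thesis by (simp add: q_def power_mult)
  qed
  define e where "e n = (\<Sum>j\<in>{..2 * K} - {K}. of_real (c j) * ee (- (real j - real K) * z') *
      ee (of_int (int j - int K) * \<zeta> n))" for n
  have q_eq: "complex_of_real (q n) = complex_of_real \<kappa>0 + e n" for n
  proof -
    have "complex_of_real (cos (pi * (\<zeta> n - z')) ^ (2 * K)) =
       of_real (c K) * ee ((real K - real K) * (\<zeta> n - z')) +
       (\<Sum>j\<in>{..2 * K} - {K}. of_real (c j) * ee ((real j - real K) * (\<zeta> n - z')))"
      unfolding cos_power_eq c_def by (rule sum.remove) auto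
    also have "(\<Sum>j\<in>{..2 * K} - {K}. of_real (c j) * ee ((real j - real K) * (\<zeta> n - z'))) = e n"
      unfolding e_def mult.assoc ee_add[symmetric] by (intro sum.cong) (auto simp: algebra_simps)
    finally show ?thesis by (simp add: q_def \<kappa>0_def)
  qed
  have null: "null_means (\<lambda>s n. complex_of_real (w (s + int n)) * (of_real (b n) * e n))"
  proof -
    have "null_means (\<lambda>s n. of_real (c j) * ee (- (real j - real K) * z') * (complex_of_real (w (s + int n)) *
       (of_real (b n) * ee (of_int (int j - int K) * \<zeta> n))))" if "j \<in> {..2 * K} - {K}" for j
      unfolding b_def \<zeta>_def
      by (rule null_means_mult[OF null_means_fiber_weyl[OF ind _ w(1)], where C="\<bar>c j\<bar>"])
        (use that in \<open>auto simp: norm_mult\<close>)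
    then have "null_means (\<lambda>s n. \<Sum>j\<in>{..2 * K} - {K}. of_real (c j) * ee (- (real j - real K) * z') *
       (complex_of_real (w (s + int n)) * (of_real (b n) * ee (of_int (int j - int K) * \<zeta> n))))"
      by (rule null_means_sum)
    then show ?thesis unfolding e_def sum_distrib_left by (simp add: mult_ac)
  qed
  obtain \<kappa> :: real where \<kappa>: "\<kappa> > 0" "\<And>N0. \<exists>N\<ge>N0. N > 0 \<and> (\<forall>s::int. \<kappa> * real N \<le> (\<Sum>n<N. w (s + int n)))"
    using weyl_algebra_positive_means[OF w(1,2)] w(3) by metis
  have "\<kappa>0 * \<kappa> / 4 > 0" using \<kappa> \<open>\<kappa>0 > 0\<close> by simp
  from null_meansD[OF null this] obtain N0 where
    N0: "\<And>N s. N \<ge> N0 \<Longrightarrow> cmod (\<Sum>n<N. complex_of_real (w (s + int n)) * (of_real (b n) * e n)) \<le> \<kappa>0 * \<kappa> / 4 * real N"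
    unfolding eventually_sequentially by blast
  obtain N where N: "N \<ge> N0" "N > 0" "\<And>s::int. \<kappa> * real N \<le> (\<Sum>n<N. w (s + int n))"
    using \<kappa>(2)[of N0] by blast
  have sum_v: "\<kappa> * real N \<le> (\<Sum>n<N. v n)"
  proof -
    have eq: "(\<lambda>k. complex_of_real ((\<Sum>n<N. w (k + int n)) - \<kappa> * real N)) =
        (\<lambda>k. (\<Sum>n<N. complex_of_real (w (k + int n))) - complex_of_real (\<kappa> * real N))" by simp
    have sW: "(\<lambda>k. \<Sum>n<N. complex_of_real (w (k + int n))) \<in> weyl_algebra" by (intro W.sum wn)
    have cs: "\<xi> (\<lambda>k. \<Sum>n<N. complex_of_real (w (k + int n))) = (\<Sum>n<N. \<xi> (\<lambda>k. complex_of_real (w (k + int n))))"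
      by (rule W.char_sum[OF \<xi>(1) wn])
    have "(\<lambda>k. complex_of_real ((\<Sum>n<N. w (k + int n)) - \<kappa> * real N)) \<in> weyl_algebra"
      unfolding eq by (intro W.diff sW W.const)
    from W.char_nonneg(2)[OF \<xi>(1) this] N(3)
    have "0 \<le> Re (\<xi> (\<lambda>k. (\<Sum>n<N. complex_of_real (w (k + int n))) - complex_of_real (\<kappa> * real N)))"
      unfolding eq by simp
    also have "\<xi> (\<lambda>k. (\<Sum>n<N. complex_of_real (w (k + int n))) - complex_of_real (\<kappa> * real N)) =
      (\<Sum>n<N. complex_of_real (v n)) - complex_of_real (\<kappa> * real N)"
      unfolding W.char_diff[OF \<xi>(1) sW W.const] W.char_const[OF \<xi>(1)] cs v(1) ..
    finally show ?thesis by simp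
  qed
  have small: "cmod (\<Sum>n<N. complex_of_real (v n) * (of_real (b n) * e n)) \<le> \<kappa>0 * \<kappa> / 4 * real N"
  proof -
    have inW: "(\<lambda>k. (of_real (b n) * e n) * complex_of_real (w (k + int n))) \<in> weyl_algebra" for n
      by (intro W.cmult wn)
    have "\<xi> (\<lambda>k. \<Sum>n<N. (of_real (b n) * e n) * complex_of_real (w (k + int n))) =
      (\<Sum>n<N. \<xi> (\<lambda>k. (of_real (b n) * e n) * complex_of_real (w (k + int n))))"
      by (rule W.char_sum[OF \<xi>(1) inW])
    also have "\<dots> = (\<Sum>n<N. complex_of_real (v n) * (of_real (b n) * e n))"
      by (intro sum.cong refl) (simp add: W.char_cmult[OF \<xi>(1) wn] v(1))
    finally have eq: "\<xi> (\<lambda>k. \<Sum>n<N. (of_real (b n) * e n) * complex_of_real (w (k + int n))) =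
       (\<Sum>n<N. complex_of_real (v n) * (of_real (b n) * e n))" .
    have "cmod (\<xi> (\<lambda>k. \<Sum>n<N. (of_real (b n) * e n) * complex_of_real (w (k + int n)))) \<le> \<kappa>0 * \<kappa> / 4 * real N"
      by (rule W.char_bound[OF \<xi>(1) W.sum[OF inW]]) (use N0[OF N(1)] in \<open>simp add: mult.commute\<close>)
    then show ?thesis unfolding eq .
  qed
  have "0 \<ge> (\<Sum>n<N. v n * b n * q n)"
  proof (rule sum_nonpos)
    fix n
    show "v n * b n * q n \<le> 0"
      using q[of n] b[of n] v(2)[of n] by (cases "v n = 0") (auto intro!: mult_nonneg_nonpos mult_nonneg_nonneg)
  qed
  also have "(\<Sum>n<N. v n * b n * q n) = \<kappa>0 * (\<Sum>n<N. v n * b n) + Re (\<Sum>n<N. complex_of_real (v n) * (of_real (b n) * e n))"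
  proof -
    have "complex_of_real (\<Sum>n<N. v n * b n * q n) =
      complex_of_real (\<kappa>0 * (\<Sum>n<N. v n * b n)) + (\<Sum>n<N. complex_of_real (v n) * (of_real (b n) * e n))"
      by (simp add: q_eq sum_distrib_left sum.distrib[symmetric] algebra_simps)
    then show ?thesis by (metis Re_complex_of_real plus_complex.sel(1))
  qed
  finally have le: "\<kappa>0 * (\<Sum>n<N. v n * b n) + Re (\<Sum>n<N. complex_of_real (v n) * (of_real (b n) * e n)) \<le> 0" .
  have "(\<Sum>n<N. v n / 2) \<le> (\<Sum>n<N. v n * b n)"
  proof (rule sum_mono)
    fix n
    show "v n / 2 \<le> v n * b n"
      using b[of n] v(2)[of n] mult_left_mono[of "1/2" "b n" "v n"] by (cases "v n = 0") auto
  qed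
  then have "\<kappa> * real N / 2 \<le> (\<Sum>n<N. v n * b n)" using sum_v by (simp add: sum_divide_distrib[symmetric])
  then have "\<kappa>0 * (\<kappa> * real N / 2) \<le> \<kappa>0 * (\<Sum>n<N. v n * b n)" using \<open>\<kappa>0 > 0\<close> by (intro mult_left_mono) auto
  moreover have "- (\<kappa>0 * \<kappa> / 4 * real N) \<le> Re (\<Sum>n<N. complex_of_real (v n) * (of_real (b n) * e n))"
    using small abs_Re_le_cmod[of "\<Sum>n<N. complex_of_real (v n) * (of_real (b n) * e n)"] by linarith
  moreover have "\<kappa>0 * \<kappa> * real N > 0" using \<kappa>(1) \<open>\<kappa>0 > 0\<close> N(2) by simp
  ultimately show False using le by (simp add: field_simps)
qed

lemma funpow_map_prod:
  fixes f :: "'a \<Rightarrow> 'a" and g :: "'b \<Rightarrow> 'b"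
  shows "(map_prod f g ^^ n) (a, b) = ((f ^^ n) a, (g ^^ n) b)"
  by (induction n) auto

text \<open>
  In the coordinates of the target, closeness in the two torus coordinates is read off from the
  values of \<open>\<xi>\<close> on the functions \<open>e(n\<alpha>)\<close> and \<open>e(n\<beta>)\<close>.  Rounding \<open>y\<^sub>n - y'\<close> to the nearest integer is the
  floor in the fibre coordinate for \<open>y0 = y' - 1/2\<close>, so the previous lemma controls exactly
  the third coordinate of the representative near \<open>(x', y', z')\<close>.
\<close>
lemma fiber_product_orbit_hit:
  assumes ind: "rationally_independent \<alpha> \<beta>"
    and p: "p \<in> topspace (fiber_product (gelfand_space weyl_algebra) (weyl_proj \<alpha> \<beta>) nil_space nil_proj)"
    and U: "openin (fiber_product (gelfand_space weyl_algebra) (weyl_proj \<alpha> \<beta>) nil_space nil_proj) U" "U \<noteq> {}"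
  shows "\<exists>n::nat. (map_prod (gelfand_shift weyl_algebra) (nil_translation \<alpha> \<beta> \<gamma>) ^^ n) p \<in> U"
proof -
  let ?X = "gelfand_space weyl_algebra" and ?S = "gelfand_shift weyl_algebra" and ?T = "nil_translation \<alpha> \<beta> \<gamma>"
  let ?P = "fiber_product ?X (weyl_proj \<alpha> \<beta>) nil_space nil_proj"
  have coords: "\<exists>\<xi> x y z. u = (\<xi>, hcoset Zlat (x, y, z)) \<and> \<xi> \<in> characters weyl_algebra \<and>
      \<xi> (weyl_function 1 \<alpha>) = ee x \<and> \<xi> (weyl_function 1 \<beta>) = ee y" if uP: "u \<in> topspace ?P" for u
  proof -
    obtain \<xi> C where u: "u = (\<xi>, C)" "\<xi> \<in> characters weyl_algebra" "C \<in> topspace nil_space" "weyl_proj \<alpha> \<beta> \<xi> = nil_proj C"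
      using uP unfolding topspace_fiber_product W.topspace_gelfand by blast
    obtain x y z where C: "C = hcoset Zlat (x, y, z)" using u(3) by (auto simp: nil_space_eq)
    obtain a where a: "\<xi> (weyl_function 1 \<alpha>) = ee a" by (rule char_weyl_function[OF u(2)])
    obtain b where b: "\<xi> (weyl_function 1 \<beta>) = ee b" by (rule char_weyl_function[OF u(2)])
    have "hcoset Zcen (x, y, z) = hcoset Zcen (a, b, 0)"
      using u(4) weyl_proj_hcoset[OF a b, of 0] by (simp add: C nil_proj_hcoset)
    then have "ee a = ee x" "ee b = ee y" by (auto simp: hcoset_Zcen_eq_iff ee_eq_iff)
    then show ?thesis using u C a b by metis
  qed
  obtain \<xi> x y z where pp: "p = (\<xi>, hcoset Zlat (x, y, z))" "\<xi> \<in> characters weyl_algebra"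
    "\<xi> (weyl_function 1 \<alpha>) = ee x" "\<xi> (weyl_function 1 \<beta>) = ee y"
    using coords[OF p] by blast
  obtain u where u: "u \<in> U" using U(2) by blast
  then have uP: "u \<in> topspace ?P" using openin_subset[OF U(1)] by blast
  obtain \<xi>' x' y' z' where uu: "u = (\<xi>', hcoset Zlat (x', y', z'))" "\<xi>' \<in> characters weyl_algebra"
    "\<xi>' (weyl_function 1 \<alpha>) = ee x'" "\<xi>' (weyl_function 1 \<beta>) = ee y'"
    using coords[OF uP] by blast
  obtain Q where Q: "openin (prod_topology ?X nil_space) Q" "U = Q \<inter> topspace ?P"
    using U(1) unfolding fiber_product_def openin_subtopology by auto
  have "(\<xi>', hcoset Zlat (x', y', z')) \<in> Q" using u Q(2) uu(1) by blast
  from Q(1)[unfolded openin_prod_topology_alt, THEN spec, THEN spec, THEN mp, OF this]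
  obtain U1 U2 where U12: "openin ?X U1" "openin nil_space U2" "\<xi>' \<in> U1" "hcoset Zlat (x', y', z') \<in> U2" "U1 \<times> U2 \<subseteq> Q"
    by (elim exE conjE)
  obtain F \<epsilon>1 where F: "finite F" "F \<subseteq> weyl_algebra" "\<epsilon>1 > 0"
    "\<And>\<eta>. \<eta> \<in> characters weyl_algebra \<Longrightarrow> (\<And>f. f \<in> F \<Longrightarrow> cmod (\<eta> f - \<xi>' f) < \<epsilon>1) \<Longrightarrow> \<eta> \<in> U1"
    by (rule W.gelfand_nbhd[OF U12(1,3)]) blast
  have "open (hcoset Zlat -` U2)" using U12(2) unfolding nil_space_eq openin_coset_space by blast
  moreover have "(x', y', z') \<in> hcoset Zlat -` U2" using U12(4) by simp
  ultimately obtain \<delta> where \<delta>: "\<delta> > 0"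
    "\<And>a b c. \<bar>a - x'\<bar> < \<delta> \<Longrightarrow> \<bar>b - y'\<bar> < \<delta> \<Longrightarrow> \<bar>c - z'\<bar> < \<delta> \<Longrightarrow> (a, b, c) \<in> hcoset Zlat -` U2"
    by (rule open_triple_box) blast
  obtain \<epsilon>2 where \<epsilon>2: "\<epsilon>2 > 0" "\<And>t. cmod (ee t - 1) < \<epsilon>2 \<Longrightarrow> \<bar>t - of_int (round t)\<bar> < \<delta>"
    by (rule ee_near_1_imp_near_int[OF \<delta>(1)]) blast
  define F' where "F' = F \<union> {weyl_function 1 \<alpha>, weyl_function 1 \<beta>}"
  have F': "finite F'" "F' \<subseteq> weyl_algebra" using F weyl_function_in_weyl by (auto simp: F'_def)
  have "min \<epsilon>1 \<epsilon>2 > 0" using F(3) \<epsilon>2(1) by simp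
  then obtain n where n: "\<And>f. f \<in> F' \<Longrightarrow> cmod (\<xi> (\<lambda>k. f (k + int n)) - \<xi>' f) < min \<epsilon>1 \<epsilon>2"
    "cmod (ee (fiber_coord \<alpha> \<beta> \<gamma> x y z (y' - 1/2) n - z') - 1) < min \<epsilon>1 \<epsilon>2"
    by (rule fiber_orbit_hit[OF ind pp(2,4) uu(2,4) F']) blast
  have in1: "(?S ^^ n) \<xi> \<in> U1"
  proof (rule F(4))
    show "(?S ^^ n) \<xi> \<in> characters weyl_algebra"
      unfolding W.gelfand_shift_funpow[OF pp(2)] by (rule W.char_translate[OF pp(2)])
    fix f assume "f \<in> F"
    then show "cmod ((?S ^^ n) \<xi> f - \<xi>' f) < \<epsilon>1"
      using n(1)[of f] F(2) unfolding W.gelfand_shift_funpow[OF pp(2)] by (auto simp: F'_def)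
  qed
  have freq: "cmod (ee (t + real n * \<theta> - t') - 1) < \<epsilon>2"
    if "weyl_function 1 \<theta> \<in> F'" "\<xi> (weyl_function 1 \<theta>) = ee t" "\<xi>' (weyl_function 1 \<theta>) = ee t'" for \<theta> t t'
    using n(1)[OF that(1)] unfolding char_weyl_function_translate[OF pp(2)] that(2,3) ee_add[symmetric] cmod_ee_diff
    by (simp add: add.commute)
  define X Y Z where "X = x + real n * \<alpha>" and "Y = y + real n * \<beta>"
    and "Z = z + real n * \<gamma> + (real n)\<^sup>2 * \<alpha> * \<beta> / 2 + real n * \<alpha> * y"
  define a k r where "a = round (X - x')" and "k = round (Y - y')" and "r = round (Z - X * of_int k - z')"
  have k: "\<lfloor>y + real n * \<beta> - (y' - 1/2)\<rfloor> = k" unfolding k_def Y_def round_def by (simp add: algebra_simps)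
  have "fiber_coord \<alpha> \<beta> \<gamma> x y z (y' - 1/2) n = Z - X * of_int k"
    unfolding fiber_coord_def k by (simp add: Z_def X_def)
  then have "cmod (ee (Z - X * of_int k - z') - 1) < \<epsilon>2" using n(2) by simp
  then have dz: "\<bar>Z - X * of_int k - z' - of_int r\<bar> < \<delta>" unfolding r_def by (rule \<epsilon>2(2))
  have dx: "\<bar>X - x' - of_int a\<bar> < \<delta>" unfolding a_def
    by (rule \<epsilon>2(2)) (use freq[OF _ pp(3) uu(3)] in \<open>simp add: F'_def X_def\<close>)
  have dy: "\<bar>Y - y' - of_int k\<bar> < \<delta>" unfolding k_def
    by (rule \<epsilon>2(2)) (use freq[OF _ pp(4) uu(4)] in \<open>simp add: F'_def Y_def\<close>)
  have s: "(- of_int a, - of_int k, - of_int r) \<in> Zlat" by auto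
  have "(?T ^^ n) (hcoset Zlat (x, y, z)) = hcoset Zlat (X, Y, Z)"
    unfolding nil_translation_funpow X_def Y_def Z_def ..
  also have "\<dots> = hcoset Zlat (X - of_int a, Y - of_int k, Z - X * of_int k - of_int r)"
    using hcoset_hmul[OF hsubgroup_Zlat s, of "(X, Y, Z)"] by (simp add: algebra_simps)
  also have "\<dots> \<in> U2"
    using \<delta>(2)[of "X - of_int a" "Y - of_int k" "Z - X * of_int k - of_int r"] dx dy dz by (simp add: algebra_simps)
  finally have in2: "(?T ^^ n) (hcoset Zlat (x, y, z)) \<in> U2" .
  have "flow ?P (map_prod ?S ?T)"
    by (rule flow_fiber_product[OF flow_hom_weyl_proj[OF ind] flow_hom_nil_proj])
  then have "\<And>v. v \<in> topspace ?P \<Longrightarrow> map_prod ?S ?T v \<in> topspace ?P"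
    unfolding flow_def using homeomorphic_imp_surjective_map by blast
  then have "(map_prod ?S ?T ^^ n) p \<in> topspace ?P" using p by (induction n) auto
  moreover have "(map_prod ?S ?T ^^ n) p \<in> Q" using in1 in2 U12(5) unfolding pp(1) funpow_map_prod by blast
  ultimately show ?thesis using Q(2) by blast
qed

theorem theorem5p2:
  fixes \<alpha> \<beta> \<gamma> :: real
  assumes "\<forall>p q r :: rat. of_rat p + of_rat q * \<alpha> + of_rat r * \<beta> = 0 \<longrightarrow> p = 0 \<and> q = 0 \<and> r = 0"
  shows "minimal_flow nil_space (nil_translation \<alpha> \<beta> \<gamma>) \<and>
    largest_equicontinuous_factor
      nil_space (nil_translation \<alpha> \<beta> \<gamma>) torus_space (nil_translation \<alpha> \<beta> \<gamma>) nil_proj \<and>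
    relatively_disjoint_over
      (gelfand_space weyl_algebra) (gelfand_shift weyl_algebra) (weyl_proj \<alpha> \<beta>)
      nil_space (nil_translation \<alpha> \<beta> \<gamma>) nil_proj
      torus_space (nil_translation \<alpha> \<beta> \<gamma>)"
proof -
  have ind: "rationally_independent \<alpha> \<beta>" using assms by (simp add: rationally_independent_def)
  let ?X = "gelfand_space weyl_algebra" and ?S = "gelfand_shift weyl_algebra" and ?T = "nil_translation \<alpha> \<beta> \<gamma>"
  let ?P = "fiber_product ?X (weyl_proj \<alpha> \<beta>) nil_space nil_proj"
  note hom = flow_hom_weyl_proj[OF ind, of \<gamma>] flow_hom_nil_proj[of \<alpha> \<beta> \<gamma>]
  have min: "minimal_flow ?P (map_prod ?S ?T)"
    by (rule minimal_flowI[OF flow_fiber_product[OF hom] fiber_product_orbit_hit[OF ind]])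
  have lift: "\<exists>\<xi>. (\<xi>, C) \<in> topspace ?P" if "C \<in> topspace nil_space" for C
  proof -
    have "nil_proj C \<in> weyl_proj \<alpha> \<beta> ` topspace ?X" using hom that unfolding flow_hom_def by blast
    then show ?thesis using that by (auto simp: topspace_fiber_product)
  qed
  have hit: "\<exists>n::nat. (?T ^^ n) C \<in> U"
    if CU: "C \<in> topspace nil_space" "openin nil_space U" "U \<noteq> {}" for C U
  proof -
    obtain \<xi> where \<xi>: "(\<xi>, C) \<in> topspace ?P" using lift[OF CU(1)] by blast
    obtain D where "D \<in> U" using CU(3) by blast
    then obtain \<eta> where \<eta>: "(\<eta>, D) \<in> topspace ?P" using lift openin_subset[OF CU(2)] by blast
    have "continuous_map ?P nil_space snd"
      unfolding fiber_product_def by (intro continuous_map_from_subtopology continuous_map_snd)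
    then have "openin ?P {v \<in> topspace ?P. snd v \<in> U}" using CU(2) by (rule openin_continuous_map_preimage)
    moreover have "(\<eta>, D) \<in> {v \<in> topspace ?P. snd v \<in> U}" using \<eta> \<open>D \<in> U\<close> by simp
    ultimately obtain n where "(map_prod ?S ?T ^^ n) (\<xi>, C) \<in> {v \<in> topspace ?P. snd v \<in> U}"
      using fiber_product_orbit_hit[OF ind \<xi>] by blast
    then show ?thesis by (auto simp: funpow_map_prod)
  qed
  have "\<alpha> \<noteq> 0" using rationally_independentD(2)[OF ind, of 0 1 0] by auto
  then have "largest_equicontinuous_factor nil_space ?T torus_space ?T nil_proj"
    using hit by (rule largest_equicontinuous_factor_nil)
  moreover have "minimal_flow nil_space ?T" by (rule minimal_flowI[OF flow_nil hit])
  ultimately show ?thesis unfolding relatively_disjoint_over_def using hom min by blast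
qed

end
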